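(* For every real number $\alpha>0$, the Riemannian Lie group $\mathrm{Sol}^3_\alpha$ admits no non-constant local harmonic morphisms to surfaces; that is, if $U\subset\mathrm{Sol}^3_\alpha$ is a non-empty connected open subset, $(N^2,h)$ is a $2$-dimensional Riemannian manifold and $\phi:U\to N^2$ is a harmonic morphism, then $\phi$ is constant.
   Context: For $\alpha>0$, $\mathrm{Sol}^3_\alpha$ denotes the simply connected Lie group whose Lie algebra has a basis $X,Y,Z$ with $[Z,X]=\alpha X$, $[Z,Y]=-Y$, $[X,Y]=0$, equipped with the left-invariant Riemannian metric for which $\{X,Y,Z\}$ is orthonormal at the identity. (The Thurston geometry Sol is $\mathrm{Sol}^3_1$.) A (smooth) map $\phi:(M,g)\to(N,h)$ between Riemannian manifolds is a harmonic morphism if, for every harmonic function $f:W\to\mathbb{R}$ defined on an open subset $W$ of $N$ with $\phi^{-1}(W)$ non-empty, the composition $f\circ\phi:\phi^{-1}(W)\to\mathbb{R}$ is harmonic. Open subsets carry the induced metric. *)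

theory Defs
  imports "HOL-Analysis.Analysis"
begin

section \<open>Smooth maps between open subsets of Euclidean spaces\<close>

primrec higher_differentiable_on ::
    "'a::real_normed_vector set \<Rightarrow> ('a \<Rightarrow> 'b::real_normed_vector) \<Rightarrow> nat \<Rightarrow> bool" where
  "higher_differentiable_on S f 0 \<longleftrightarrow> continuous_on S f"
| "higher_differentiable_on S f (Suc n) \<longleftrightarrow>
     (\<forall>x\<in>S. f differentiable (at x)) \<and>
     (\<forall>v. higher_differentiable_on S (\<lambda>x. frechet_derivative f (at x) v) n)"

text \<open>\<open>C\<^sup>\<infinity>\<close> maps; only meaningful for open \<open>S\<close>, where all derivatives up to order
  \<open>n\<close> exist and are continuous for every \<open>n\<close>.\<close>

definition smooth_on :: "'a::real_normed_vector set \<Rightarrow> ('a \<Rightarrow> 'b::real_normed_vector) \<Rightarrow> bool" where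
  "smooth_on S f \<longleftrightarrow> (\<forall>n. higher_differentiable_on S f n)"


section \<open>Riemannian manifolds\<close>

text \<open>A chart is a pair of its domain and its coordinate map, whose values outside the domain are
  irrelevant.  The manifold given by an atlas is the union of the chart domains; it is an open
  subset of its ambient Hausdorff, second countable type.\<close>

type_synonym ('a, 'n) chart = "'a set \<times> ('a \<Rightarrow> real^'n)"

definition smooth_atlas ::
    "('a::{second_countable_topology, t2_space}, 'n::finite) chart set \<Rightarrow> bool" where
  "smooth_atlas A \<longleftrightarrow>
     (\<forall>(D, \<psi>)\<in>A. open D \<and> open (\<psi> ` D) \<and> homeomorphism D (\<psi> ` D) \<psi> (inv_into D \<psi>)) \<and>
     (\<forall>(D, \<psi>)\<in>A. \<forall>(E, \<eta>)\<in>A. smooth_on (\<psi> ` (D \<inter> E)) (\<eta> \<circ> inv_into D \<psi>))"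

definition manifold_carrier :: "('a, 'n::finite) chart set \<Rightarrow> 'a set" where
  "manifold_carrier A = (\<Union>(D, \<psi>)\<in>A. D)"

text \<open>A metric assigns to every chart \<open>(D, \<psi>)\<close> its coordinate expression:
  \<open>g (D, \<psi>) x u v\<close> is the inner product of the tangent vectors at the point with coordinates
  \<open>x \<in> \<psi> ` D\<close> whose components are \<open>u\<close> and \<open>v\<close>.  The last conjunct is the transformation rule of
  a covariant 2-tensor under the change of coordinates.\<close>

type_synonym ('a, 'n) metric = "('a, 'n) chart \<Rightarrow> real^'n \<Rightarrow> real^'n \<Rightarrow> real^'n \<Rightarrow> real"

definition riemannian_manifold ::
    "('a::{second_countable_topology, t2_space}, 'n::finite) chart set \<Rightarrow> ('a, 'n) metric \<Rightarrow> bool" where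
  "riemannian_manifold A g \<longleftrightarrow>
     smooth_atlas A \<and>
     (\<forall>(D, \<psi>)\<in>A.
        (\<forall>x\<in>\<psi> ` D.
           bilinear (g (D, \<psi>) x) \<and>
           (\<forall>u v. g (D, \<psi>) x u v = g (D, \<psi>) x v u) \<and>
           (\<forall>u. u \<noteq> 0 \<longrightarrow> g (D, \<psi>) x u u > 0)) \<and>
        (\<forall>u v. smooth_on (\<psi> ` D) (\<lambda>x. g (D, \<psi>) x u v))) \<and>
     (\<forall>(D, \<psi>)\<in>A. \<forall>(E, \<eta>)\<in>A. \<forall>x\<in>\<psi> ` (D \<inter> E). \<forall>u v.
        let \<tau> = \<eta> \<circ> inv_into D \<psi>; d\<tau> = frechet_derivative \<tau> (at x)
        in g (D, \<psi>) x u v = g (E, \<eta>) (\<tau> x) (d\<tau> u) (d\<tau> v))"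

definition smooth_map_on ::
    "('a::topological_space, 'm::finite) chart set \<Rightarrow> 'a set \<Rightarrow>
     ('b::topological_space, 'n::finite) chart set \<Rightarrow> ('a \<Rightarrow> 'b) \<Rightarrow> bool" where
  "smooth_map_on A U B \<phi> \<longleftrightarrow>
     \<phi> ` U \<subseteq> manifold_carrier B \<and> continuous_on U \<phi> \<and>
     (\<forall>(D, \<psi>)\<in>A. \<forall>(E, \<eta>)\<in>B.
        smooth_on (\<psi> ` (D \<inter> U \<inter> \<phi> -` E)) (\<eta> \<circ> \<phi> \<circ> inv_into D \<psi>))"


section \<open>Harmonic functions and harmonic morphisms\<close>

definition partial_deriv :: "'n::finite \<Rightarrow> (real^'n \<Rightarrow> real) \<Rightarrow> real^'n \<Rightarrow> real" where
  "partial_deriv i f x = frechet_derivative f (at x) (axis i 1)"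

definition gram_matrix :: "(real^'n \<Rightarrow> real^'n \<Rightarrow> real) \<Rightarrow> real^'n^'n::finite" where
  "gram_matrix b = (\<chi> i j. b (axis i 1) (axis j 1))"

text \<open>The Laplace--Beltrami operator in local coordinates:
  \<open>1 / sqrt |g| * (\<Sum>i. \<partial>\<^sub>i (sqrt |g| * (\<Sum>j. g\<^sup>i\<^sup>j * \<partial>\<^sub>j f)))\<close>.\<close>

definition laplace_beltrami ::
    "(real^'n \<Rightarrow> real^'n \<Rightarrow> real^'n \<Rightarrow> real) \<Rightarrow> (real^'n::finite \<Rightarrow> real) \<Rightarrow> real^'n \<Rightarrow> real" where
  "laplace_beltrami b f x =
     1 / sqrt (det (gram_matrix (b x))) *
     (\<Sum>i\<in>UNIV. partial_deriv i
        (\<lambda>y. sqrt (det (gram_matrix (b y))) *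
             (\<Sum>j\<in>UNIV. matrix_inv (gram_matrix (b y)) $ i $ j * partial_deriv j f y)) x)"

definition harmonic_on ::
    "('a, 'n::finite) chart set \<Rightarrow> ('a, 'n) metric \<Rightarrow> 'a set \<Rightarrow> ('a \<Rightarrow> real) \<Rightarrow> bool" where
  "harmonic_on A g W f \<longleftrightarrow>
     (\<forall>(D, \<psi>)\<in>A.
        smooth_on (\<psi> ` (D \<inter> W)) (f \<circ> inv_into D \<psi>) \<and>
        (\<forall>x\<in>\<psi> ` (D \<inter> W). laplace_beltrami (g (D, \<psi>)) (f \<circ> inv_into D \<psi>) x = 0))"

text \<open>Harmonic morphisms from the open submanifold \<open>U\<close> of \<open>(A, g)\<close>, with the induced metric, to
  \<open>(B, h)\<close>.\<close>

definition harmonic_morphism ::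
    "('a::topological_space, 'm::finite) chart set \<Rightarrow> ('a, 'm) metric \<Rightarrow> 'a set \<Rightarrow>
     ('b::topological_space, 'n::finite) chart set \<Rightarrow> ('b, 'n) metric \<Rightarrow> ('a \<Rightarrow> 'b) \<Rightarrow> bool" where
  "harmonic_morphism A g U B h \<phi> \<longleftrightarrow>
     smooth_map_on A U B \<phi> \<and>
     (\<forall>W f. open W \<and> W \<subseteq> manifold_carrier B \<and> U \<inter> \<phi> -` W \<noteq> {} \<and> harmonic_on B h W f
        \<longrightarrow> harmonic_on A g (U \<inter> \<phi> -` W) (f \<circ> \<phi>))"


section \<open>The Riemannian Lie group \<open>Sol\<close> with parameter \<open>\<alpha>\<close>\<close>

text \<open>The simply connected Lie group with the prescribed Lie algebra is unique up to isomorphism.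
  We use its realisation on \<open>\<real>\<^sup>3\<close> as the semidirect product of \<open>\<real>\<^sup>2\<close> and \<open>\<real>\<close> in which \<open>z\<close> acts by
  \<open>diag (exp (\<alpha> z), exp (- z))\<close>; the lemmas at the end of this section show that it has the
  defining properties.\<close>

definition sol_mult :: "real \<Rightarrow> real^3 \<Rightarrow> real^3 \<Rightarrow> real^3" where
  "sol_mult \<alpha> p q = vector [p$1 + exp (\<alpha> * p$3) * q$1, p$2 + exp (- p$3) * q$2, p$3 + q$3]"

definition sol_inverse :: "real \<Rightarrow> real^3 \<Rightarrow> real^3" where
  "sol_inverse \<alpha> p = vector [- (exp (- (\<alpha> * p$3)) * p$1), - (exp (p$3) * p$2), - p$3]"

definition sol_atlas :: "(real^3, 3) chart set" where
  "sol_atlas = {(UNIV, id)}"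

text \<open>The left-invariant metric extending the standard inner product at the identity: tangent
  vectors at \<open>p\<close> are moved to the identity by the differential of the left translation by the
  inverse of \<open>p\<close>.\<close>

definition sol_metric :: "real \<Rightarrow> (real^3, 3) metric" where
  "sol_metric \<alpha> c p u v =
     (let dL = frechet_derivative (sol_mult \<alpha> (sol_inverse \<alpha> p)) (at p) in dL u \<bullet> dL v)"

definition sol_left_invariant_field :: "real \<Rightarrow> real^3 \<Rightarrow> real^3 \<Rightarrow> real^3" where
  "sol_left_invariant_field \<alpha> u p = frechet_derivative (sol_mult \<alpha> p) (at 0) u"

definition lie_bracket ::
    "('a::real_normed_vector \<Rightarrow> 'a) \<Rightarrow> ('a \<Rightarrow> 'a) \<Rightarrow> 'a \<Rightarrow> 'a" where
  "lie_bracket V W p = frechet_derivative W (at p) (V p) - frechet_derivative V (at p) (W p)"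

abbreviation sol_X :: "real \<Rightarrow> real^3 \<Rightarrow> real^3" where
  "sol_X \<alpha> \<equiv> sol_left_invariant_field \<alpha> (axis 1 1)"

abbreviation sol_Y :: "real \<Rightarrow> real^3 \<Rightarrow> real^3" where
  "sol_Y \<alpha> \<equiv> sol_left_invariant_field \<alpha> (axis 2 1)"

abbreviation sol_Z :: "real \<Rightarrow> real^3 \<Rightarrow> real^3" where
  "sol_Z \<alpha> \<equiv> sol_left_invariant_field \<alpha> (axis 3 1)"

lemma sol_group: "group (sol_mult \<alpha>) 0 (sol_inverse \<alpha>)"
proof
  fix a b c :: "real^3"
  have "exp (- (a$3 + b$3)) = exp (- a$3) * exp (- b$3)"
    by (simp flip: exp_add)
  then show "sol_mult \<alpha> (sol_mult \<alpha> a b) c = sol_mult \<alpha> a (sol_mult \<alpha> b c)"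
    by (simp add: sol_mult_def vec_eq_iff forall_3 exp_add algebra_simps)
  show "sol_mult \<alpha> 0 a = a"
    by (simp add: sol_mult_def vec_eq_iff forall_3)
  show "sol_mult \<alpha> (sol_inverse \<alpha> a) a = 0"
    by (simp add: sol_mult_def sol_inverse_def vec_eq_iff forall_3)
qed

lemma sol_simply_connected: "simply_connected (manifold_carrier sol_atlas)"
  by (simp add: manifold_carrier_def sol_atlas_def convex_imp_simply_connected)

lemma vector3_eq_axis: "vector [a, b, c] = a *\<^sub>R axis 1 1 + b *\<^sub>R axis 2 1 + (c *\<^sub>R axis 3 1 :: real^3)"
  by (simp add: vec_eq_iff forall_3 axis_def)

lemma has_derivative_vec_nth: "((\<lambda>x::real^'n::finite. x $ i) has_derivative (\<lambda>x. x $ i)) F"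
  by (rule bounded_linear_imp_has_derivative[OF bounded_linear_vec_nth])

lemma sol_mult_has_derivative:
  "(sol_mult \<alpha> p has_derivative
     (\<lambda>u. vector [exp (\<alpha> * p$3) * u$1, exp (- p$3) * u$2, u$3])) (at q)"
  unfolding sol_mult_def vector3_eq_axis
  by (auto intro!: derivative_eq_intros has_derivative_vec_nth)

lemma frechet_derivative_sol_mult:
  "frechet_derivative (sol_mult \<alpha> p) (at q) =
     (\<lambda>u. vector [exp (\<alpha> * p$3) * u$1, exp (- p$3) * u$2, u$3])"
  by (rule frechet_derivative_at[OF sol_mult_has_derivative, symmetric])

lemma sol_metric_eq:
  "sol_metric \<alpha> c p u v =
     exp (- 2 * \<alpha> * p$3) * u$1 * v$1 + exp (2 * p$3) * u$2 * v$2 + u$3 * v$3"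
proof -
  have "exp (- (2 * \<alpha> * p$3)) = exp (- (\<alpha> * p$3)) * exp (- (\<alpha> * p$3))"
       "exp (2 * p$3) = exp (p$3) * exp (p$3)"
    by (simp_all flip: exp_add)
  then show ?thesis
    by (simp add: sol_metric_def frechet_derivative_sol_mult sol_inverse_def inner_vec_def sum_3)
qed

lemma sol_left_invariant_field_eq:
  "sol_left_invariant_field \<alpha> u p = vector [exp (\<alpha> * p$3) * u$1, exp (- p$3) * u$2, u$3]"
  by (simp add: sol_left_invariant_field_def frechet_derivative_sol_mult)

lemma sol_left_invariant_field_invariant:
  "frechet_derivative (sol_mult \<alpha> a) (at p) (sol_left_invariant_field \<alpha> u p) =
     sol_left_invariant_field \<alpha> u (sol_mult \<alpha> a p)"
proof -
  have "exp (\<alpha> * (a$3 + p$3)) = exp (\<alpha> * a$3) * exp (\<alpha> * p$3)"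
       "exp (- (a$3 + p$3)) = exp (- a$3) * exp (- p$3)"
    by (simp_all add: algebra_simps flip: exp_add)
  then show ?thesis
    by (simp add: frechet_derivative_sol_mult sol_left_invariant_field_eq sol_mult_def
        vec_eq_iff forall_3)
qed

lemma sol_left_invariant_field_0: "sol_left_invariant_field \<alpha> u 0 = u"
  by (simp add: sol_left_invariant_field_eq vec_eq_iff forall_3)

lemma sol_metric_left_invariant:
  "sol_metric \<alpha> c (sol_mult \<alpha> a p)
     (frechet_derivative (sol_mult \<alpha> a) (at p) u) (frechet_derivative (sol_mult \<alpha> a) (at p) v) =
   sol_metric \<alpha> c p u v"
proof -
  have "exp (- 2 * \<alpha> * (a$3 + p$3)) * exp (\<alpha> * a$3) * exp (\<alpha> * a$3) = exp (- 2 * \<alpha> * p$3)"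
       "exp (2 * (a$3 + p$3)) * exp (- a$3) * exp (- a$3) = exp (2 * p$3)"
    by (simp_all add: algebra_simps flip: exp_add)
  note e = this
  have "sol_metric \<alpha> c (sol_mult \<alpha> a p)
     (frechet_derivative (sol_mult \<alpha> a) (at p) u) (frechet_derivative (sol_mult \<alpha> a) (at p) v) =
     (exp (- 2 * \<alpha> * (a$3 + p$3)) * exp (\<alpha> * a$3) * exp (\<alpha> * a$3)) * u$1 * v$1 +
     (exp (2 * (a$3 + p$3)) * exp (- a$3) * exp (- a$3)) * u$2 * v$2 + u$3 * v$3"
    by (simp add: sol_metric_eq frechet_derivative_sol_mult sol_mult_def)
  also have "\<dots> = sol_metric \<alpha> c p u v"
    unfolding e by (simp add: sol_metric_eq)
  finally show ?thesis .
qed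

lemma sol_metric_0: "sol_metric \<alpha> c 0 u v = u \<bullet> v"
  by (simp add: sol_metric_eq inner_vec_def sum_3)

lemma has_derivative_exp_coordinate:
  "((\<lambda>p::real^3. exp (k * p$3)) has_derivative (\<lambda>v. k * v$3 * exp (k * p$3))) (at p)"
  by (rule has_derivative_exp[OF has_derivative_mult_right[OF has_derivative_vec_nth]])

lemma sol_left_invariant_field_has_derivative:
  "(sol_left_invariant_field \<alpha> u has_derivative
     (\<lambda>v. vector [\<alpha> * v$3 * exp (\<alpha> * p$3) * u$1, - v$3 * exp (- p$3) * u$2, 0])) (at p)"
proof -
  have "((\<lambda>p::real^3. exp (- p$3)) has_derivative (\<lambda>v. - v$3 * exp (- p$3))) (at p)"
    using has_derivative_exp_coordinate[of "-1" p] by simp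
  note d = has_derivative_exp_coordinate[of \<alpha> p] this
  show ?thesis
    unfolding sol_left_invariant_field_eq[abs_def] vector3_eq_axis
    by (intro has_derivative_add has_derivative_scaleR_left has_derivative_mult_left d has_derivative_const)
qed

lemma frechet_derivative_sol_left_invariant_field:
  "frechet_derivative (sol_left_invariant_field \<alpha> u) (at p) =
     (\<lambda>v. vector [\<alpha> * v$3 * exp (\<alpha> * p$3) * u$1, - v$3 * exp (- p$3) * u$2, 0])"
  by (rule frechet_derivative_at[OF sol_left_invariant_field_has_derivative, symmetric])

lemma sol_brackets:
  "lie_bracket (sol_Z \<alpha>) (sol_X \<alpha>) = (\<lambda>p. \<alpha> *\<^sub>R sol_X \<alpha> p)"
  "lie_bracket (sol_Z \<alpha>) (sol_Y \<alpha>) = (\<lambda>p. - sol_Y \<alpha> p)"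
  "lie_bracket (sol_X \<alpha>) (sol_Y \<alpha>) = (\<lambda>p. 0)"
  by (simp_all add: fun_eq_iff lie_bracket_def frechet_derivative_sol_left_invariant_field
      sol_left_invariant_field_eq vec_eq_iff forall_3 axis_def)

lemma higher_differentiable_on_exp_sum:
  "higher_differentiable_on UNIV
     (\<lambda>p::real^3. a * exp (k * p$3) + b * exp (l * p$3) + c) n"
proof (induction n arbitrary: a b c)
  case 0
  show ?case by (auto intro!: continuous_intros)
next
  case (Suc n)
  have d: "((\<lambda>p::real^3. a * exp (k * p$3) + b * exp (l * p$3) + c) has_derivative
      (\<lambda>v. (a * k * v$3) * exp (k * p$3) + (b * l * v$3) * exp (l * p$3) + 0)) (at p)" for p
    unfolding mult.assoc[of a] mult.assoc[of b]
    by (intro has_derivative_add has_derivative_mult_right has_derivative_exp_coordinate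
        has_derivative_const)
  note fd = frechet_derivative_at[OF d, symmetric]
  show ?case
    unfolding higher_differentiable_on.simps fd
  proof (intro conjI ballI allI)
    show "(\<lambda>p::real^3. a * exp (k * p$3) + b * exp (l * p$3) + c) differentiable (at p)" for p
      using d unfolding differentiable_def by blast
  qed (rule Suc.IH)
qed

lemma higher_differentiable_on_id:
  "higher_differentiable_on UNIV (id :: 'a::real_normed_vector \<Rightarrow> 'a) n"
proof -
  have c: "higher_differentiable_on UNIV (\<lambda>x::'a. c::'a) m" for m c
    by (induction m arbitrary: c) (auto simp: frechet_derivative_const)
  show ?thesis
    by (cases n) (auto simp: c id_def)
qed

lemma sol_riemannian_manifold: "riemannian_manifold sol_atlas (sol_metric \<alpha>)"
proof -
  have smooth_id: "smooth_on UNIV (id :: real^3 \<Rightarrow> real^3)"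
    by (simp add: smooth_on_def higher_differentiable_on_id)
  have inv: "inv_into UNIV id = (id :: real^3 \<Rightarrow> real^3)"
    by (simp add: fun_eq_iff inv_f_eq)
  have atlas: "smooth_atlas sol_atlas"
    by (simp add: smooth_atlas_def sol_atlas_def inv smooth_id homeomorphism_def)
  have bil: "bilinear (sol_metric \<alpha> c p)" for c p
    unfolding bilinear_def linear_iff sol_metric_eq by (simp add: algebra_simps)
  have sym: "sol_metric \<alpha> c p u v = sol_metric \<alpha> c p v u" for c p u v
    by (simp add: sol_metric_eq)
  have pos: "sol_metric \<alpha> c p u u > 0" if "u \<noteq> 0" for c p u
  proof -
    have sq: "0 < r * s * s" if "r > 0" "s \<noteq> 0" for r s :: real
    proof -
      have "0 < s * s"
        using that(2) not_real_square_gt_zero by blast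
      then show ?thesis
        using mult_pos_pos[OF that(1)] by (simp only: mult.assoc)
    qed
    have nn: "0 \<le> r * s * s" if "r > 0" for r s :: real
      using sq[OF that] by (cases "s = 0") (auto simp: less_imp_le)
    let ?a = "exp (- 2 * \<alpha> * p$3)" and ?b = "exp (2 * p$3)"
    have "0 \<le> ?a * u$1 * u$1" "0 \<le> ?b * u$2 * u$2" "0 \<le> u$3 * u$3"
      using nn by simp_all
    moreover have "0 < ?a * u$1 * u$1 \<or> 0 < ?b * u$2 * u$2 \<or> 0 < u$3 * u$3"
    proof -
      have "u$1 \<noteq> 0 \<or> u$2 \<noteq> 0 \<or> u$3 \<noteq> 0"
        using that by (simp add: vec_eq_iff forall_3)
      then show ?thesis
        using sq[of ?a "u$1"] sq[of ?b "u$2"] sq[of 1 "u$3"] by auto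
    qed
    ultimately show ?thesis
      unfolding sol_metric_eq by linarith
  qed
  have smooth: "smooth_on UNIV (\<lambda>p. sol_metric \<alpha> c p u v)" for c u v
  proof -
    have "(\<lambda>p. sol_metric \<alpha> c p u v) =
        (\<lambda>p. (u$1 * v$1) * exp ((- 2 * \<alpha>) * p$3) + (u$2 * v$2) * exp (2 * p$3) + u$3 * v$3)"
      by (simp add: sol_metric_eq fun_eq_iff algebra_simps)
    then show ?thesis
      by (simp only: smooth_on_def higher_differentiable_on_exp_sum simp_thms)
  qed
  have trans: "frechet_derivative (id :: real^3 \<Rightarrow> real^3) (at x) = id" for x
    by (simp add: id_def)
  show ?thesis
    unfolding riemannian_manifold_def
    by (intro conjI atlas)
      (auto simp: sol_atlas_def inv trans bil pos smooth intro: sym)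
qed

end

(*
  On a surface a smooth metric can be written locally as E |dx + t dy|^2 with Im t > 0, and a solution
  of the Beltrami equation w_y = t w_x with w_x <> 0 is an isothermal coordinate: Re w, Im w, Re w^2
  and Im w^2 are harmonic.  The equation is solved on a torus: after rescaling and cutting off, t
  differs from a constant by a function of small norm in the Wiener algebra of absolutely convergent
  Fourier series, on which the operator d_x (d_y - t0 d_x)^{-1} is a bounded Fourier multiplier, so a
  Neumann series converges; weighted l^1 norms give smoothness.

  Pulling these functions back by a harmonic morphism gives a complex function F on an open subset of
  Sol with F and F^2 harmonic.  Hence F is harmonic with null gradient zeta = (p, q, r) in the
  left-invariant frame.  The covariant Hessian of F is symmetric, trace-free and annihilates zeta,
  which forces the trace of its square to vanish, and Bochner's formula applied to zeta . zeta = 0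
  leaves Ric(zeta, zeta) = 0, that is p^2 + alpha q^2 = 0.  Together with the null condition this
  fixes the ratios p : q : r up to sign, and closedness of dF then yields alpha p q = - p q, so
  zeta = 0 when alpha > 0.
*)
theory Submission
  imports Defs
begin

subsection \<open>Calculus of smooth functions\<close>

text \<open>Only \<open>w\<close> and \<open>w * w\<close> are ever pulled back, so one isothermal
  coordinate near each point of N is enough. As the metric is merely smooth, such a coordinate has
  to be constructed, and this shapes most of the development. The Wiener algebra is chosen because
  pointwise products and Fourier multipliers are both bounded on it by explicit constants, without
  singular integral estimates. For non-real t0 the symbol k1 / (k2 - t0 k1) is bounded by 1 / Im t0.
  The zero frequency, where it is undefined, is carried by an affine term of the coordinate. Making
  the oscillation of t smaller than Im t0 / 2 in norm gives convergence and also w_x <> 0. On Sol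
  neither connection nor curvature is introduced. The null condition and the harmonic equation are
  differentiated in the left-invariant frame, and the brackets exchange the derivatives. The
  relation so obtained is proved at every point, zeros of the gradient included, because it is
  itself differentiated afterwards. The case alpha = 1 is special: there r vanishes identically and
  its derivatives have to be found separately.\<close>

lemma hdiff_mono:
  "higher_differentiable_on S f (Suc n) \<Longrightarrow> higher_differentiable_on S f n"
proof (induction n arbitrary: f)
  case 0
  then show ?case
    by (auto intro!: differentiable_imp_continuous_on simp: differentiable_on_def
        differentiable_at_withinI)
next
  case (Suc n)
  then show ?case by auto
qed

lemma hdiff_subset:
  "higher_differentiable_on S f n \<Longrightarrow> T \<subseteq> S \<Longrightarrow> higher_differentiable_on T f n"
  by (induction n arbitrary: f) (auto intro: continuous_on_subset)

lemma frechet_derivative_cong_open: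
  assumes "open S" "x \<in> S" "\<And>y. y \<in> S \<Longrightarrow> f y = g y"
  shows "frechet_derivative f (at x) = frechet_derivative g (at x)"
proof -
  have "(f has_derivative D) (at x) \<longleftrightarrow> (g has_derivative D) (at x)" for D
    using has_derivative_transform_within_open[OF _ assms(1,2), of f D UNIV g]
      has_derivative_transform_within_open[OF _ assms(1,2), of g D UNIV f] assms(3) by auto
  then show ?thesis by (simp add: frechet_derivative_def)
qed

lemma differentiable_cong_open:
  assumes "open S" "x \<in> S" "\<And>y. y \<in> S \<Longrightarrow> f y = g y" "f differentiable (at x)"
  shows "g differentiable (at x)"
  using assms has_derivative_transform_within_open[OF _ assms(1,2), of f _ UNIV g]
  unfolding differentiable_def by blast

lemma hdiff_cong:
  assumes "open S" "\<And>y. y \<in> S \<Longrightarrow> f y = g y" "higher_differentiable_on S f n"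
  shows "higher_differentiable_on S g n"
  using assms(2,3)
proof (induction n arbitrary: f g)
  case 0
  then show ?case using continuous_on_cong by (metis higher_differentiable_on.simps(1))
next
  case (Suc n)
  show ?case
    unfolding higher_differentiable_on.simps
  proof (intro conjI ballI allI)
    fix x assume "x \<in> S"
    then show "g differentiable (at x)"
      using Suc.prems differentiable_cong_open[OF assms(1), of x f g] by auto
  next
    fix v
    have "higher_differentiable_on S (\<lambda>x. frechet_derivative f (at x) v) n"
      using Suc.prems by auto
    then show "higher_differentiable_on S (\<lambda>x. frechet_derivative g (at x) v) n"
      by (rule Suc.IH[rotated])
        (use frechet_derivative_cong_open[OF assms(1)] Suc.prems in metis)
  qed
qed

text \<open>Entry point of all inductions on the order: any formula for the derivative may be
  supplied, since derivatives are unique and the class respects pointwise equality on an open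
  set.\<close>

lemma hdiff_SucI:
  assumes "open S"
    and "\<And>x. x \<in> S \<Longrightarrow> (f has_derivative f' x) (at x)"
    and "\<And>v. higher_differentiable_on S (\<lambda>x. f' x v) n"
  shows "higher_differentiable_on S f (Suc n)"
  unfolding higher_differentiable_on.simps
proof (intro conjI ballI allI)
  fix x assume "x \<in> S"
  then show "f differentiable (at x)" using assms(2) differentiable_def by blast
next
  fix v
  show "higher_differentiable_on S (\<lambda>x. frechet_derivative f (at x) v) n"
    by (rule hdiff_cong[OF assms(1) _ assms(3)[of v]])
      (use assms(2) frechet_derivative_at in metis)
qed

lemma hdiff_SucD:
  assumes "higher_differentiable_on S f (Suc n)" "x \<in> S"
  shows "(f has_derivative frechet_derivative f (at x)) (at x)"
  using assms frechet_derivative_works by auto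

lemma hdiff_const: "open S \<Longrightarrow> higher_differentiable_on S (\<lambda>x. c) n"
proof (induction n arbitrary: c)
  case (Suc n)
  show ?case by (rule hdiff_SucI[where f' = "\<lambda>x v. 0"]) (use Suc in auto)
qed auto

lemma hdiff_bounded_linear:
  assumes "open S" "bounded_linear L"
  shows "higher_differentiable_on S L n"
proof (cases n)
  case 0
  then show ?thesis using assms linear_continuous_on by auto
next
  case (Suc m)
  show ?thesis unfolding Suc
    by (rule hdiff_SucI[where f' = "\<lambda>x. L"])
      (use assms bounded_linear_imp_has_derivative hdiff_const in auto)
qed

lemma hdiff_add:
  assumes "open S" "higher_differentiable_on S f n" "higher_differentiable_on S g n"
  shows "higher_differentiable_on S (\<lambda>x. f x + g x) n"
  using assms(2,3)
proof (induction n arbitrary: f g)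
  case (Suc n)
  show ?case
    by (rule hdiff_SucI[OF assms(1) has_derivative_add[OF hdiff_SucD[OF Suc.prems(1)] hdiff_SucD[OF Suc.prems(2)]]])
      (use Suc in auto)
qed (auto intro: continuous_intros)

lemma hdiff_sum:
  assumes "open S" "finite I" "\<And>i. i \<in> I \<Longrightarrow> higher_differentiable_on S (f i) n"
  shows "higher_differentiable_on S (\<lambda>x. \<Sum>i\<in>I. f i x) n"
  using assms(2,3) by (induction I rule: finite_induct) (auto intro: hdiff_add hdiff_const assms(1))

lemma hdiff_bilinear:
  assumes "open S" "bounded_bilinear B"
    "higher_differentiable_on S f n" "higher_differentiable_on S g n"
  shows "higher_differentiable_on S (\<lambda>x. B (f x) (g x)) n"
  using assms(3,4)
proof (induction n arbitrary: f g)
  case 0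
  then show ?case using bounded_bilinear.continuous_on[OF assms(2)] by auto
next
  case (Suc n)
  show ?case
    by (rule hdiff_SucI[OF assms(1) bounded_bilinear.FDERIV[OF assms(2) hdiff_SucD[OF Suc.prems(1)] hdiff_SucD[OF Suc.prems(2)]]])
      (use Suc hdiff_mono[OF Suc.prems(1)] hdiff_mono[OF Suc.prems(2)] in \<open>auto intro!: hdiff_add assms(1)\<close>)
qed

lemma hdiff_linear_compose:
  assumes "open S" "bounded_linear L" "higher_differentiable_on S f n"
  shows "higher_differentiable_on S (\<lambda>x. L (f x)) n"
  using assms(3)
proof (induction n arbitrary: f)
  case 0
  then show ?case using bounded_linear.continuous_on[OF assms(2)] by auto
next
  case (Suc n)
  show ?case
    by (rule hdiff_SucI[OF assms(1) bounded_linear.has_derivative[OF assms(2) hdiff_SucD[OF Suc.prems]]])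
      (use Suc in auto)
qed

lemma hdiff_compose:
  fixes g :: "'a::real_normed_vector \<Rightarrow> 'b::euclidean_space" and f :: "'b \<Rightarrow> 'c::real_normed_vector"
  assumes S: "open S" and T: "open T" and gST: "\<And>x. x \<in> S \<Longrightarrow> g x \<in> T"
    and g: "higher_differentiable_on S g n" and f: "higher_differentiable_on T f n"
  shows "higher_differentiable_on S (\<lambda>x. f (g x)) n"
  using g f
proof (induction n arbitrary: f)
  case 0
  then show ?case using gST continuous_on_compose2 by (metis higher_differentiable_on.simps(1) image_subsetI)
next
  case (Suc n)
  \<comment> \<open>The derivative of \<open>f\<close> is applied to a direction that varies with
    \<open>x\<close>. Expanding that direction in \<open>Basis\<close> leaves scalars times
    derivatives of \<open>f\<close> in fixed directions, to which the induction hypothesis applies.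
    This is why the middle space is Euclidean.\<close>
  let ?D = "\<lambda>x v. \<Sum>i\<in>Basis. (frechet_derivative g (at x) v \<bullet> i) *\<^sub>R frechet_derivative f (at (g x)) i"
  show ?case
  proof (rule hdiff_SucI[OF S, where f' = ?D])
    fix x assume x: "x \<in> S"
    have lin: "linear (frechet_derivative f (at (g x)))"
      using hdiff_SucD[OF Suc.prems(2) gST[OF x]] has_derivative_linear by blast
    have D: "((\<lambda>x. f (g x)) has_derivative (\<lambda>v. frechet_derivative f (at (g x)) (frechet_derivative g (at x) v))) (at x)"
      using has_derivative_compose[OF hdiff_SucD[OF Suc.prems(1) x] hdiff_SucD[OF Suc.prems(2) gST[OF x]]] .
    have E: "frechet_derivative f (at (g x)) w = (\<Sum>i\<in>Basis. (w \<bullet> i) *\<^sub>R frechet_derivative f (at (g x)) i)" for w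
    proof -
      have "frechet_derivative f (at (g x)) (\<Sum>i\<in>Basis. (w \<bullet> i) *\<^sub>R i) =
          (\<Sum>i\<in>Basis. (w \<bullet> i) *\<^sub>R frechet_derivative f (at (g x)) i)"
        by (simp only: linear_sum[OF lin] linear_scale[OF lin])
      then show ?thesis by (simp only: euclidean_representation)
    qed
    show "((\<lambda>x. f (g x)) has_derivative ?D x) (at x)"
      by (rule has_derivative_eq_rhs[OF D]) (rule ext, rule E)
  next
    fix v
    show "higher_differentiable_on S (\<lambda>x. ?D x v) n"
    proof (intro hdiff_sum S finite_Basis hdiff_bilinear[OF S bounded_bilinear_scaleR])
      fix i :: 'b assume "i \<in> Basis"
      show "higher_differentiable_on S (\<lambda>x. frechet_derivative g (at x) v \<bullet> i) n"
        using Suc.prems by (intro hdiff_linear_compose[OF S bounded_linear_inner_left]) auto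
      show "higher_differentiable_on S (\<lambda>x. frechet_derivative f (at (g x)) i) n"
        using Suc.prems hdiff_mono by (intro Suc.IH) auto
    qed
  qed
qed

section \<open>Closure properties of smooth maps\<close>

lemma smooth_on_subset: "smooth_on S f \<Longrightarrow> T \<subseteq> S \<Longrightarrow> smooth_on T f"
  by (auto simp: smooth_on_def intro: hdiff_subset)

lemma smooth_on_cong: "smooth_on S f \<Longrightarrow> open S \<Longrightarrow> (\<And>x. x \<in> S \<Longrightarrow> f x = g x) \<Longrightarrow> smooth_on S g"
  unfolding smooth_on_def by (metis hdiff_cong)

lemma smooth_on_imp_has_derivative:
  "smooth_on S f \<Longrightarrow> x \<in> S \<Longrightarrow> (f has_derivative frechet_derivative f (at x)) (at x)"
  unfolding smooth_on_def using hdiff_SucD by blast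

lemma smooth_on_imp_continuous_on: "smooth_on S f \<Longrightarrow> continuous_on S f"
  unfolding smooth_on_def by (metis higher_differentiable_on.simps(1))

lemma smooth_on_deriv:
  "smooth_on S f \<Longrightarrow> smooth_on S (\<lambda>x. frechet_derivative f (at x) v)"
  unfolding smooth_on_def by (metis higher_differentiable_on.simps(2))

lemma smooth_on_const: "open S \<Longrightarrow> smooth_on S (\<lambda>x. c)"
  by (simp add: smooth_on_def hdiff_const)

lemma smooth_on_bounded_linear: "open S \<Longrightarrow> bounded_linear L \<Longrightarrow> smooth_on S L"
  by (simp add: smooth_on_def hdiff_bounded_linear)

lemma smooth_on_linear_compose:
  "open S \<Longrightarrow> bounded_linear L \<Longrightarrow> smooth_on S f \<Longrightarrow> smooth_on S (\<lambda>x. L (f x))"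
  by (simp add: smooth_on_def hdiff_linear_compose)

lemma smooth_on_add:
  "open S \<Longrightarrow> smooth_on S f \<Longrightarrow> smooth_on S g \<Longrightarrow> smooth_on S (\<lambda>x. f x + g x)"
  by (simp add: smooth_on_def hdiff_add)

lemma smooth_on_mult:
  fixes f g :: "'a::real_normed_vector \<Rightarrow> 'b::real_normed_algebra"
  shows "open S \<Longrightarrow> smooth_on S f \<Longrightarrow> smooth_on S g \<Longrightarrow> smooth_on S (\<lambda>x. f x * g x)"
  by (simp add: smooth_on_def hdiff_bilinear bounded_bilinear_mult)

lemma smooth_on_scaleR:
  "open S \<Longrightarrow> smooth_on S f \<Longrightarrow> smooth_on S g \<Longrightarrow> smooth_on S (\<lambda>x. f x *\<^sub>R g x)"
  by (simp add: smooth_on_def hdiff_bilinear bounded_bilinear_scaleR)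

lemma smooth_on_minus: "open S \<Longrightarrow> smooth_on S f \<Longrightarrow> smooth_on S (\<lambda>x. - f x)"
  using smooth_on_linear_compose[OF _ bounded_linear_minus[OF bounded_linear_ident]] .

lemma smooth_on_diff:
  "open S \<Longrightarrow> smooth_on S f \<Longrightarrow> smooth_on S g \<Longrightarrow> smooth_on S (\<lambda>x. f x - g x)"
  using smooth_on_add[of S f "\<lambda>x. - g x"] smooth_on_minus by auto

lemma smooth_on_compose:
  fixes g :: "'a::real_normed_vector \<Rightarrow> 'b::euclidean_space" and f :: "'b \<Rightarrow> 'c::real_normed_vector"
  assumes "open S" "open T" "\<And>x. x \<in> S \<Longrightarrow> g x \<in> T" "smooth_on S g" "smooth_on T f"
  shows "smooth_on S (\<lambda>x. f (g x))"
  using assms unfolding smooth_on_def by (metis hdiff_compose)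

section \<open>Smoothness of reciprocal, square root and exponential\<close>

lemma smooth_on_inverse_real: "smooth_on (- {0::real}) inverse"
proof -
  have "higher_differentiable_on (- {0::real}) inverse n" for n
  proof (induction n)
    case 0
    then show ?case by (auto intro!: continuous_intros)
  next
    case (Suc n)
    show ?case
    proof (rule hdiff_SucI[where f' = "\<lambda>x h. - (inverse x * h * inverse x)"])
      show "higher_differentiable_on (- {0}) (\<lambda>x. - (inverse x * v * inverse x)) n" for v :: real
      proof -
        have op: "open (- {0::real})" by (rule open_Compl) simp
        have "higher_differentiable_on (- {0::real}) (\<lambda>x. inverse x * v) n"
          by (rule hdiff_bilinear[OF op bounded_bilinear_mult Suc hdiff_const[OF op]])
        then have "higher_differentiable_on (- {0::real}) (\<lambda>x. inverse x * v * inverse x) n"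
          by (rule hdiff_bilinear[OF op bounded_bilinear_mult _ Suc])
        then show ?thesis
          by (rule hdiff_linear_compose[OF op bounded_linear_minus[OF bounded_linear_ident]])
      qed
    qed (auto intro!: has_derivative_inverse')
  qed
  then show ?thesis by (simp add: smooth_on_def)
qed

lemma smooth_on_inverse:
  fixes f :: "'a::real_normed_vector \<Rightarrow> real"
  assumes "open S" "smooth_on S f" "\<And>x. x \<in> S \<Longrightarrow> f x \<noteq> 0"
  shows "smooth_on S (\<lambda>x. inverse (f x))"
  by (rule smooth_on_compose[OF assms(1) _ _ assms(2) smooth_on_inverse_real])
    (use assms(3) in auto)

lemma smooth_on_divide:
  fixes f g :: "'a::real_normed_vector \<Rightarrow> real"
  assumes "open S" "smooth_on S f" "smooth_on S g" "\<And>x. x \<in> S \<Longrightarrow> g x \<noteq> 0"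
  shows "smooth_on S (\<lambda>x. f x / g x)"
  unfolding divide_inverse by (intro smooth_on_mult smooth_on_inverse assms)

lemma smooth_on_sqrt_real: "smooth_on {0<..} sqrt"
proof -
  have op: "open {0::real<..}" by simp
  have "higher_differentiable_on {0::real<..} sqrt n" for n
  proof (induction n)
    case 0
    then show ?case by (auto intro!: continuous_intros)
  next
    case (Suc n)
    have inv: "higher_differentiable_on {0::real<..} (\<lambda>x. inverse (sqrt x)) n"
      using smooth_on_inverse_real
      by (intro hdiff_compose[OF op _ _ Suc, of "- {0}"]) (auto simp: smooth_on_def)
    show ?case
    proof (rule hdiff_SucI[OF op, where f' = "\<lambda>x h. h * (inverse (sqrt x) / 2)"])
      show "higher_differentiable_on {0<..} (\<lambda>x. v * (inverse (sqrt x) / 2)) n" for v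
        unfolding divide_inverse
        by (intro hdiff_bilinear[OF op bounded_bilinear_mult] hdiff_const op inv)
      show "(sqrt has_derivative (\<lambda>h. h * (inverse (sqrt x) / 2))) (at x)" if "x \<in> {0<..}" for x
      proof -
        have "(sqrt has_derivative (*) (inverse (sqrt x) / 2)) (at x)"
          using DERIV_real_sqrt[of x] that by (simp add: has_field_derivative_def)
        then show ?thesis by (rule has_derivative_eq_rhs) (auto simp: fun_eq_iff)
      qed
    qed
  qed
  then show ?thesis by (simp add: smooth_on_def)
qed

lemma smooth_on_sqrt:
  assumes "open S" "smooth_on S f" "\<And>x. x \<in> S \<Longrightarrow> f x > 0"
  shows "smooth_on S (\<lambda>x. sqrt (f x))"
  by (rule smooth_on_compose[OF assms(1) _ _ assms(2) smooth_on_sqrt_real])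
    (use assms(3) in auto)

lemma smooth_on_exp_real: "smooth_on UNIV (exp :: real \<Rightarrow> real)"
proof -
  have "higher_differentiable_on UNIV (exp :: real \<Rightarrow> real) n" for n
  proof (induction n)
    case 0
    then show ?case by (auto intro!: continuous_intros)
  next
    case (Suc n)
    show ?case
    proof (rule hdiff_SucI[where f' = "\<lambda>x h. h * exp x"])
      show "higher_differentiable_on UNIV (\<lambda>x::real. v * exp x) n" for v :: real
        by (intro hdiff_bilinear[OF _ bounded_bilinear_mult] Suc hdiff_const) auto
      show "(exp has_derivative (\<lambda>h. h * exp x)) (at x)" for x :: real
        using DERIV_exp[of x] by (simp add: has_field_derivative_def mult_commute_abs)
    qed auto
  qed
  then show ?thesis by (simp add: smooth_on_def)
qed

lemma smooth_on_exp:
  fixes f :: "'a::real_normed_vector \<Rightarrow> real"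
  shows "open S \<Longrightarrow> smooth_on S f \<Longrightarrow> smooth_on S (\<lambda>x. exp (f x))"
  by (rule smooth_on_compose[OF _ _ _ _ smooth_on_exp_real]) auto

subsection \<open>Symmetry of second derivatives\<close>

text \<open>The mean value theorem twice: along \<open>u\<close> for the difference of two
  translates of \<open>f\<close>, then along \<open>v\<close> for the derivative so obtained. The
  second difference is symmetric in \<open>u\<close> and \<open>v\<close>, which is what makes it
  useful.\<close>

lemma second_difference_mvt:
  fixes f :: "'a::real_normed_vector \<Rightarrow> real"
  assumes sm: "smooth_on S f" and h: "h > 0"
    and sub: "\<And>s t. s \<in> {0..h} \<Longrightarrow> t \<in> {0..h} \<Longrightarrow> x + s *\<^sub>R u + t *\<^sub>R v \<in> S"
  shows "\<exists>s\<in>{0..h}. \<exists>t\<in>{0..h}.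
    f (x + h *\<^sub>R u + h *\<^sub>R v) - f (x + h *\<^sub>R u) - f (x + h *\<^sub>R v) + f x =
    h * h * frechet_derivative (\<lambda>y. frechet_derivative f (at y) u) (at (x + s *\<^sub>R u + t *\<^sub>R v)) v"
proof -
  have along: "((\<lambda>r. g (a + r *\<^sub>R w)) has_real_derivative frechet_derivative g (at (a + r *\<^sub>R w)) w) (at r)"
    if "smooth_on S g" "a + r *\<^sub>R w \<in> S" for g :: "'a \<Rightarrow> real" and a w r
  proof -
    have d: "(g has_derivative frechet_derivative g (at (a + r *\<^sub>R w))) (at (a + r *\<^sub>R w))"
      using smooth_on_imp_has_derivative[OF that] .
    have "((\<lambda>r. a + r *\<^sub>R w) has_derivative (\<lambda>r. r *\<^sub>R w)) (at r)"
      by (auto intro!: derivative_eq_intros)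
    from has_derivative_compose[OF this d] show ?thesis
      using linear_scale[OF has_derivative_linear[OF d]]
      by (simp add: has_field_derivative_def mult_commute_abs mult.commute)
  qed
  let ?F = "\<lambda>s. f (x + h *\<^sub>R v + s *\<^sub>R u) - f (x + s *\<^sub>R u)"
  let ?fu = "\<lambda>y. frechet_derivative f (at y) u"
  have "(?F has_real_derivative ?fu (x + h *\<^sub>R v + s *\<^sub>R u) - ?fu (x + s *\<^sub>R u)) (at s)"
    if "0 \<le> s" "s \<le> h" for s
    using sub[of s h] sub[of s 0] that h
    by (intro DERIV_diff along[OF sm]) (auto simp: add_ac)
  from MVT2[OF h this] obtain s where s: "0 < s" "s < h"
    "?F h - ?F 0 = h * (?fu (x + h *\<^sub>R v + s *\<^sub>R u) - ?fu (x + s *\<^sub>R u))"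
    by auto
  have "((\<lambda>t. ?fu (x + s *\<^sub>R u + t *\<^sub>R v)) has_real_derivative
      frechet_derivative ?fu (at (x + s *\<^sub>R u + t *\<^sub>R v)) v) (at t)"
    if "0 \<le> t" "t \<le> h" for t
    using sub[of s t] that s by (intro along smooth_on_deriv sm) auto
  from MVT2[OF h this] obtain t where t: "0 < t" "t < h"
    "?fu (x + s *\<^sub>R u + h *\<^sub>R v) - ?fu (x + s *\<^sub>R u) =
       h * frechet_derivative ?fu (at (x + s *\<^sub>R u + t *\<^sub>R v)) v"
    by auto
  have "f (x + h *\<^sub>R u + h *\<^sub>R v) - f (x + h *\<^sub>R u) - f (x + h *\<^sub>R v) + f x = ?F h - ?F 0"
    by (simp add: add_ac)
  also have "\<dots> = h * h * frechet_derivative ?fu (at (x + s *\<^sub>R u + t *\<^sub>R v)) v"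
    using s(3) t(3) by (simp add: add_ac)
  finally show ?thesis using s t by (intro bexI[of _ s] bexI[of _ t]) auto
qed

lemma frechet_derivative_commute:
  fixes f :: "'a::real_normed_vector \<Rightarrow> real"
  assumes S: "open S" "x \<in> S" and sm: "smooth_on S f"
  shows "frechet_derivative (\<lambda>y. frechet_derivative f (at y) u) (at x) v =
    frechet_derivative (\<lambda>y. frechet_derivative f (at y) v) (at x) u"
proof (rule ccontr)
  let ?A = "\<lambda>y. frechet_derivative (\<lambda>y. frechet_derivative f (at y) u) (at y) v"
  let ?B = "\<lambda>y. frechet_derivative (\<lambda>y. frechet_derivative f (at y) v) (at y) u"
  assume ne: "?A x \<noteq> ?B x"
  \<comment> \<open>Half the gap: a number within \<open>e\<close> of one value cannot be within
    \<open>e\<close> of the other.\<close>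
  define e where "e = \<bar>?A x - ?B x\<bar> / 2"
  have e: "e > 0" using ne by (simp add: e_def)
  have cA: "isCont ?A x" and cB: "isCont ?B x"
    using smooth_on_imp_continuous_on[OF smooth_on_deriv[OF smooth_on_deriv[OF sm]]] S
      continuous_on_eq_continuous_at by blast+
  obtain d1 where d1: "d1 > 0" "\<And>y. dist y x < d1 \<Longrightarrow> dist (?A y) (?A x) < e"
    using cA e unfolding continuous_at_eps_delta by (auto simp: dist_commute)
  obtain d2 where d2: "d2 > 0" "\<And>y. dist y x < d2 \<Longrightarrow> dist (?B y) (?B x) < e"
    using cB e unfolding continuous_at_eps_delta by (auto simp: dist_commute)
  obtain d3 where d3: "d3 > 0" "ball x d3 \<subseteq> S"
    using S open_contains_ball by blast
  define d where "d = min d1 (min d2 d3)"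
  have d: "d > 0" using d1 d2 d3 by (simp add: d_def)
  \<comment> \<open>Keeps the whole parallelogram at \<open>x\<close> within \<open>d / 2\<close> of
    \<open>x\<close>; the summand 1 keeps the denominator positive when \<open>u\<close> and
    \<open>v\<close> vanish.\<close>
  define h where "h = d / (2 * (norm u + norm v + 1))"
  have np: "norm u + norm v + 1 > 0" using norm_ge_zero[of u] norm_ge_zero[of v] by linarith
  have h: "h > 0" using d np by (simp add: h_def)
  have near: "dist (x + s *\<^sub>R u + t *\<^sub>R v) x < d" if "s \<in> {0..h}" "t \<in> {0..h}" for s t
  proof -
    have "norm (s *\<^sub>R u + t *\<^sub>R v) \<le> s * norm u + t * norm v"
      using norm_triangle_ineq[of "s *\<^sub>R u" "t *\<^sub>R v"] that by simp
    also have "\<dots> \<le> h * norm u + h * norm v"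
      using that by (intro add_mono mult_right_mono) auto
    also have "\<dots> \<le> h * (norm u + norm v + 1)"
      using h by (simp add: algebra_simps)
    also have "\<dots> = d / 2" using np by (simp add: h_def field_simps)
    also have "\<dots> < d" using d by simp
    finally show ?thesis by (simp add: dist_norm add_ac)
  qed
  have sub: "x + s *\<^sub>R u + t *\<^sub>R v \<in> S" if "s \<in> {0..h}" "t \<in> {0..h}" for s t
    using near[OF that] d3 by (auto simp: d_def mem_ball dist_commute)
  have sub': "x + s *\<^sub>R v + t *\<^sub>R u \<in> S" if "s \<in> {0..h}" "t \<in> {0..h}" for s t
    using sub[OF that(2,1)] by (simp add: add_ac)
  obtain s t where st: "s \<in> {0..h}" "t \<in> {0..h}"
    "f (x + h *\<^sub>R u + h *\<^sub>R v) - f (x + h *\<^sub>R u) - f (x + h *\<^sub>R v) + f x = h * h * ?A (x + s *\<^sub>R u + t *\<^sub>R v)"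
    using second_difference_mvt[OF sm h sub] by blast
  obtain s' t' where st': "s' \<in> {0..h}" "t' \<in> {0..h}"
    "f (x + h *\<^sub>R v + h *\<^sub>R u) - f (x + h *\<^sub>R v) - f (x + h *\<^sub>R u) + f x = h * h * ?B (x + s' *\<^sub>R v + t' *\<^sub>R u)"
    using second_difference_mvt[OF sm h sub'] by blast
  have "?A (x + s *\<^sub>R u + t *\<^sub>R v) = ?B (x + t' *\<^sub>R u + s' *\<^sub>R v)"
  proof -
    have "x + h *\<^sub>R v + h *\<^sub>R u = x + h *\<^sub>R u + h *\<^sub>R v" "x + s' *\<^sub>R v + t' *\<^sub>R u = x + t' *\<^sub>R u + s' *\<^sub>R v"
      by (simp_all add: add_ac)
    moreover have "a - b - c = a - c - b" for a b c :: real by simp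
    ultimately have "h * h * ?A (x + s *\<^sub>R u + t *\<^sub>R v) = h * h * ?B (x + t' *\<^sub>R u + s' *\<^sub>R v)"
      using st(3) st'(3) by metis
    then show ?thesis using h by simp
  qed
  moreover have "dist (?A (x + s *\<^sub>R u + t *\<^sub>R v)) (?A x) < e"
    using d1(2) near[OF st(1,2)] by (simp add: d_def)
  moreover have "dist (?B (x + t' *\<^sub>R u + s' *\<^sub>R v)) (?B x) < e"
    using d2(2) near[OF st'(2,1)] by (simp add: d_def)
  ultimately show False by (simp add: e_def dist_real_def abs_if split: if_splits)
qed

subsection \<open>Directional derivatives\<close>

definition dirder :: "'a::real_normed_vector \<Rightarrow> ('a \<Rightarrow> 'b::real_normed_vector) \<Rightarrow> 'a \<Rightarrow> 'b" where
  "dirder v f x = frechet_derivative f (at x) v"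

lemma smooth_on_dirder: "smooth_on S f \<Longrightarrow> smooth_on S (dirder v f)"
  using smooth_on_deriv[of S f v] by (simp add: dirder_def[abs_def])

lemma dirder_eqI: "(f has_derivative f') (at x) \<Longrightarrow> dirder v f x = f' v"
  unfolding dirder_def using frechet_derivative_at by metis

lemma smooth_on_has_dirder: "smooth_on S f \<Longrightarrow> x \<in> S \<Longrightarrow> (f has_derivative (\<lambda>v. dirder v f x)) (at x)"
  using smooth_on_imp_has_derivative unfolding dirder_def by blast

lemma dirder_cong:
  assumes "open S" "x \<in> S" "\<And>y. y \<in> S \<Longrightarrow> f y = g y"
  shows "dirder v f x = dirder v g x"
  unfolding dirder_def using frechet_derivative_cong_open[OF assms] by simp

lemma dirder_const: "dirder v (\<lambda>x. c) x = 0"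
  by (rule dirder_eqI[OF has_derivative_const])

lemma dirder_add:
  "smooth_on S f \<Longrightarrow> smooth_on S g \<Longrightarrow> x \<in> S \<Longrightarrow>
    dirder v (\<lambda>x. f x + g x) x = dirder v f x + dirder v g x"
  using dirder_eqI[OF has_derivative_add[OF smooth_on_has_dirder smooth_on_has_dirder]] by blast

lemma dirder_mult:
  fixes f g :: "'a::real_normed_vector \<Rightarrow> 'b::real_normed_algebra"
  shows "smooth_on S f \<Longrightarrow> smooth_on S g \<Longrightarrow> x \<in> S \<Longrightarrow>
    dirder v (\<lambda>x. f x * g x) x = f x * dirder v g x + dirder v f x * g x"
  using dirder_eqI[OF has_derivative_mult[OF smooth_on_has_dirder smooth_on_has_dirder]] by blast

lemma dirder_linear_compose:
  "bounded_linear L \<Longrightarrow> smooth_on S f \<Longrightarrow> x \<in> S \<Longrightarrow> dirder v (\<lambda>x. L (f x)) x = L (dirder v f x)"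
  using dirder_eqI[OF bounded_linear.has_derivative[OF _ smooth_on_has_dirder]] by blast

text \<open>Done componentwise, as the mean value argument is confined to real values.\<close>

lemma dirder_commute:
  fixes f :: "'a::real_normed_vector \<Rightarrow> 'b::euclidean_space"
  assumes S: "open S" "x \<in> S" and sm: "smooth_on S f"
  shows "dirder v (dirder u f) x = dirder u (dirder v f) x"
proof (rule euclidean_eqI)
  fix i :: 'b assume "i \<in> Basis"
  have bl: "bounded_linear (\<lambda>y::'b. y \<bullet> i)" by (rule bounded_linear_inner_left)
  have 1: "dirder u (\<lambda>x. f x \<bullet> i) y = dirder u f y \<bullet> i" if "y \<in> S" for u y
    using dirder_linear_compose[OF bl sm that] .
  have 2: "dirder v (dirder u f) x \<bullet> i = dirder v (dirder u (\<lambda>x. f x \<bullet> i)) x" for u v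
  proof -
    have "dirder v (dirder u (\<lambda>x. f x \<bullet> i)) x = dirder v (\<lambda>x. dirder u f x \<bullet> i) x"
      by (rule dirder_cong[OF S 1])
    then show ?thesis using dirder_linear_compose[OF bl smooth_on_dirder[OF sm] S(2)] by simp
  qed
  show "dirder v (dirder u f) x \<bullet> i = dirder u (dirder v f) x \<bullet> i"
    unfolding 2
    using frechet_derivative_commute[OF S smooth_on_linear_compose[OF S(1) bl sm], of u v]
    by (simp add: dirder_def[abs_def])
qed

subsection \<open>Null gradients on Sol\<close>

text \<open>For a vector \<open>(p, q, r) \<noteq> 0\<close> on the null cone in the kernel of \<open>h\<close>, all rows of the adjugate of
  \<open>h\<close> are multiples of it, so the trace of the adjugate vanishes.\<close>

lemma trace_square_eq_0:
  fixes a b c d e f p q r :: complex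
  assumes h: "a * p + d * q + e * r = 0" "d * p + b * q + f * r = 0" "e * p + f * q + c * r = 0"
    and tr: "a + b + c = 0" and null: "p * p + q * q + r * r = 0" and nz: "p \<noteq> 0 \<or> q \<noteq> 0 \<or> r \<noteq> 0"
  shows "a * a + b * b + c * c + 2 * (d * d) + 2 * (e * e) + 2 * (f * f) = 0"
proof -
  define m where "m = (b * c - f * f) + (a * c - e * e) + (a * b - d * d)"
  have "p * p * m = 0" "q * q * m = 0" "r * r * m = 0"
    unfolding m_def using h null by algebra+
  then have "m = 0" using nz by auto
  then show ?thesis using tr unfolding m_def by algebra
qed

text \<open>\<open>sol_frame \<alpha> 1\<close>, \<open>sol_frame (-1) 2\<close> and
  \<open>sol_frame 0 3\<close> are the left-invariant fields X, Y, Z acting on complex functions.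
  Keeping the exponent free lets one commutator formula yield all three brackets.\<close>

definition sol_frame :: "real \<Rightarrow> 3 \<Rightarrow> (real^3 \<Rightarrow> complex) \<Rightarrow> real^3 \<Rightarrow> complex" where
  "sol_frame k i f x = of_real (exp (k * x$3)) * dirder (axis i 1) f x"

lemma smooth_on_exp_coordinate:
  "open S \<Longrightarrow> smooth_on S (\<lambda>x::real^3. complex_of_real (exp (k * x$3)))"
  by (intro smooth_on_linear_compose[OF _ bounded_linear_of_real] smooth_on_exp
      smooth_on_linear_compose[OF _ bounded_linear_mult_right]
      smooth_on_bounded_linear bounded_linear_vec_nth)

lemma dirder_exp_coordinate:
  "dirder v (\<lambda>x::real^3. complex_of_real (exp (k * x$3))) x = of_real (k * v$3 * exp (k * x$3))"
  by (rule dirder_eqI[OF bounded_linear.has_derivative[OF bounded_linear_of_real has_derivative_exp_coordinate]])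

lemma smooth_on_sol_frame: "open S \<Longrightarrow> smooth_on S f \<Longrightarrow> smooth_on S (sol_frame k i f)"
  using smooth_on_mult[OF _ smooth_on_exp_coordinate smooth_on_dirder]
  by (simp add: sol_frame_def[abs_def])

lemma sol_frame_cong:
  "open S \<Longrightarrow> x \<in> S \<Longrightarrow> (\<And>y. y \<in> S \<Longrightarrow> f y = g y) \<Longrightarrow> sol_frame k i f x = sol_frame k i g x"
  unfolding sol_frame_def using dirder_cong by metis

lemma sol_frame_add:
  "smooth_on S f \<Longrightarrow> smooth_on S g \<Longrightarrow> x \<in> S \<Longrightarrow>
    sol_frame k i (\<lambda>x. f x + g x) x = sol_frame k i f x + sol_frame k i g x"
  by (simp add: sol_frame_def dirder_add algebra_simps)

lemma sol_frame_mult: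
  "smooth_on S f \<Longrightarrow> smooth_on S g \<Longrightarrow> x \<in> S \<Longrightarrow>
    sol_frame k i (\<lambda>x. f x * g x) x = f x * sol_frame k i g x + sol_frame k i f x * g x"
  by (simp add: sol_frame_def dirder_mult algebra_simps)

lemma sol_frame_const: "sol_frame k i (\<lambda>x. c) x = 0"
  by (simp add: sol_frame_def dirder_const)

lemma sol_frame_cmult:
  assumes "open S" "smooth_on S f" "x \<in> S"
  shows "sol_frame k i (\<lambda>x. c * f x) x = c * sol_frame k i f x"
  using sol_frame_mult[OF smooth_on_const[OF assms(1)] assms(2,3), of k i c]
  by (simp add: sol_frame_const)

lemma sol_frame_commute:
  assumes S: "open S" "x \<in> S" and sm: "smooth_on S f"
  shows "sol_frame k i (sol_frame l j f) x =
    sol_frame l j (sol_frame k i f) x +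
    of_real (exp (k * x$3)) * of_real (l * axis i 1 $ 3) * sol_frame l j f x -
    of_real (exp (l * x$3)) * of_real (k * axis j 1 $ 3) * sol_frame k i f x"
proof -
  have *: "sol_frame k i (sol_frame l j f) x = of_real (exp (k * x$3)) *
      (of_real (exp (l * x$3)) * dirder (axis i 1) (dirder (axis j 1) f) x +
       of_real (l * axis i 1 $ 3 * exp (l * x$3)) * dirder (axis j 1) f x)" for k i l j
    unfolding sol_frame_def[abs_def]
    by (simp only: dirder_mult[OF smooth_on_exp_coordinate[OF S(1)] smooth_on_dirder[OF sm] S(2)]
        dirder_exp_coordinate)
  show ?thesis
    unfolding * using dirder_commute[OF S sm, of "axis i 1" "axis j 1"]
    by (simp add: sol_frame_def algebra_simps)
qed

text \<open>In an orthonormal frame the Laplacian is the sum of the squares minus the derivative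
  along the sum of the fields nabla_E E. Here these fields are alpha Z, - Z and 0 for E = X, Y, Z,
  whence the coefficient 1 - alpha.\<close>

definition sol_lap :: "real \<Rightarrow> (real^3 \<Rightarrow> complex) \<Rightarrow> real^3 \<Rightarrow> complex" where
  "sol_lap \<alpha> f x = sol_frame \<alpha> 1 (sol_frame \<alpha> 1 f) x + sol_frame (-1) 2 (sol_frame (-1) 2 f) x +
    sol_frame 0 3 (sol_frame 0 3 f) x + of_real (1 - \<alpha>) * sol_frame 0 3 f x"

text \<open>The last bracket is the complex bilinear square of the gradient. If \<open>w\<close> and
  its square are both harmonic, it must vanish.\<close>

lemma sol_lap_square:
  assumes S: "open S" "x \<in> S" and sm: "smooth_on S w"
  shows "sol_lap \<alpha> (\<lambda>x. w x * w x) x = 2 * w x * sol_lap \<alpha> w x +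
    2 * ((sol_frame \<alpha> 1 w x)\<^sup>2 + (sol_frame (-1) 2 w x)\<^sup>2 + (sol_frame 0 3 w x)\<^sup>2)"
proof -
  have sf: "smooth_on S (sol_frame k i w)" for k i by (rule smooth_on_sol_frame[OF S(1) sm])
  have 1: "sol_frame k i (\<lambda>x. w x * w x) y = w y * sol_frame k i w y + sol_frame k i w y * w y"
    if "y \<in> S" for k i y
    using sol_frame_mult[OF sm sm that] .
  have 2: "sol_frame k i (sol_frame k i (\<lambda>x. w x * w x)) x =
     2 * w x * sol_frame k i (sol_frame k i w) x + 2 * (sol_frame k i w x)\<^sup>2" for k i
  proof -
    have "sol_frame k i (sol_frame k i (\<lambda>x. w x * w x)) x =
        sol_frame k i (\<lambda>y. w y * sol_frame k i w y + sol_frame k i w y * w y) x"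
      by (rule sol_frame_cong[OF S 1])
    then show ?thesis
      by (simp only: sol_frame_add[OF smooth_on_mult[OF S(1) sm sf] smooth_on_mult[OF S(1) sf sm] S(2)]
          sol_frame_mult[OF sm sf S(2)] sol_frame_mult[OF sf sm S(2)]) (simp add: power2_eq_square algebra_simps)
  qed
  show ?thesis unfolding sol_lap_def by (simp only: 2 1[OF S(2)]) (simp add: algebra_simps)
qed

text \<open>Bochner's formula for the complex bilinear square of the gradient, carried out by hand:
  the null condition is differentiated twice along each frame field, and third derivatives are
  removed with the differentiated harmonic equation.\<close>

lemma sol_null_gradient_relation:
  assumes S: "open S" "x \<in> S" and sm: "smooth_on S w"
    and lap: "\<And>y. y \<in> S \<Longrightarrow> sol_lap \<alpha> w y = 0"
    and null: "\<And>y. y \<in> S \<Longrightarrow> (sol_frame \<alpha> 1 w y)\<^sup>2 + (sol_frame (-1) 2 w y)\<^sup>2 + (sol_frame 0 3 w y)\<^sup>2 = 0"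
    and \<alpha>: "\<alpha> > 0"
  shows "(sol_frame \<alpha> 1 w x)\<^sup>2 + of_real \<alpha> * (sol_frame (-1) 2 w x)\<^sup>2 = 0"
proof -
  define X Y Z where "X = sol_frame \<alpha> 1" and "Y = sol_frame (-1) 2" and "Z = sol_frame 0 3"
  define p q r where "p = X w" and "q = Y w" and "r = Z w"
  note XYZ = X_def Y_def Z_def
  have smXYZ: "smooth_on S (X f)" "smooth_on S (Y f)" "smooth_on S (Z f)" if "smooth_on S f" for f
    unfolding XYZ by (intro smooth_on_sol_frame S(1) that)+
  have pqr: "smooth_on S p" "smooth_on S q" "smooth_on S r"
    unfolding p_def q_def r_def by (intro smXYZ sm)+
  have axis3: "(axis 1 1 :: real^3) $ 3 = 0" "(axis 2 1 :: real^3) $ 3 = 0" "(axis 3 1 :: real^3) $ 3 = 1"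
    by (simp_all add: axis_def)
  have XY: "X (Y f) y = Y (X f) y" and ZX: "Z (X f) y = X (Z f) y + of_real \<alpha> * X f y"
    and ZY: "Z (Y f) y = Y (Z f) y - Y f y" if "smooth_on S f" "y \<in> S" for f y
    unfolding XYZ using sol_frame_commute[OF S(1) that(2,1), where i=1 and j=2 and k=\<alpha> and l="-1"]
      sol_frame_commute[OF S(1) that(2,1), where i=3 and j=1 and k=0 and l=\<alpha>]
      sol_frame_commute[OF S(1) that(2,1), where i=3 and j=2 and k=0 and l="-1"]
    by (simp_all add: axis3)
  define N where "N = (\<lambda>y. p y * p y + q y * q y + r y * r y)"
  have N0: "N y = 0" if "y \<in> S" for y
    using null[OF that] by (simp add: N_def p_def q_def r_def XYZ power2_eq_square)
  have DN: "sol_frame k i N y = 2 * (p y * sol_frame k i p y + q y * sol_frame k i q y + r y * sol_frame k i r y)"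
    if "y \<in> S" for k i y
    unfolding N_def
    by (simp add: sol_frame_add[OF smooth_on_add[OF S(1) smooth_on_mult smooth_on_mult] smooth_on_mult that]
        sol_frame_add[OF smooth_on_mult smooth_on_mult that] sol_frame_mult[OF _ _ that] pqr S(1))
  have DN0: "p y * sol_frame k i p y + q y * sol_frame k i q y + r y * sol_frame k i r y = 0"
    if "y \<in> S" for k i y
  proof -
    have "sol_frame k i N y = sol_frame k i (\<lambda>y. 0) y" by (rule sol_frame_cong[OF S(1) that N0])
    then show ?thesis using DN[OF that, of k i] by (simp only: sol_frame_const) algebra
  qed
  \<comment> \<open>Half the second derivative of the null condition in one direction; the sum over
    the frame is the Bochner identity.\<close>
  have DDN: "(sol_frame k i p x)\<^sup>2 + (sol_frame k i q x)\<^sup>2 + (sol_frame k i r x)\<^sup>2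
     + p x * sol_frame k i (sol_frame k i p) x + q x * sol_frame k i (sol_frame k i q) x
     + r x * sol_frame k i (sol_frame k i r) x = 0" for k i
  proof -
    let ?d = "sol_frame k i"
    have "?d (\<lambda>y. p y * ?d p y + q y * ?d q y + r y * ?d r y) x = 0"
      using trans[OF sol_frame_cong[OF S DN0] sol_frame_const] .
    moreover have "smooth_on S (?d p)" "smooth_on S (?d q)" "smooth_on S (?d r)"
      by (intro smooth_on_sol_frame pqr S(1))+
    moreover from this have "?d (\<lambda>y. p y * ?d p y + q y * ?d q y + r y * ?d r y) x =
        (p x * ?d (?d p) x + ?d p x * ?d p x) + (q x * ?d (?d q) x + ?d q x * ?d q x)
        + (r x * ?d (?d r) x + ?d r x * ?d r x)"
      by (simp only: sol_frame_add[OF smooth_on_add[OF S(1) smooth_on_mult smooth_on_mult] smooth_on_mult S(2)]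
        sol_frame_add[OF smooth_on_mult smooth_on_mult S(2)] sol_frame_mult[OF _ _ S(2)] pqr S(1))
    ultimately show ?thesis by algebra
  qed
  \<comment> \<open>The frame brackets applied to \<open>w\<close>, that is, closedness of its
    differential.\<close>
  have c1: "X q y = Y p y" "Z p y = X r y + of_real \<alpha> * p y" "Z q y = Y r y - q y" if "y \<in> S" for y
    unfolding p_def q_def r_def using XY[OF sm that] ZX[OF sm that] ZY[OF sm that] by auto
  have tr: "X p y + Y q y + Z r y + of_real (1 - \<alpha>) * r y = 0" if "y \<in> S" for y
    using lap[OF that] by (simp add: sol_lap_def p_def q_def r_def XYZ)
  have Dtr: "sol_frame k i (X p) x + sol_frame k i (Y q) x + sol_frame k i (Z r) x
      + of_real (1 - \<alpha>) * sol_frame k i r x = 0" for k i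
  proof -
    have "sol_frame k i (\<lambda>y. X p y + Y q y + Z r y + of_real (1 - \<alpha>) * r y) x = 0"
      using trans[OF sol_frame_cong[OF S tr] sol_frame_const] .
    moreover have "sol_frame k i (\<lambda>y. X p y + Y q y + Z r y + of_real (1 - \<alpha>) * r y) x =
        sol_frame k i (X p) x + sol_frame k i (Y q) x + sol_frame k i (Z r) x + of_real (1 - \<alpha>) * sol_frame k i r x"
      by (simp only: sol_frame_add[OF smooth_on_add[OF S(1) smooth_on_add] smooth_on_mult[OF S(1) smooth_on_const] S(2)]
        sol_frame_add[OF smooth_on_add _ S(2)] sol_frame_add[OF _ _ S(2)] sol_frame_cmult[OF S(1) _ S(2)] smXYZ pqr S(1))
    ultimately show ?thesis by simp
  qed
  have cong: "X f x = X g x" "Y f x = Y g x" "Z f x = Z g x" if "\<And>y. y \<in> S \<Longrightarrow> f y = g y" for f g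
    unfolding XYZ using sol_frame_cong[OF S that] by auto
  have lin: "X (\<lambda>y. f y + c * g y) x = X f x + c * X g x" "Y (\<lambda>y. f y + c * g y) x = Y f x + c * Y g x"
      "Z (\<lambda>y. f y + c * g y) x = Z f x + c * Z g x"
    if "smooth_on S f" "smooth_on S g" for f g c
    unfolding XYZ using that
    by (simp_all add: sol_frame_add[OF _ smooth_on_mult[OF S(1) smooth_on_const] S(2)]
        sol_frame_cmult[OF S(1) _ S(2)] S(1))
  \<comment> \<open>From here to \<open>YYr\<close> each third derivative is commuted into a
    derivative of a diagonal term \<open>X p\<close>, \<open>Y q\<close> or \<open>Z r\<close> plus
    lower order terms, so that \<open>Dtr\<close> can eliminate it.\<close>
  have YYp: "Y (Y p) x = X (Y q) x"
    using cong(2)[of "X q" "Y p"] c1(1) XY[OF pqr(2) S(2)] by simp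
  have ZZp: "Z (Z p) x = X (Z r) x + of_real \<alpha> * X r x + of_real \<alpha> * Z p x"
    using cong(3)[of "Z p" "\<lambda>y. X r y + of_real \<alpha> * p y"] c1(2) lin(3)[OF smXYZ(1)[OF pqr(3)] pqr(1)]
      ZX[OF pqr(3) S(2)] by simp
  have XXq: "X (X q) x = Y (X p) x"
    using cong(1)[of "X q" "Y p"] c1(1) XY[OF pqr(1) S(2)] by simp
  have ZZq: "Z (Z q) x = Y (Z r) x - Y r x - Z q x"
    using cong(3)[of "Z q" "\<lambda>y. Y r y + (-1) * q y"] c1(3) lin(3)[OF smXYZ(2)[OF pqr(3)] pqr(2), of "-1"]
      ZY[OF pqr(3) S(2)] by simp
  have XXr: "X (X r) x = Z (X p) x - 2 * of_real \<alpha> * X p x"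
    using cong(1)[of "X r" "\<lambda>y. Z p y + (- of_real \<alpha>) * p y"] c1(2) lin(1)[OF smXYZ(3)[OF pqr(1)] pqr(1), of "- of_real \<alpha>"]
      ZX[OF pqr(1) S(2)] by simp
  have YYr: "Y (Y r) x = Z (Y q) x + 2 * Y q x"
    using cong(2)[of "Y r" "\<lambda>y. Z q y + 1 * q y"] c1(3) lin(2)[OF smXYZ(3)[OF pqr(2)] pqr(2), of 1]
      ZY[OF pqr(2) S(2)] by simp
  define A :: complex where "A = of_real \<alpha>"
  define a b d e f g where "a = X p x" and "b = Y q x" and "d = X q x" and "e = X r x"
    and "f = Y r x" and "g = Z r x"
  define P Q R where "P = p x" and "Q = q x" and "R = r x"
  have v: "X p x = a" "Y q x = b" "X q x = d" "Y p x = d" "X r x = e" "Y r x = f" "Z r x = g"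
      "p x = P" "q x = Q" "r x = R" "Z p x = e + A * P" "Z q x = f - Q" "complex_of_real \<alpha> = A"
      "complex_of_real (1 - \<alpha>) = 1 - A"
    using c1[OF S(2)] by (simp_all add: a_def b_def d_def e_def f_def g_def P_def Q_def R_def A_def)
  have zero: "P * P + Q * Q + R * R = 0"
    using N0[OF S(2)] by (simp add: N_def v)
  have rows: "P * a + Q * d + R * e = 0" "P * d + Q * b + R * f = 0"
      "P * (e + A * P) + Q * (f - Q) + R * g = 0"
    using DN0[OF S(2), of \<alpha> 1] DN0[OF S(2), of "-1" 2] DN0[OF S(2), of 0 3]
    unfolding XYZ[symmetric] v by auto
  have trace: "a + b + g + (1 - A) * R = 0"
    using tr[OF S(2)] unfolding v .
  have Xtr: "X (X p) x + X (Y q) x + X (Z r) x + (1 - A) * e = 0"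
    and Ytr: "Y (X p) x + Y (Y q) x + Y (Z r) x + (1 - A) * f = 0"
    and Ztr: "Z (X p) x + Z (Y q) x + Z (Z r) x + (1 - A) * g = 0"
    using Dtr[of \<alpha> 1] Dtr[of "-1" 2] Dtr[of 0 3] unfolding XYZ[symmetric] v by auto
  have bochner: "a * a + d * d + e * e + d * d + b * b + f * f + (e + A * P) * (e + A * P) + (f - Q) * (f - Q) + g * g
      + P * (X (X p) x + Y (Y p) x + Z (Z p) x) + Q * (X (X q) x + Y (Y q) x + Z (Z q) x)
      + R * (X (X r) x + Y (Y r) x + Z (Z r) x) = 0"
    using DDN[of \<alpha> 1] DDN[of "-1" 2] DDN[of 0 3] unfolding XYZ[symmetric] v by algebra
  have sums: "X (X p) x + Y (Y p) x + Z (Z p) x = (A - 1) * e + A * e + A * (e + A * P)"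
      "X (X q) x + Y (Y q) x + Z (Z q) x = (A - 1) * f - f - (f - Q)"
      "X (X r) x + Y (Y r) x + Z (Z r) x = (A - 1) * g - 2 * A * a + 2 * b"
    using Xtr Ytr Ztr YYp ZZp XXq ZZq XXr YYr unfolding v by algebra+
  \<comment> \<open>In the frame Ric is diagonal with entries alpha (1 - alpha), alpha - 1 and - (1
    + alpha^2). Adding (1 + alpha^2) times the null condition to Ric(zeta, zeta) gives exactly this
    expression. At zeros of zeta it holds trivially.\<close>
  have "(1 + A) * (P * P + A * Q * Q) = 0"
  proof (cases "P = 0 \<and> Q = 0 \<and> R = 0")
    case False
    \<comment> \<open>The six entries are the covariant Hessian. The corrections of \<open>a\<close>
      and \<open>b\<close> come from nabla_X X = alpha Z and nabla_Y Y = - Z; the mixed entries with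
      Z are \<open>Z p\<close> and \<open>Z q\<close> because nabla_Z vanishes on the frame.\<close>
    have "(a - A * R) * (a - A * R) + (b + R) * (b + R) + g * g + 2 * (d * d)
      + 2 * ((e + A * P) * (e + A * P)) + 2 * ((f - Q) * (f - Q)) = 0"
    proof (rule trace_square_eq_0[of _ P d Q "e + A * P" R])
      show "(a - A * R) * P + d * Q + (e + A * P) * R = 0" using rows by algebra
      show "d * P + (b + R) * Q + (f - Q) * R = 0" using rows by algebra
      show "(e + A * P) * P + (f - Q) * Q + g * R = 0" using rows by algebra
      show "a - A * R + (b + R) + g = 0" using trace by algebra
    qed (use zero False in auto)
    then show ?thesis using bochner[unfolded sums] rows zero trace by algebra
  qed auto
  moreover have "1 + A \<noteq> 0"
    using \<alpha> unfolding A_def by (metis add.commute add_pos_pos less_irrefl of_real_1 of_real_add of_real_eq_0_iff zero_less_one)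
  ultimately have "P * P + A * Q * Q = 0" by simp
  then show ?thesis
    by (simp add: P_def Q_def A_def p_def q_def XYZ power2_eq_square mult.assoc)
qed


text \<open>The ratios of p, q, r can take only finitely many values, so their derivatives vanish
  where q does not. This is extracted by differentiating the quadratic relations, which avoids
  choosing branches of square roots.\<close>

lemma sol_null_gradient_eq_0:
  assumes S: "open S" "x \<in> S" and sm: "smooth_on S w"
    and lap: "\<And>y. y \<in> S \<Longrightarrow> sol_lap \<alpha> w y = 0"
    and null: "\<And>y. y \<in> S \<Longrightarrow> (sol_frame \<alpha> 1 w y)\<^sup>2 + (sol_frame (-1) 2 w y)\<^sup>2 + (sol_frame 0 3 w y)\<^sup>2 = 0"
    and \<alpha>: "\<alpha> > 0"
  shows "dirder v w x = 0"
proof -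
  define X Y Z where "X = sol_frame \<alpha> 1" and "Y = sol_frame (-1) 2" and "Z = sol_frame 0 3"
  define p q r where "p = X w" and "q = Y w" and "r = Z w"
  note XYZ = X_def Y_def Z_def
  define A :: complex where "A = of_real \<alpha>"
  have A0: "A \<noteq> 0" and A1: "A + 1 \<noteq> 0"
    using \<alpha> by (auto simp: A_def complex_eq_iff)
  have pqr: "smooth_on S p" "smooth_on S q" "smooth_on S r"
    unfolding p_def q_def r_def XYZ by (intro smooth_on_sol_frame sm S(1))+
  have rel: "p y * p y + A * (q y * q y) = 0" if "y \<in> S" for y
    using sol_null_gradient_relation[OF S(1) that sm lap null \<alpha>]
    by (simp add: p_def q_def XYZ A_def power2_eq_square)
  have nul: "p y * p y + q y * q y + r y * r y = 0" if "y \<in> S" for y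
    using null[OF that] by (simp add: p_def q_def r_def XYZ power2_eq_square)
  have rel2: "r y * r y + (1 - A) * (q y * q y) = 0" if "y \<in> S" for y
    using rel[OF that] nul[OF that] by algebra
  have Drel: "p x * sol_frame k i p x + A * (q x * sol_frame k i q x) = 0"
    and Drel2: "r x * sol_frame k i r x + (1 - A) * (q x * sol_frame k i q x) = 0" for k i
  proof -
    have D: "2 * (f x * sol_frame k i f x + c * (g x * sol_frame k i g x)) = 0"
      if "smooth_on S f" "smooth_on S g" "\<And>y. y \<in> S \<Longrightarrow> f y * f y + c * (g y * g y) = 0" for f g c
    proof -
      have "sol_frame k i (\<lambda>y. f y * f y + c * (g y * g y)) x = 0"
        by (rule trans[OF sol_frame_cong[OF S that(3)] sol_frame_const])
      moreover have "sol_frame k i (\<lambda>y. f y * f y + c * (g y * g y)) x =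
          (f x * sol_frame k i f x + sol_frame k i f x * f x) + c * (g x * sol_frame k i g x + sol_frame k i g x * g x)"
        by (simp only: sol_frame_add[OF smooth_on_mult[OF S(1) that(1,1)] smooth_on_mult[OF S(1) smooth_on_const[OF S(1)] smooth_on_mult[OF S(1) that(2,2)]] S(2)]
            sol_frame_cmult[OF S(1) smooth_on_mult[OF S(1) that(2,2)] S(2)]
            sol_frame_mult[OF that(1,1) S(2)] sol_frame_mult[OF that(2,2) S(2)])
      ultimately show ?thesis by algebra
    qed
    show "p x * sol_frame k i p x + A * (q x * sol_frame k i q x) = 0"
      using D[OF pqr(1,2) rel] by (metis mult_eq_0_iff zero_neq_numeral)
    show "r x * sol_frame k i r x + (1 - A) * (q x * sol_frame k i q x) = 0"
      using D[OF pqr(3,2) rel2] by (metis mult_eq_0_iff zero_neq_numeral)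
  qed
  \<comment> \<open>For alpha = 1 the relation \<open>rel2\<close> reads r^2 = 0, and its derivative
    says nothing about the derivatives of r. They vanish because r is identically zero.\<close>
  have Dr0: "sol_frame k i r x = 0" if "A = 1" for k i
  proof -
    have "r y = 0" if "y \<in> S" for y
      using rel2[OF that] \<open>A = 1\<close> by simp
    from trans[OF sol_frame_cong[OF S this] sol_frame_const] show ?thesis .
  qed
  have axis3: "(axis 1 1 :: real^3) $ 3 = 0" "(axis 2 1 :: real^3) $ 3 = 0" "(axis 3 1 :: real^3) $ 3 = 1"
    by (simp_all add: axis_def)
  have "X q x = Y p x" "Z p x = X r x + A * p x" "Z q x = Y r x - q x"
    unfolding p_def q_def r_def XYZ A_def
    using sol_frame_commute[OF S sm, where i=1 and j=2 and k=\<alpha> and l="-1"]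
      sol_frame_commute[OF S sm, where i=3 and j=1 and k=0 and l=\<alpha>]
      sol_frame_commute[OF S sm, where i=3 and j=2 and k=0 and l="-1"]
    by (simp_all add: axis3)
  moreover define P Q R where "P = p x" and "Q = q x" and "R = r x"
  moreover define a b d e f g where "a = X p x" and "b = Y q x" and "d = X q x" and "e = X r x"
    and "f = Y r x" and "g = Z r x"
  ultimately have v: "X p x = a" "Y q x = b" "X q x = d" "Y p x = d" "X r x = e" "Y r x = f" "Z r x = g"
      "p x = P" "q x = Q" "r x = R" "Z p x = e + A * P" "Z q x = f - Q"
    by auto
  have Q0: "Q = 0"
  proof (rule ccontr)
    assume Q: "Q \<noteq> 0"
    have PQ: "P * P + A * (Q * Q) = 0" and RQ: "R * R + (1 - A) * (Q * Q) = 0"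
      using rel[OF S(2)] rel2[OF S(2)] unfolding v .
    have D: "P * a + A * (Q * d) = 0" "P * d + A * (Q * b) = 0" "P * (e + A * P) + A * (Q * (f - Q)) = 0"
      using Drel[of \<alpha> 1] Drel[of "-1" 2] Drel[of 0 3] unfolding XYZ[symmetric] v by auto
    have E: "R * e + (1 - A) * (Q * d) = 0" "R * f + (1 - A) * (Q * b) = 0"
      using Drel2[of \<alpha> 1] Drel2[of "-1" 2] unfolding XYZ[symmetric] v by auto
    \<comment> \<open>Stationarity of p / q without division: \<open>u\<close> and \<open>u'\<close>
      stand for the derivatives of p and q along one frame field.\<close>
    have prp: "Q * u = P * u'" if "P * u + A * (Q * u') = 0" for u u'
    proof -
      have "A * Q * (Q * u - P * u') = 0" using that PQ by algebra
      then show ?thesis using A0 Q by simp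
    qed
    have propR: "Q * u = R * u'" if "R * u + (1 - A) * (Q * u') = 0" "A = 1 \<Longrightarrow> u = 0" for u u'
    proof (cases "A = 1")
      case True
      then show ?thesis using RQ that by simp
    next
      case False
      have "(1 - A) * Q * (Q * u - R * u') = 0" using that(1) RQ by algebra
      then show ?thesis using False Q by simp
    qed
    have "Q * d = P * b" "Q * (e + A * P) = P * (f - Q)"
      using prp D by blast+
    moreover have "Q * e = R * d" "Q * f = R * b"
      using propR[OF E(1)] propR[OF E(2)] Dr0[of \<alpha> 1] Dr0[of "-1" 2] v(5,6) unfolding XYZ by auto
    ultimately have "Q * Q * P * (A + 1) = 0" by algebra
    then have "P = 0" using A1 Q by simp
    then show False using PQ A0 Q by simp
  qed
  then have "P = 0" "R = 0" using rel[OF S(2)] rel2[OF S(2)] unfolding v by simp_all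
  then have "dirder (axis i 1) w x = 0" for i
    using Q0 exhaust_3[of i] unfolding P_def Q_def R_def p_def q_def r_def XYZ sol_frame_def by auto
  moreover have "v = (\<Sum>i\<in>UNIV. v $ i *\<^sub>R axis i 1)"
    using basis_expansion[of v] by (simp add: scalar_mult_eq_scaleR)
  moreover have "linear (\<lambda>v. dirder v w x)"
    using smooth_on_has_dirder[OF sm S(2)] has_derivative_linear by blast
  ultimately show ?thesis
    by (metis (no_types, lifting) linear_sum linear_scale scaleR_zero_right sum.neutral)
qed

section \<open>The Laplace-Beltrami operator of Sol in the left-invariant frame\<close>

lemma matrix_inv_eqI:
  fixes A :: "'a::semiring_1^'n^'n"
  assumes "A ** B = mat 1" "B ** A = mat 1"
  shows "matrix_inv A = B"
proof -
  have "A ** matrix_inv A = mat 1 \<and> matrix_inv A ** A = mat 1"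
    unfolding matrix_inv_def by (rule someI[of _ B]) (use assms in simp)
  then show ?thesis
    using assms by (metis matrix_mul_assoc matrix_mul_lid matrix_mul_rid)
qed

text \<open>The coordinate Laplacian acts on real functions, hence the projection \<open>L\<close>.
  The volume density is exp((1 - alpha) z); differentiating it in z produces the first-order term of
  \<open>sol_lap\<close>.\<close>

lemma laplace_beltrami_sol:
  assumes S: "open S" "x \<in> S" and sm: "smooth_on S w" and that: "L = Re \<or> L = Im"
  shows "laplace_beltrami (sol_metric \<alpha> c) (\<lambda>x. L (w x)) x = L (sol_lap \<alpha> w x)"
proof -
  have L: "bounded_linear L" using that bounded_linear_Re bounded_linear_Im by auto
  have Lr: "L (of_real c * z) = c * L z" for c z using that by auto
  have g: "gram_matrix (sol_metric \<alpha> c y) =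
      (\<chi> i j. if i = j then (if i = 1 then exp (- 2 * \<alpha> * y$3) else if i = 2 then exp (2 * y$3) else 1) else 0)" for y
    by (simp add: gram_matrix_def sol_metric_eq vec_eq_iff forall_3 axis_def)
  have det: "sqrt (det (gram_matrix (sol_metric \<alpha> c y))) = exp ((1 - \<alpha>) * y$3)" for y
  proof -
    have "det (gram_matrix (sol_metric \<alpha> c y)) = exp ((1 - \<alpha>) * y$3) * exp ((1 - \<alpha>) * y$3)"
      unfolding g by (simp add: det_3 algebra_simps flip: exp_add)
    then show ?thesis by simp
  qed
  have inv: "matrix_inv (gram_matrix (sol_metric \<alpha> c y)) =
      (\<chi> i j. if i = j then (if i = 1 then exp (2 * \<alpha> * y$3) else if i = 2 then exp (- 2 * y$3) else 1) else 0)" (is "_ = ?I y") for y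
  proof -
    have "gram_matrix (sol_metric \<alpha> c y) ** ?I y = mat 1" "?I y ** gram_matrix (sol_metric \<alpha> c y) = mat 1"
      unfolding g by (simp_all add: matrix_matrix_mult_def mat_def vec_eq_iff forall_3 sum_3 flip: exp_add)
    then show ?thesis by (rule matrix_inv_eqI)
  qed
  have pd: "partial_deriv j (\<lambda>x. L (w x)) y = L (dirder (axis j 1) w y)" if "y \<in> S" for j y
    using dirder_linear_compose[OF L sm that, of "axis j 1"] by (simp add: partial_deriv_def dirder_def)
  have pd2: "partial_deriv j f y = dirder (axis j 1) f y" for j f y
    by (simp add: partial_deriv_def dirder_def)
  \<comment> \<open>Shape of the flux components: density times diagonal inverse metric is again an
    exponential of z, with exponents 1 + alpha, - 1 - alpha and 1 - alpha.\<close>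
  define wt where "wt k j y = exp (k * y$3) * L (dirder (axis j 1) w y)" for k j and y :: "real^3"
  have Lw: "smooth_on S (\<lambda>y. L (dirder (axis j 1) w y))" for j
    by (rule smooth_on_linear_compose[OF S(1) L smooth_on_dirder[OF sm]])
  have expk: "smooth_on S (\<lambda>y::real^3. exp (k * y$3))" for k
    by (intro smooth_on_exp smooth_on_linear_compose[OF _ bounded_linear_mult_right]
      smooth_on_bounded_linear bounded_linear_vec_nth S)
  have dwt: "dirder (axis i 1) (wt k j) x = exp (k * x$3) * L (dirder (axis i 1) (dirder (axis j 1) w) x)
     + k * axis i 1 $ 3 * exp (k * x$3) * L (dirder (axis j 1) w x)" for k i j
    unfolding wt_def using dirder_mult[OF expk Lw S(2)]
      dirder_eqI[OF has_derivative_exp_coordinate] dirder_linear_compose[OF L smooth_on_dirder[OF sm] S(2)]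
    by simp
  have flux: "sqrt (det (gram_matrix (sol_metric \<alpha> c y))) *
      (\<Sum>j\<in>UNIV. matrix_inv (gram_matrix (sol_metric \<alpha> c y)) $ i $ j * partial_deriv j (\<lambda>x. L (w x)) y)
      = wt (if i = 1 then 1 + \<alpha> else if i = 2 then - 1 - \<alpha> else 1 - \<alpha>) i y" if "y \<in> S" for i y
    unfolding det inv wt_def using exhaust_3[of i]
    by (auto simp: sum_3 pd[OF that] algebra_simps simp flip: exp_add)
  have "laplace_beltrami (sol_metric \<alpha> c) (\<lambda>x. L (w x)) x = 1 / exp ((1 - \<alpha>) * x$3) *
      (\<Sum>i\<in>UNIV. dirder (axis i 1) (wt (if i = 1 then 1 + \<alpha> else if i = 2 then - 1 - \<alpha> else 1 - \<alpha>) i) x)"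
    unfolding laplace_beltrami_def pd2 det[of x]
    by (intro arg_cong2[where f = "(*)"] refl sum.cong dirder_cong[OF S]) (simp add: flux[unfolded pd2])
  also have "\<dots> = exp (2 * \<alpha> * x$3) * L (dirder (axis 1 1) (dirder (axis 1 1) w) x)
      + exp (- 2 * x$3) * L (dirder (axis 2 1) (dirder (axis 2 1) w) x)
      + L (dirder (axis 3 1) (dirder (axis 3 1) w) x) + (1 - \<alpha>) * L (dirder (axis 3 1) w x)"
  proof -
    have "exp ((1 + \<alpha>) * x$3) = exp ((1 - \<alpha>) * x$3) * exp (2 * \<alpha> * x$3)"
      "exp ((- 1 - \<alpha>) * x$3) = exp ((1 - \<alpha>) * x$3) * exp (- 2 * x$3)"
      by (simp_all add: algebra_simps flip: exp_add)
    then show ?thesis by (simp add: sum_3 dwt) (simp add: axis_def field_simps)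
  qed
  also have "\<dots> = L (sol_lap \<alpha> w x)"
  proof -
    have fr: "sol_frame k i (sol_frame k i w) x = of_real (exp (2 * k * x$3)) * dirder (axis i 1) (dirder (axis i 1) w) x
      + of_real (k * axis i 1 $ 3 * exp (2 * k * x$3)) * dirder (axis i 1) w x" for k i
    proof -
      have "exp (2 * k * x$3) = exp (k * x$3) * exp (k * x$3)" by (simp flip: exp_add)
      then show ?thesis
        unfolding sol_frame_def[abs_def]
        by (simp only: dirder_mult[OF smooth_on_exp_coordinate[OF S(1)] smooth_on_dirder[OF sm] S(2)]
            dirder_exp_coordinate) (simp add: algebra_simps)
    qed
    have ax: "(axis 1 1 :: real^3) $ 3 = 0" "(axis 2 1 :: real^3) $ 3 = 0"
      by (simp_all add: axis_def)
    have Ladd: "L (a + b) = L a + L b" for a b using that by auto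
    show ?thesis
      unfolding sol_lap_def fr Ladd Lr by (simp add: ax sol_frame_def Lr del: of_real_exp)
  qed
  finally show ?thesis .
qed

subsection \<open>Conformal coordinates on surfaces\<close>

text \<open>The real part is the Euclidean inner product of the images of \<open>u\<close> and
  \<open>u'\<close> under dw, so \<open>w\<close> pulls the flat metric back to a multiple of
  \<open>b\<close>. Only positivity of the factor \<open>l\<close> is recorded, as it cancels from
  the two-dimensional flux.\<close>

definition conformal_coordinate ::
    "(real^2 \<Rightarrow> real^2 \<Rightarrow> real^2 \<Rightarrow> real) \<Rightarrow> (real^2) set \<Rightarrow> (real^2 \<Rightarrow> complex) \<Rightarrow> bool" where
  "conformal_coordinate b V w \<longleftrightarrow> open V \<and> smooth_on V w \<and>
     (\<forall>y\<in>V. \<exists>l>0. \<forall>u u'. b y u u' = l * Re (dirder u w y * cnj (dirder u' w y)))"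

text \<open>In dimension 2 the density times the inverse metric ignores the conformal factor. The
  flux of \<open>f\<close> is therefore, up to the sign of the Jacobian, the gradient of the
  conjugate function \<open>v\<close> turned by a right angle, and its divergence vanishes because
  mixed partials commute. Exchanging \<open>f\<close> and \<open>v\<close> gives the second
  claim.\<close>

lemma laplace_beltrami_conformal_coordinate:
  fixes x :: "real^2"
  assumes w: "conformal_coordinate b V w" and x: "x \<in> V"
    and pos: "\<And>y u. y \<in> V \<Longrightarrow> u \<noteq> 0 \<Longrightarrow> b y u u > 0"
  shows "laplace_beltrami b (\<lambda>y. Re (w y)) x = 0" "laplace_beltrami b (\<lambda>y. Im (w y)) x = 0"
proof -
  have V: "open V" and sm: "smooth_on V w"
    using w by (auto simp: conformal_coordinate_def)
  have main: "laplace_beltrami b f x = 0"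
    if sf: "smooth_on V f" and sv: "smooth_on V v"
      and fv: "\<And>y. y \<in> V \<Longrightarrow> \<exists>l>0. \<forall>u u'. b y u u' = l * (dirder u f y * dirder u' f y + dirder u v y * dirder u' v y)"
    for f v :: "real^2 \<Rightarrow> real"
  proof -
    define f1 f2 v1 v2 where "f1 = dirder (axis 1 1) f" and "f2 = dirder (axis 2 1) f"
      and "v1 = dirder (axis 1 1) v" and "v2 = dirder (axis 2 1) v"
    define J where "J y = f1 y * v2 y - f2 y * v1 y" for y
    have lin: "dirder u g y = u$1 * dirder (axis 1 1) g y + u$2 * dirder (axis 2 1) g y"
      if "smooth_on V g" "y \<in> V" for g :: "real^2 \<Rightarrow> real" and u y
    proof -
      have l: "linear (\<lambda>u. dirder u g y)"
        using has_derivative_linear[OF smooth_on_has_dirder[OF that]] .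
      have "u = u$1 *\<^sub>R axis 1 1 + u$2 *\<^sub>R axis 2 1"
        by (simp add: vec_eq_iff forall_2 axis_def)
      then show ?thesis
        using linear_add[OF l] linear_scale[OF l] by (metis real_scaleR_def)
    qed
    have J0: "J y \<noteq> 0" if y: "y \<in> V" for y
    proof
      assume J: "J y = 0"
      obtain l where l: "l > 0" "\<And>u u'. b y u u' = l * (dirder u f y * dirder u' f y + dirder u v y * dirder u' v y)"
        using fv[OF y] by blast
      have *: "u = 0" if "u$1 * f1 y + u$2 * f2 y = 0" "u$1 * v1 y + u$2 * v2 y = 0" for u :: "real^2"
        using pos[OF y, of u] l(2)[of u u] lin[OF sf y, of u] lin[OF sv y, of u] that
        by (auto simp: f1_def f2_def v1_def v2_def)
      \<comment> \<open>If the Jacobian vanishes, both vectors lie in the kernel of dw, which is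
        trivial by positivity of the metric. Then dw = 0, and even the first basis vector is in the
        kernel.\<close>
      have "vector [f2 y, - f1 y] = (0::real^2)" "vector [v2 y, - v1 y] = (0::real^2)"
        using J by (auto intro!: * simp: J_def algebra_simps)
      then have "f1 y = 0" "f2 y = 0" "v1 y = 0" "v2 y = 0"
        by (simp_all add: vec_eq_iff forall_2)
      then have "axis 1 1 = (0::real^2)" by (intro *) auto
      then show False by (simp add: axis_eq_0_iff)
    qed
    have flux: "sqrt (det (gram_matrix (b y))) * (\<Sum>j\<in>UNIV. matrix_inv (gram_matrix (b y)) $ i $ j * dirder (axis j 1) f y)
      = sgn (J y) * (if i = 1 then v2 y else - v1 y)" if y: "y \<in> V" for y and i :: 2
    proof -
      obtain l where l: "l > 0" "\<And>u u'. b y u u' = l * (dirder u f y * dirder u' f y + dirder u v y * dirder u' v y)"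
        using fv[OF y] by blast
      let ?G = "gram_matrix (b y)"
      have G: "?G $ 1 $ 1 = l * (f1 y * f1 y + v1 y * v1 y)" "?G $ 1 $ 2 = l * (f1 y * f2 y + v1 y * v2 y)"
        "?G $ 2 $ 1 = l * (f1 y * f2 y + v1 y * v2 y)" "?G $ 2 $ 2 = l * (f2 y * f2 y + v2 y * v2 y)"
        by (simp_all add: gram_matrix_def l(2) f1_def f2_def v1_def v2_def)
      have det: "det ?G = (l * J y)\<^sup>2"
        unfolding det_2 G J_def by algebra
      have sq: "sqrt (det ?G) = l * \<bar>J y\<bar>"
        unfolding det using l(1) by (simp add: abs_mult)
      define k where "k = 1 / (l * (J y * J y))"
      have k: "k * l * (J y * J y) = 1" using l(1) J0[OF y] by (simp add: k_def)
      define H :: "real^2^2" where "H = vector [vector [k * (f2 y * f2 y + v2 y * v2 y), - k * (f1 y * f2 y + v1 y * v2 y)],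
        vector [- k * (f1 y * f2 y + v1 y * v2 y), k * (f1 y * f1 y + v1 y * v1 y)]]"
      have H: "H $ 1 $ 1 = k * (f2 y * f2 y + v2 y * v2 y)" "H $ 1 $ 2 = - k * (f1 y * f2 y + v1 y * v2 y)"
        "H $ 2 $ 1 = - k * (f1 y * f2 y + v1 y * v2 y)" "H $ 2 $ 2 = k * (f1 y * f1 y + v1 y * v1 y)"
        by (simp_all add: H_def)
      have e: "k * l * ((f1 y * f1 y + v1 y * v1 y) * (f2 y * f2 y + v2 y * v2 y) - (f1 y * f2 y + v1 y * v2 y) * (f1 y * f2 y + v1 y * v2 y)) = 1"
        using k unfolding J_def by algebra
      have inv: "matrix_inv ?G = H"
      proof (rule matrix_inv_eqI)
        show "?G ** H = mat 1" "H ** ?G = mat 1"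
          using e by (simp_all add: matrix_matrix_mult_def mat_def vec_eq_iff forall_2 sum_2 G H) (algebra+)
      qed
      have s: "l * \<bar>J y\<bar> * k * J y = sgn (J y)"
        using l(1) J0[OF y] by (simp add: k_def sgn_if abs_if)
      show ?thesis
      proof (cases "i = 1")
        case True
        have "H $ 1 $ 1 * f1 y + H $ 1 $ 2 * f2 y = k * J y * v2 y"
          unfolding H J_def by algebra
        then show ?thesis unfolding sq inv s[symmetric] using True
          by (simp add: sum_2 flip: f1_def f2_def)
      next
        case False
        then have i: "i = 2" using exhaust_2 by blast
        have "H $ 2 $ 1 * f1 y + H $ 2 $ 2 * f2 y = - k * J y * v1 y"
          unfolding H J_def by algebra
        then show ?thesis unfolding sq inv s[symmetric] using i
          by (simp add: sum_2 flip: f1_def f2_def)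
      qed
    qed
    have sd: "smooth_on V f1" "smooth_on V f2" "smooth_on V v1" "smooth_on V v2"
      unfolding f1_def f2_def v1_def v2_def by (intro smooth_on_dirder sf sv)+
    have contJ: "continuous_on V J"
      unfolding J_def by (intro continuous_intros smooth_on_imp_continuous_on sd)
    \<comment> \<open>A neighbourhood on which the Jacobian keeps the sign it has at
      \<open>x\<close>, so the sign in the flux formula is constant under differentiation.\<close>
    define V' where "V' = V \<inter> J -` {t. t * J x > 0}"
    have V': "open V'" "x \<in> V'" "V' \<subseteq> V"
    proof -
      have "open {t::real. t * J x > 0}" by (intro open_Collect_less continuous_intros)
      then show "open V'" unfolding V'_def by (rule continuous_open_preimage[OF contJ V])
      show "x \<in> V'" using x J0[OF x] by (simp add: V'_def) (metis linorder_neqE_linordered_idom mult_neg_neg mult_pos_pos)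
    qed (auto simp: V'_def)
    have sgnJ: "sgn (J y) = sgn (J x)" if "y \<in> V'" for y
      using that by (auto simp: V'_def sgn_if zero_less_mult_iff)
    have fl: "dirder (axis i 1) (\<lambda>y. sqrt (det (gram_matrix (b y))) *
          (\<Sum>j\<in>UNIV. matrix_inv (gram_matrix (b y)) $ i $ j * dirder (axis j 1) f y)) x =
        dirder (axis i 1) (\<lambda>y. sgn (J x) * (if i = 1 then v2 y else - v1 y)) x" for i :: 2
      by (rule dirder_cong[OF V'(1,2)]) (use flux sgnJ V'(3) in auto)
    have "laplace_beltrami b f x = 1 / sqrt (det (gram_matrix (b x))) *
        (\<Sum>i\<in>UNIV. dirder (axis i 1) (\<lambda>y. sgn (J x) * (if i = (1::2) then v2 y else - v1 y)) x)"
      unfolding laplace_beltrami_def using fl by (simp add: partial_deriv_def dirder_def[abs_def])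
    also have "(\<Sum>i\<in>UNIV. dirder (axis i 1) (\<lambda>y. sgn (J x) * (if i = (1::2) then v2 y else - v1 y)) x) =
        dirder (axis 1 1) (\<lambda>y. sgn (J x) * v2 y) x + dirder (axis 2 1) (\<lambda>y. - sgn (J x) * v1 y) x"
      by (simp add: sum_2)
    also have "\<dots> = 0"
      using dirder_linear_compose[OF bounded_linear_mult_right sd(4) x, of "axis 1 1" "sgn (J x)"]
        dirder_linear_compose[OF bounded_linear_mult_right sd(3) x, of "axis 2 1" "- sgn (J x)"]
        dirder_commute[OF V x sv, of "axis 1 1" "axis 2 1"]
      by (simp add: v1_def v2_def)
    finally show ?thesis by simp
  qed
  have sRI: "smooth_on V (\<lambda>y. Re (w y))" "smooth_on V (\<lambda>y. Im (w y))"
    by (rule smooth_on_linear_compose[OF V bounded_linear_Re sm] smooth_on_linear_compose[OF V bounded_linear_Im sm])+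
  have c: "\<exists>l>0. \<forall>u u'. b y u u' = l * (dirder u (\<lambda>y. Re (w y)) y * dirder u' (\<lambda>y. Re (w y)) y
      + dirder u (\<lambda>y. Im (w y)) y * dirder u' (\<lambda>y. Im (w y)) y)" if "y \<in> V" for y
    using w that unfolding conformal_coordinate_def
    by (simp add: dirder_linear_compose[OF bounded_linear_Re sm that] dirder_linear_compose[OF bounded_linear_Im sm that])
  show "laplace_beltrami b (\<lambda>y. Re (w y)) x = 0"
    using main[OF sRI c] .
  show "laplace_beltrami b (\<lambda>y. Im (w y)) x = 0"
    using main[OF sRI(2,1)] c by (simp add: add.commute)
qed

text \<open>Squaring is holomorphic with derivative 2 w, so where \<open>w\<close> has no zero it
  only rescales the factor \<open>l\<close> by 1 / |2 w|^2.\<close>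

lemma conformal_coordinate_square:
  assumes "conformal_coordinate b V w" "\<And>y. y \<in> V \<Longrightarrow> w y \<noteq> 0"
  shows "conformal_coordinate b V (\<lambda>y. w y * w y)"
proof -
  have V: "open V" and sm: "smooth_on V w"
    using assms(1) by (auto simp: conformal_coordinate_def)
  have "\<exists>l>0. \<forall>u u'. b y u u' = l * Re (dirder u (\<lambda>y. w y * w y) y * cnj (dirder u' (\<lambda>y. w y * w y) y))"
    if y: "y \<in> V" for y
  proof -
    obtain l where l: "l > 0" "\<And>u u'. b y u u' = l * Re (dirder u w y * cnj (dirder u' w y))"
      using assms(1) y unfolding conformal_coordinate_def by blast
    have d: "dirder u (\<lambda>y. w y * w y) y = 2 * w y * dirder u w y" for u
      using dirder_mult[OF sm sm y] by simp
    have "dirder u (\<lambda>y. w y * w y) y * cnj (dirder u' (\<lambda>y. w y * w y) y) =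
        of_real (4 * (norm (w y))\<^sup>2) * (dirder u w y * cnj (dirder u' w y))" for u u'
      unfolding d by (simp add: complex_norm_square[symmetric] algebra_simps flip: of_real_power)
    then have "Re (dirder u (\<lambda>y. w y * w y) y * cnj (dirder u' (\<lambda>y. w y * w y) y)) =
        4 * (norm (w y))\<^sup>2 * Re (dirder u w y * cnj (dirder u' w y))" for u u'
      by simp
    then show ?thesis
      using l assms(2)[OF y] by (intro exI[of _ "l / (4 * (norm (w y))\<^sup>2)"]) simp
  qed
  then show ?thesis
    unfolding conformal_coordinate_def using V smooth_on_mult[OF V sm sm] by blast
qed

text \<open>Harmonicity is tested in every chart of the atlas. By the transformation rule of the
  metric, \<open>w\<close> composed with a transition map is a conformal coordinate for the other
  chart, so the local computation applies there too.\<close>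

lemma harmonic_on_conformal_coordinate:
  fixes B :: "('b::{second_countable_topology, t2_space}, 2) chart set"
  assumes B: "riemannian_manifold B h" and chart: "(E, \<eta>) \<in> B"
    and w: "conformal_coordinate (h (E, \<eta>)) V w"
    and L: "L = Re \<or> L = Im"
  defines "W \<equiv> E \<inter> \<eta> -` V"
  shows "open W" "W \<subseteq> manifold_carrier B" "harmonic_on B h W (\<lambda>p. L (w (\<eta> p)))"
proof -
  have atlas: "smooth_atlas B" using B by (simp add: riemannian_manifold_def)
  have V: "open V" and sm: "smooth_on V w" using w by (auto simp: conformal_coordinate_def)
  have E: "open E" "continuous_on E \<eta>"
    using atlas chart by (auto simp: smooth_atlas_def homeomorphism_def)
  show W: "open W"
    unfolding W_def by (rule continuous_open_preimage[OF E(2,1) V])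
  show "W \<subseteq> manifold_carrier B" using chart by (auto simp: W_def manifold_carrier_def)
  show "harmonic_on B h W (\<lambda>p. L (w (\<eta> p)))"
    unfolding harmonic_on_def
  proof (safe del: notI)
    fix D \<psi> assume D: "(D, \<psi>) \<in> B"
    define \<tau> where "\<tau> = \<eta> \<circ> inv_into D \<psi>"
    let ?S = "\<psi> ` (D \<inter> W)"
    have Dop: "open D" "open (\<psi> ` D)" "homeomorphism D (\<psi> ` D) \<psi> (inv_into D \<psi>)"
      using atlas D by (auto simp: smooth_atlas_def)
    have S: "open ?S"
    proof -
      have "openin (top_of_set D) (D \<inter> W)" using W by (simp add: openin_open_Int)
      then have "openin (top_of_set (\<psi> ` D)) ?S"
        using homeomorphism_imp_open_map[OF Dop(3)] by blast
      then show ?thesis using Dop(2) openin_open_trans by blast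
    qed
    have sub: "?S \<subseteq> \<psi> ` (D \<inter> E)" by (auto simp: W_def)
    have inv: "inv_into D \<psi> x \<in> D \<inter> W" if "x \<in> ?S" for x
      using that Dop(3) by (auto simp: homeomorphism_def)
    have smt: "smooth_on ?S \<tau>"
      using atlas D chart smooth_on_subset[OF _ sub] unfolding smooth_atlas_def \<tau>_def by blast
    have tV: "\<tau> x \<in> V" if "x \<in> ?S" for x
      using inv[OF that] by (simp add: \<tau>_def W_def)
    define w' where "w' = (\<lambda>x. w (\<tau> x))"
    have smw': "smooth_on ?S w'"
      unfolding w'_def by (rule smooth_on_compose[OF S V tV smt sm])
    have dw': "dirder u w' x = dirder (dirder u \<tau> x) w (\<tau> x)" if "x \<in> ?S" for u x
      unfolding w'_def
      by (rule dirder_eqI[OF has_derivative_compose[OF smooth_on_has_dirder[OF smt that] smooth_on_has_dirder[OF sm tV[OF that]]]])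
    have conf: "conformal_coordinate (h (D, \<psi>)) ?S w'"
      unfolding conformal_coordinate_def
    proof (intro conjI S smw' ballI)
      fix x assume x: "x \<in> ?S"
      obtain l where l: "l > 0" "\<And>u u'. h (E, \<eta>) (\<tau> x) u u' = l * Re (dirder u w (\<tau> x) * cnj (dirder u' w (\<tau> x)))"
        using w tV[OF x] unfolding conformal_coordinate_def by blast
      have T: "\<forall>(D, \<psi>)\<in>B. \<forall>(E, \<eta>)\<in>B. \<forall>x\<in>\<psi> ` (D \<inter> E). \<forall>u v.
          let \<tau> = \<eta> \<circ> inv_into D \<psi>; d\<tau> = frechet_derivative \<tau> (at x)
          in h (D, \<psi>) x u v = h (E, \<eta>) (\<tau> x) (d\<tau> u) (d\<tau> v)"
        using B unfolding riemannian_manifold_def by (elim conjE)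
      have "h (D, \<psi>) x u u' = h (E, \<eta>) (\<tau> x) (dirder u \<tau> x) (dirder u' \<tau> x)" for u u'
        unfolding \<tau>_def dirder_def
        using bspec[OF bspec[OF T D, unfolded prod.case] chart, unfolded prod.case Let_def, THEN bspec, OF subsetD[OF sub x]]
        by (elim allE)
      then show "\<exists>l>0. \<forall>u u'. h (D, \<psi>) x u u' = l * Re (dirder u w' x * cnj (dirder u' w' x))"
        using l dw'[OF x] by auto
    qed
    have pos: "h (D, \<psi>) x u u > 0" if "x \<in> ?S" "u \<noteq> 0" for x u
      using B D that unfolding riemannian_manifold_def by blast
    have eq: "(\<lambda>p. L (w (\<eta> p))) \<circ> inv_into D \<psi> = (\<lambda>x. L (w' x))"
      by (simp add: fun_eq_iff w'_def \<tau>_def)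
    show "smooth_on ?S ((\<lambda>p. L (w (\<eta> p))) \<circ> inv_into D \<psi>)"
      unfolding eq using L smooth_on_linear_compose[OF S bounded_linear_Re smw']
        smooth_on_linear_compose[OF S bounded_linear_Im smw'] by auto
    fix x assume "x \<in> D" "x \<in> W"
    then have x: "\<psi> x \<in> ?S" by blast
    show "laplace_beltrami (h (D, \<psi>)) ((\<lambda>p. L (w (\<eta> p))) \<circ> inv_into D \<psi>) (\<psi> x) = 0"
      unfolding eq using L laplace_beltrami_conformal_coordinate[OF conf x pos] by auto
  qed
qed

subsection \<open>Absolutely convergent double Fourier series\<close>

text \<open>The infix \<open>abs_summable_on\<close> is ambiguous between \<open>Infinite_Sum\<close> and \<open>Infinite_Set_Sum\<close>.\<close>

abbreviation norm_summable_on :: "('a \<Rightarrow> 'b::real_normed_vector) \<Rightarrow> 'a set \<Rightarrow> bool"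
    (infix "norm'_summable'_on" 50) where
  "f norm_summable_on A \<equiv> (\<lambda>x. norm (f x)) summable_on A"

lemma abs_summable_on_UNIV_prod:
  fixes f :: "'a \<Rightarrow> 'b \<Rightarrow> 'c::banach"
  assumes "\<And>x. (\<lambda>y. f x y) norm_summable_on UNIV"
    and "(\<lambda>x. \<Sum>\<^sub>\<infinity>y. norm (f x y)) summable_on UNIV"
  shows "(\<lambda>(x, y). f x y) norm_summable_on UNIV"
proof -
  have "(\<lambda>(x, y). f x y) norm_summable_on Sigma UNIV (\<lambda>_. UNIV)"
    by (rule iffD2[OF Infinite_Sum.abs_summable_on_Sigma_iff]) (use assms in \<open>simp add: infsum_nonneg\<close>)
  then show ?thesis by simp
qed

lemma abs_summable_tensor:
  fixes a :: "'i \<Rightarrow> 'c::{real_normed_div_algebra, banach}" and b :: "'j \<Rightarrow> 'c"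
  assumes "a norm_summable_on UNIV" "b norm_summable_on UNIV"
  shows "(\<lambda>(x, y). a x * b y) norm_summable_on UNIV"
    and "(\<Sum>\<^sub>\<infinity>(x, y). a x * b y) = (\<Sum>\<^sub>\<infinity>x. a x) * (\<Sum>\<^sub>\<infinity>y. b y)"
proof -
  show *: "(\<lambda>(x, y). a x * b y) norm_summable_on UNIV"
    using assms
    by (intro abs_summable_on_UNIV_prod)
      (simp_all add: norm_mult summable_on_cmult_right summable_on_cmult_left infsum_cmult_right)
  then have "(\<lambda>(x, y). a x * b y) summable_on (UNIV \<times> UNIV)"
    using abs_summable_summable by auto
  from infsum_Sigma'_banach[OF this]
  show "(\<Sum>\<^sub>\<infinity>(x, y). a x * b y) = (\<Sum>\<^sub>\<infinity>x. a x) * (\<Sum>\<^sub>\<infinity>y. b y)"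
    using assms abs_summable_summable
    by (simp add: infsum_cmult_right' infsum_cmult_left')
qed

lemma bij_betw_convolution: "bij_betw (\<lambda>(k, l). (l, k - l :: 'a::group_add)) UNIV UNIV"
  by (rule bij_betw_byWitness[where f' = "\<lambda>(l, m). (m + l, l)"]) auto

text \<open>The substitution (k, l) -> (l, k - l) turns the convolution into a tensor product, whose
  double sum factors.\<close>

lemma abs_summable_convolution:
  fixes a b :: "'i::group_add \<Rightarrow> 'c::{real_normed_div_algebra, banach}"
  assumes "a norm_summable_on UNIV" "b norm_summable_on UNIV"
  shows "(\<lambda>(k, l). a l * b (k - l)) norm_summable_on UNIV"
    and "\<And>k. (\<lambda>l. a l * b (k - l)) norm_summable_on UNIV"
    and "(\<lambda>k. \<Sum>\<^sub>\<infinity>l. a l * b (k - l)) norm_summable_on UNIV"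
    and "(\<Sum>\<^sub>\<infinity>k. \<Sum>\<^sub>\<infinity>l. a l * b (k - l)) = (\<Sum>\<^sub>\<infinity>x. a x) * (\<Sum>\<^sub>\<infinity>y. b y)"
proof -
  note t = abs_summable_tensor[OF assms]
  have e: "(\<lambda>p. norm (case (case p of (k, l) \<Rightarrow> (l, k - l)) of (x, y) \<Rightarrow> a x * b y)) =
      (\<lambda>p. norm (case p of (k, l) \<Rightarrow> a l * b (k - l)))"
    "(\<lambda>p. case (case p of (k, l) \<Rightarrow> (l, k - l)) of (x, y) \<Rightarrow> a x * b y) =
      (\<lambda>(k, l). a l * b (k - l))"
    by (auto simp: fun_eq_iff)
  show 1: "(\<lambda>(k, l). a l * b (k - l)) norm_summable_on UNIV"
    using summable_on_reindex_bij_betw[OF bij_betw_convolution, of "\<lambda>p. norm (case p of (x, y) \<Rightarrow> a x * b y)"] t(1)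
    unfolding e by simp
  have S1: "(\<lambda>(k, l). a l * b (k - l)) norm_summable_on Sigma UNIV (\<lambda>_. UNIV)"
    using 1 by simp
  show 2: "(\<lambda>l. a l * b (k - l)) norm_summable_on UNIV" for k
    using S1[unfolded Infinite_Sum.abs_summable_on_Sigma_iff] by simp
  have "(\<lambda>k. \<Sum>\<^sub>\<infinity>l. norm (a l * b (k - l))) summable_on UNIV"
    using S1[unfolded Infinite_Sum.abs_summable_on_Sigma_iff] by (simp add: infsum_nonneg)
  then show "(\<lambda>k. \<Sum>\<^sub>\<infinity>l. a l * b (k - l)) norm_summable_on UNIV"
    by (rule summable_on_comparison_test) (auto intro: norm_infsum_bound[OF 2])
  have "(\<lambda>(k, l). a l * b (k - l)) summable_on (UNIV \<times> UNIV)"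
    using 1 abs_summable_summable by auto
  from infsum_Sigma'_banach[OF this]
  have "(\<Sum>\<^sub>\<infinity>k. \<Sum>\<^sub>\<infinity>l. a l * b (k - l)) = (\<Sum>\<^sub>\<infinity>(k, l). a l * b (k - l))" by simp
  also have "\<dots> = (\<Sum>\<^sub>\<infinity>(x, y). a x * b y)"
    using infsum_reindex_bij_betw[OF bij_betw_convolution, of "\<lambda>(x, y). a x * b y"] unfolding e .
  finally show "(\<Sum>\<^sub>\<infinity>k. \<Sum>\<^sub>\<infinity>l. a l * b (k - l)) = (\<Sum>\<^sub>\<infinity>x. a x) * (\<Sum>\<^sub>\<infinity>y. b y)"
    using t(2) by simp
qed

type_synonym coeffs = "int \<times> int \<Rightarrow> complex"

definition fconv :: "coeffs \<Rightarrow> coeffs \<Rightarrow> coeffs" where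
  "fconv a b k = (\<Sum>\<^sub>\<infinity>l. a l * b (k - l))"

definition fchar :: "int \<times> int \<Rightarrow> real \<times> real \<Rightarrow> complex" where
  "fchar k p = cis (of_int (fst k) * fst p + of_int (snd k) * snd p)"

definition fseries :: "coeffs \<Rightarrow> real \<times> real \<Rightarrow> complex" where
  "fseries a p = (\<Sum>\<^sub>\<infinity>k. a k * fchar k p)"

definition mag :: "int \<times> int \<Rightarrow> real" where
  "mag k = of_int (\<bar>fst k\<bar> + \<bar>snd k\<bar>)"

definition wsummable :: "(int \<times> int \<Rightarrow> real) \<Rightarrow> coeffs \<Rightarrow> bool" where
  "wsummable W a \<longleftrightarrow> (\<lambda>k. W k * norm (a k)) summable_on UNIV"

definition wnorm :: "(int \<times> int \<Rightarrow> real) \<Rightarrow> coeffs \<Rightarrow> real" where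
  "wnorm W a = (\<Sum>\<^sub>\<infinity>k. W k * norm (a k))"

definition rapid :: "coeffs \<Rightarrow> bool" where
  "rapid a \<longleftrightarrow> (\<forall>s. wsummable (\<lambda>k. (1 + mag k) ^ s) a)"

lemma mag_nonneg: "mag k \<ge> 0" by (simp add: mag_def)

lemma mag_add: "mag (k + l) \<le> mag k + mag l"
  unfolding mag_def of_int_add[symmetric] by (simp only: of_int_le_iff fst_add snd_add)

lemma norm_fchar: "norm (fchar k p) = 1" by (simp add: fchar_def)

lemma fchar_add: "fchar (k + l) p = fchar k p * fchar l p"
  by (simp add: fchar_def cis_mult algebra_simps)

lemma wsummable_mono:
  assumes "wsummable W a" "\<And>k. norm (b k) \<le> c * norm (a k)" "\<And>k. 0 \<le> W k"
  shows "wsummable W b"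
proof -
  have "(\<lambda>k. c * (W k * norm (a k))) summable_on UNIV"
    using assms(1) summable_on_cmult_right unfolding wsummable_def by blast
  then show ?thesis unfolding wsummable_def
    by (rule summable_on_comparison_test)
      (use assms(2,3) mult_left_mono[OF assms(2) assms(3)] in \<open>auto simp: algebra_simps\<close>)
qed

lemma abs_summable_if_wsummable:
  assumes "wsummable W a" "\<And>k. 1 \<le> W k"
  shows "a norm_summable_on UNIV"
  using assms(1) unfolding wsummable_def
proof (rule summable_on_comparison_test)
  show "norm (a k) \<le> W k * norm (a k)" for k
    using mult_right_mono[OF assms(2), of "norm (a k)"] by simp
qed auto

text \<open>Submultiplicativity distributes the weight over the two factors, so the unweighted
  convolution bound applies to the weighted absolute values.\<close>

lemma wsummable_fconv:
  assumes a: "wsummable W a" and b: "wsummable W b"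
    and W1: "\<And>k. 1 \<le> W k" and W: "\<And>k l. W (k + l) \<le> W k * W l"
  shows "wsummable W (fconv a b)" "wnorm W (fconv a b) \<le> wnorm W a * wnorm W b"
proof -
  define A B where "A k = W k * norm (a k)" and "B k = W k * norm (b k)" for k
  have W0: "0 \<le> W k" for k using W1[of k] by linarith
  have nn: "0 \<le> A k" "0 \<le> B k" for k using W0 by (simp_all add: A_def B_def)
  have AB: "A norm_summable_on UNIV" "B norm_summable_on UNIV"
    using a b nn by (simp_all add: wsummable_def A_def[symmetric] B_def[symmetric])
  note c = abs_summable_convolution[OF AB]
  note c0 = abs_summable_convolution(2)[OF abs_summable_if_wsummable[OF a W1] abs_summable_if_wsummable[OF b W1]]
  have le: "W k * norm (fconv a b k) \<le> (\<Sum>\<^sub>\<infinity>l. A l * B (k - l))" for k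
  proof -
    have "W k * norm (fconv a b k) \<le> W k * (\<Sum>\<^sub>\<infinity>l. norm (a l * b (k - l)))"
      unfolding fconv_def by (rule mult_left_mono[OF norm_infsum_bound[OF c0] W0])
    also have "\<dots> = (\<Sum>\<^sub>\<infinity>l. W k * norm (a l * b (k - l)))"
      using infsum_cmult_right[OF c0] by simp
    also have "\<dots> \<le> (\<Sum>\<^sub>\<infinity>l. A l * B (k - l))"
    proof (rule infsum_mono)
      show "(\<lambda>l. W k * norm (a l * b (k - l))) summable_on UNIV"
        using summable_on_cmult_right[OF c0] .
      show "(\<lambda>l. A l * B (k - l)) summable_on UNIV"
        by (rule abs_summable_summable[OF c(2)])
      fix l
      have "W k \<le> W l * W (k - l)" using W[of l "k - l"] by simp
      then have "W k * (norm (a l) * norm (b (k - l))) \<le> W l * W (k - l) * (norm (a l) * norm (b (k - l)))"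
        by (intro mult_right_mono) auto
      then show "W k * norm (a l * b (k - l)) \<le> A l * B (k - l)"
        by (simp add: A_def B_def norm_mult algebra_simps)
    qed
    finally show ?thesis .
  qed
  have sumc: "(\<lambda>k. \<Sum>\<^sub>\<infinity>l. A l * B (k - l)) summable_on UNIV"
    by (rule abs_summable_summable[OF c(3)])
  show s: "wsummable W (fconv a b)"
    unfolding wsummable_def
    by (rule summable_on_comparison_test[OF sumc]) (use le W0 in auto)
  have "wnorm W (fconv a b) \<le> (\<Sum>\<^sub>\<infinity>k. \<Sum>\<^sub>\<infinity>l. A l * B (k - l))"
    unfolding wnorm_def by (rule infsum_mono[OF _ sumc]) (use s le in \<open>auto simp: wsummable_def\<close>)
  then show "wnorm W (fconv a b) \<le> wnorm W a * wnorm W b"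
    unfolding c(4) by (simp add: wnorm_def A_def[abs_def] B_def[abs_def])
qed

lemma abs_summable_fchar: "a norm_summable_on UNIV \<Longrightarrow> (\<lambda>k. a k * fchar k p) norm_summable_on UNIV"
  by (simp add: norm_mult norm_fchar)

lemma fseries_fconv:
  assumes "a norm_summable_on UNIV" "b norm_summable_on UNIV"
  shows "fseries (fconv a b) p = fseries a p * fseries b p"
proof -
  note s = abs_summable_fchar[OF assms(1), of p] abs_summable_fchar[OF assms(2), of p]
  have "fconv a b k * fchar k p = (\<Sum>\<^sub>\<infinity>l. (a l * fchar l p) * (b (k - l) * fchar (k - l) p))" for k
  proof -
    have "fconv a b k * fchar k p = (\<Sum>\<^sub>\<infinity>l. a l * b (k - l) * fchar k p)"
      unfolding fconv_def
      by (simp only: infsum_cmult_left')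
    also have "\<dots> = (\<Sum>\<^sub>\<infinity>l. (a l * fchar l p) * (b (k - l) * fchar (k - l) p))"
      using fchar_add[of _ "k - _" p] by (intro infsum_cong) (metis (no_types, lifting) add_diff_cancel_left' diff_add_cancel fchar_add mult.assoc mult.commute)
    finally show ?thesis .
  qed
  then show ?thesis
    unfolding fseries_def using abs_summable_convolution(4)[OF s] by simp
qed

lemma fseries_bound:
  assumes "a norm_summable_on UNIV"
  shows "norm (fseries a p) \<le> (\<Sum>\<^sub>\<infinity>k. norm (a k))"
  using norm_infsum_bound[OF abs_summable_fchar[OF assms, of p]]
  by (simp add: fseries_def norm_mult norm_fchar)

lemma infsum_swap_abs:
  fixes f :: "'a \<Rightarrow> 'b \<Rightarrow> 'c::banach"
  assumes "(\<lambda>(x, y). f x y) norm_summable_on UNIV"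
  shows "(\<Sum>\<^sub>\<infinity>x. \<Sum>\<^sub>\<infinity>y. f x y) = (\<Sum>\<^sub>\<infinity>y. \<Sum>\<^sub>\<infinity>x. f x y)"
  by (rule infsum_swap_banach) (use abs_summable_summable[OF assms] in simp)

subsection \<open>A Neumann series in the weighted Wiener algebras\<close>

text \<open>Iterates for nu = rho + rho (sigma nu), where the product is convolution and sigma is a
  Fourier multiplier. In the application rho belongs to the cut-off oscillation F of t, and nu to F
  times the x-derivative of the solution.\<close>

primrec neumann :: "coeffs \<Rightarrow> coeffs \<Rightarrow> nat \<Rightarrow> coeffs" where
  "neumann \<rho> \<sigma> 0 = \<rho>"
| "neumann \<rho> \<sigma> (Suc n) = fconv \<rho> (\<lambda>k. \<sigma> k * neumann \<rho> \<sigma> n k)"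

definition neumann_sum :: "coeffs \<Rightarrow> coeffs \<Rightarrow> coeffs" where
  "neumann_sum \<rho> \<sigma> k = (\<Sum>\<^sub>\<infinity>n. neumann \<rho> \<sigma> n k)"

lemma neumann_wnorm:
  assumes \<rho>: "wsummable W \<rho>" and \<sigma>: "\<And>k. norm (\<sigma> k) \<le> M"
    and W1: "\<And>k. 1 \<le> W k" and W: "\<And>k l. W (k + l) \<le> W k * W l"
  shows "wsummable W (neumann \<rho> \<sigma> n) \<and> wnorm W (neumann \<rho> \<sigma> n) \<le> wnorm W \<rho> * (M * wnorm W \<rho>) ^ n"
proof (induction n)
  case 0
  then show ?case using \<rho> by simp
next
  case (Suc n)
  have W0: "0 \<le> W k" for k using W1[of k] by linarith
  have M0: "0 \<le> M" using \<sigma> norm_ge_zero order_trans by blast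
  let ?b = "\<lambda>k. \<sigma> k * neumann \<rho> \<sigma> n k"
  have le: "norm (?b k) \<le> M * norm (neumann \<rho> \<sigma> n k)" for k
    using \<sigma>[of k] by (simp add: norm_mult mult_right_mono)
  have b: "wsummable W ?b"
    by (rule wsummable_mono[OF _ le W0]) (use Suc in blast)
  have "wnorm W ?b \<le> (\<Sum>\<^sub>\<infinity>k. M * (W k * norm (neumann \<rho> \<sigma> n k)))"
    unfolding wnorm_def
  proof (rule infsum_mono)
    show "(\<lambda>k. W k * norm (?b k)) summable_on UNIV" using b by (simp add: wsummable_def)
    show "(\<lambda>k. M * (W k * norm (neumann \<rho> \<sigma> n k))) summable_on UNIV"
      using Suc by (intro summable_on_cmult_right) (auto simp: wsummable_def)
    show "W k * norm (?b k) \<le> M * (W k * norm (neumann \<rho> \<sigma> n k))" for k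
      using mult_left_mono[OF le[of k] W0[of k]] by (simp add: algebra_simps)
  qed
  also have "\<dots> = M * wnorm W (neumann \<rho> \<sigma> n)"
    using Suc unfolding wnorm_def by (intro infsum_cmult_right) (auto simp: wsummable_def)
  also have "\<dots> \<le> M * (wnorm W \<rho> * (M * wnorm W \<rho>) ^ n)"
    using Suc M0 by (intro mult_left_mono) auto
  finally have nb: "wnorm W ?b \<le> M * (wnorm W \<rho> * (M * wnorm W \<rho>) ^ n)" .
  have "0 \<le> wnorm W \<rho>" unfolding wnorm_def by (rule infsum_nonneg) (use W0 in auto)
  then have "wnorm W \<rho> * wnorm W ?b \<le> wnorm W \<rho> * (M * (wnorm W \<rho> * (M * wnorm W \<rho>) ^ n))"
    using nb by (intro mult_left_mono)
  then show ?case
    using wsummable_fconv[OF \<rho> b W1 W] by (simp add: algebra_simps)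
qed

text \<open>The weighted norms of the iterates decay geometrically. Summability jointly in
  \<open>n\<close> and \<open>k\<close> comes first, as it justifies exchanging the two
  sums.\<close>

lemma neumann_sum_wsummable:
  assumes \<rho>: "wsummable W \<rho>" and \<sigma>: "\<And>k. norm (\<sigma> k) \<le> M"
    and W1: "\<And>k. 1 \<le> W k" and W: "\<And>k l. W (k + l) \<le> W k * W l"
    and small: "M * wnorm W \<rho> < 1"
  shows "(\<lambda>(n, k). W k *\<^sub>R neumann \<rho> \<sigma> n k) norm_summable_on UNIV"
    and "wsummable W (neumann_sum \<rho> \<sigma>)"
    and "wnorm W (neumann_sum \<rho> \<sigma>) \<le> wnorm W \<rho> / (1 - M * wnorm W \<rho>)"
proof -
  have W0: "0 \<le> W k" for k using W1[of k] by linarith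
  have M0: "0 \<le> M" using \<sigma> norm_ge_zero order_trans by blast
  have n0: "0 \<le> wnorm W \<rho>" unfolding wnorm_def by (rule infsum_nonneg) (use W0 in auto)
  note nn = neumann_wnorm[OF \<rho> \<sigma> W1 W]
  define t where "t = M * wnorm W \<rho>"
  have t: "0 \<le> t" "t < 1" using M0 n0 small by (auto simp: t_def)
  have geo: "((\<lambda>n. wnorm W \<rho> * t ^ n) has_sum (wnorm W \<rho> * (1 / (1 - t)))) UNIV"
  proof (rule norm_summable_imp_has_sum)
    show "summable (\<lambda>n. norm (wnorm W \<rho> * t ^ n))"
      using t n0 by (simp add: norm_mult norm_power summable_mult summable_geometric)
    show "(\<lambda>n. wnorm W \<rho> * t ^ n) sums (wnorm W \<rho> * (1 / (1 - t)))"
      using t by (intro sums_mult geometric_sums) auto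
  qed
  have nsum: "(\<Sum>\<^sub>\<infinity>k. norm (W k *\<^sub>R neumann \<rho> \<sigma> n k)) = wnorm W (neumann \<rho> \<sigma> n)" for n
    using W0 by (simp add: wnorm_def)
  have wn0: "0 \<le> wnorm W (neumann \<rho> \<sigma> n)" for n
    unfolding wnorm_def by (rule infsum_nonneg) (use W0 in auto)
  have sn: "(\<lambda>n. wnorm W (neumann \<rho> \<sigma> n)) summable_on UNIV"
    by (rule summable_on_comparison_test[OF has_sum_imp_summable[OF geo]]) (use nn wn0 in \<open>auto simp: t_def\<close>)
  show 1: "(\<lambda>(n, k). W k *\<^sub>R neumann \<rho> \<sigma> n k) norm_summable_on UNIV"
    by (rule abs_summable_on_UNIV_prod) (use nn W0 nsum sn in \<open>auto simp: wsummable_def\<close>)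
  have swp: "bij_betw prod.swap UNIV (UNIV :: (nat \<times> (int \<times> int)) set)" by simp
  have 2: "(\<lambda>(k, n). W k *\<^sub>R neumann \<rho> \<sigma> n k) norm_summable_on UNIV"
    using summable_on_reindex_bij_betw[OF swp, of "\<lambda>p. norm (case p of (n, k) \<Rightarrow> W k *\<^sub>R neumann \<rho> \<sigma> n k)"] 1
    by (simp add: case_prod_beta)
  have S2: "(\<lambda>(k, n). W k *\<^sub>R neumann \<rho> \<sigma> n k) norm_summable_on Sigma UNIV (\<lambda>_. UNIV)"
    using 2 by simp
  have kn: "(\<lambda>n. W k *\<^sub>R neumann \<rho> \<sigma> n k) norm_summable_on UNIV" for k
    using S2[unfolded Infinite_Sum.abs_summable_on_Sigma_iff] by (cases k) simp
  have ks: "(\<lambda>k. \<Sum>\<^sub>\<infinity>n. norm (W k *\<^sub>R neumann \<rho> \<sigma> n k)) summable_on UNIV"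
    using S2[unfolded Infinite_Sum.abs_summable_on_Sigma_iff] by (simp add: infsum_nonneg W0)
  have le: "W k * norm (neumann_sum \<rho> \<sigma> k) \<le> (\<Sum>\<^sub>\<infinity>n. norm (W k *\<^sub>R neumann \<rho> \<sigma> n k))" for k
  proof -
    have "W k *\<^sub>R neumann_sum \<rho> \<sigma> k = (\<Sum>\<^sub>\<infinity>n. W k *\<^sub>R neumann \<rho> \<sigma> n k)"
      unfolding neumann_sum_def by (simp add: infsum_scaleR_right)
    then show ?thesis using norm_infsum_bound[OF kn, of k] W0 by (metis abs_of_nonneg norm_scaleR)
  qed
  show 3: "wsummable W (neumann_sum \<rho> \<sigma>)"
    unfolding wsummable_def by (rule summable_on_comparison_test[OF ks]) (use le W0 in auto)
  have "wnorm W (neumann_sum \<rho> \<sigma>) \<le> (\<Sum>\<^sub>\<infinity>k. \<Sum>\<^sub>\<infinity>n. norm (W k *\<^sub>R neumann \<rho> \<sigma> n k))"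
    unfolding wnorm_def by (rule infsum_mono[OF _ ks]) (use 3 le in \<open>auto simp: wsummable_def\<close>)
  also have "\<dots> = (\<Sum>\<^sub>\<infinity>n. wnorm W (neumann \<rho> \<sigma> n))"
    unfolding nsum[symmetric] by (rule infsum_swap_abs) (use 2 in \<open>simp add: case_prod_beta\<close>)
  also have "\<dots> \<le> (\<Sum>\<^sub>\<infinity>n. wnorm W \<rho> * t ^ n)"
    by (rule infsum_mono[OF sn has_sum_imp_summable[OF geo]]) (use nn in \<open>auto simp: t_def\<close>)
  also have "\<dots> = wnorm W \<rho> / (1 - M * wnorm W \<rho>)"
    using infsumI[OF geo] by (simp add: t_def)
  finally show "wnorm W (neumann_sum \<rho> \<sigma>) \<le> wnorm W \<rho> / (1 - M * wnorm W \<rho>)" .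
qed

text \<open>The fixed-point equation of the Neumann series as an identity of functions: splitting
  off the term \<open>n = 0\<close> leaves rho times the multiplier sigma applied to the
  sum.\<close>

lemma neumann_sum_fseries:
  assumes \<rho>: "\<rho> norm_summable_on UNIV" and \<sigma>: "\<And>k. norm (\<sigma> k) \<le> M"
    and small: "M * (\<Sum>\<^sub>\<infinity>k. norm (\<rho> k)) < 1"
  shows "fseries (neumann_sum \<rho> \<sigma>) p =
    fseries \<rho> p * (1 + fseries (\<lambda>k. \<sigma> k * neumann_sum \<rho> \<sigma> k) p)"
proof -
  have W: "wsummable (\<lambda>k. 1) \<rho>" "M * wnorm (\<lambda>k. 1) \<rho> < 1"
    using \<rho> small by (simp_all add: wsummable_def wnorm_def)
  let ?\<nu> = "neumann \<rho> \<sigma>"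
  have nk: "(\<lambda>(n, k). ?\<nu> n k) norm_summable_on UNIV"
    using neumann_sum_wsummable(1)[OF W(1) \<sigma> _ _ W(2)] by simp
  have ns: "?\<nu> n norm_summable_on UNIV" for n
    using neumann_wnorm[OF W(1) \<sigma>, where n = n] by (simp add: wsummable_def)
  have \<sigma>s: "(\<lambda>k. \<sigma> k * ?\<nu> n k) norm_summable_on UNIV" for n
    using wsummable_mono[of "\<lambda>k. 1" "?\<nu> n" "\<lambda>k. \<sigma> k * ?\<nu> n k" M] ns \<sigma>
    by (simp add: wsummable_def norm_mult mult_right_mono)
  \<comment> \<open>Stated for a bounded multiplier \<open>c\<close>, to be used both with
    \<open>c = 1\<close> and with \<open>c = \<sigma>\<close>.\<close>
  have swap: "(\<Sum>\<^sub>\<infinity>k. c k * neumann_sum \<rho> \<sigma> k * fchar k p) = (\<Sum>\<^sub>\<infinity>n. \<Sum>\<^sub>\<infinity>k. c k * ?\<nu> n k * fchar k p)"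
    and sumn: "(\<lambda>n. \<Sum>\<^sub>\<infinity>k. c k * ?\<nu> n k * fchar k p) summable_on UNIV"
    if c: "\<And>k. norm (c k) \<le> C" for c C
  proof -
    have s: "(\<lambda>(n, k). c k * ?\<nu> n k * fchar k p) norm_summable_on UNIV"
    proof (rule summable_on_comparison_test)
      show "(\<lambda>x. C * norm (case x of (n, k) \<Rightarrow> ?\<nu> n k)) summable_on UNIV"
        using nk by (rule summable_on_cmult_right)
      show "norm (case x of (n, k) \<Rightarrow> c k * ?\<nu> n k * fchar k p) \<le> C * norm (case x of (n, k) \<Rightarrow> ?\<nu> n k)" for x
        using c by (cases x) (simp add: norm_mult norm_fchar mult_right_mono)
    qed auto
    have "(\<Sum>\<^sub>\<infinity>n. \<Sum>\<^sub>\<infinity>k. c k * ?\<nu> n k * fchar k p) = (\<Sum>\<^sub>\<infinity>k. \<Sum>\<^sub>\<infinity>n. c k * ?\<nu> n k * fchar k p)"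
      by (rule infsum_swap_abs[OF s])
    also have "\<dots> = (\<Sum>\<^sub>\<infinity>k. c k * neumann_sum \<rho> \<sigma> k * fchar k p)"
      unfolding neumann_sum_def by (simp only: infsum_cmult_left' infsum_cmult_right')
    finally show "(\<Sum>\<^sub>\<infinity>k. c k * neumann_sum \<rho> \<sigma> k * fchar k p) = (\<Sum>\<^sub>\<infinity>n. \<Sum>\<^sub>\<infinity>k. c k * ?\<nu> n k * fchar k p)" ..
    have "(\<lambda>(n, k). c k * ?\<nu> n k * fchar k p) summable_on Sigma UNIV (\<lambda>_. UNIV)"
      using abs_summable_summable[OF s] by simp
    from summable_on_Sigma_banach[OF this]
    show "(\<lambda>n. \<Sum>\<^sub>\<infinity>k. c k * ?\<nu> n k * fchar k p) summable_on UNIV" by simp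
  qed
  have eq1: "fseries (neumann_sum \<rho> \<sigma>) p = (\<Sum>\<^sub>\<infinity>n. fseries (?\<nu> n) p)"
    and s1: "(\<lambda>n. fseries (?\<nu> n) p) summable_on UNIV"
    using swap[of "\<lambda>k. 1" 1] sumn[of "\<lambda>k. 1" 1] by (simp_all add: fseries_def)
  have eq2: "fseries (\<lambda>k. \<sigma> k * neumann_sum \<rho> \<sigma> k) p = (\<Sum>\<^sub>\<infinity>n. fseries (\<lambda>k. \<sigma> k * ?\<nu> n k) p)"
    using swap[of \<sigma>, OF \<sigma>] by (simp add: fseries_def)
  have step: "fseries (?\<nu> (Suc n)) p = fseries \<rho> p * fseries (\<lambda>k. \<sigma> k * ?\<nu> n k) p" for n
    using fseries_fconv[OF \<rho> \<sigma>s] by simp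
  have "(\<Sum>\<^sub>\<infinity>n. fseries (?\<nu> n) p) = fseries (?\<nu> 0) p + (\<Sum>\<^sub>\<infinity>n\<in>-{0}. fseries (?\<nu> n) p)"
    using infsum_Un_disjoint[of "\<lambda>n. fseries (?\<nu> n) p" "{0}" "-{0}"] summable_on_subset_banach[OF s1]
    by (simp add: Compl_partition)
  also have "(\<Sum>\<^sub>\<infinity>n\<in>-{0}. fseries (?\<nu> n) p) = (\<Sum>\<^sub>\<infinity>n. fseries (?\<nu> (Suc n)) p)"
  proof -
    have "bij_betw Suc UNIV (-{0})"
      by (rule bij_betw_byWitness[where f' = "\<lambda>n. n - 1"]) auto
    from infsum_reindex_bij_betw[OF this, of "\<lambda>n. fseries (?\<nu> n) p"] show ?thesis by (rule sym)
  qed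
  also have "\<dots> = fseries \<rho> p * (\<Sum>\<^sub>\<infinity>n. fseries (\<lambda>k. \<sigma> k * ?\<nu> n k) p)"
    unfolding step by (rule infsum_cmult_right')
  finally show ?thesis unfolding eq1 eq2 by (simp add: algebra_simps)
qed

text \<open>As a function of \<open>e\<close> the left side is convex on [0, 1], and the right side
  is its chord between \<open>e = 0\<close> and \<open>e = 1\<close>.\<close>

lemma power_one_plus_convex:
  fixes e t :: real
  assumes "0 \<le> e" "e \<le> 1" "0 \<le> t"
  shows "(1 + e * t) ^ s \<le> 1 + e * ((1 + t) ^ s - 1)"
proof (induction s)
  case (Suc s)
  define A where "A = (1 + t) ^ s"
  have A: "A \<ge> 1" using assms by (simp add: A_def)
  have "(1 + e * t) ^ Suc s \<le> (1 + e * (A - 1)) * (1 + e * t)"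
    using mult_right_mono[OF Suc, of "1 + e * t"] assms by (simp add: A_def algebra_simps)
  also have "\<dots> = 1 + e * (A - 1) + e * t + e * (e * ((A - 1) * t))"
    by (simp add: algebra_simps)
  also have "e * (e * ((A - 1) * t)) \<le> e * (1 * ((A - 1) * t))"
    using A assms by (intro mult_left_mono mult_right_mono) auto
  also have "1 + e * (A - 1) + e * t + e * (1 * ((A - 1) * t)) = 1 + e * ((1 + t) ^ Suc s - 1)"
    by (simp add: A_def algebra_simps)
  finally show ?case by simp
qed simp

text \<open>Summability against every power of \<open>1 + mag k\<close> survives because \<open>(1 + e * mag k) ^ s\<close> is
  a submultiplicative weight for which the norm of \<open>\<rho>\<close> tends to its \<open>l\<^sup>1\<close> norm as \<open>e\<close> tends to \<open>0\<close>.\<close>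

lemma neumann_sum_rapid:
  assumes \<rho>: "rapid \<rho>" and \<sigma>: "\<And>k. norm (\<sigma> k) \<le> M"
    and small: "M * (\<Sum>\<^sub>\<infinity>k. norm (\<rho> k)) < 1"
  shows "rapid (neumann_sum \<rho> \<sigma>)"
  unfolding rapid_def
proof
  fix s
  have M0: "0 \<le> M" using \<sigma> norm_ge_zero order_trans by blast
  let ?n0 = "\<Sum>\<^sub>\<infinity>k. norm (\<rho> k)"
  define n where "n = wnorm (\<lambda>k. (1 + mag k) ^ s) \<rho>"
  have rs: "(\<lambda>k. (1 + mag k) ^ s * norm (\<rho> k)) summable_on UNIV"
    using \<rho> unfolding rapid_def wsummable_def by blast
  have r0: "(\<lambda>k. norm (\<rho> k)) summable_on UNIV"
    using \<rho> unfolding rapid_def wsummable_def by (elim allE[of _ 0]) simp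
  have n: "n \<ge> 0" unfolding n_def wnorm_def by (rule infsum_nonneg) (simp add: mag_nonneg)
  \<comment> \<open>Makes \<open>e * (M * n + 1)\<close> at most half of the margin
    \<open>1 - M * ?n0\<close>, so the weighted norm still satisfies the smallness
    condition.\<close>
  define e where "e = min 1 ((1 - M * ?n0) / (2 * (M * n + 1)))"
  have den: "0 < M * n + 1" using M0 n by (simp add: add_nonneg_pos)
  have e: "0 < e" "e \<le> 1" using small den by (auto simp: e_def)
  have eMn: "e * (M * n) < 1 - M * ?n0"
  proof -
    have "e * (M * n) \<le> e * (M * n + 1)" using e by simp
    also have "\<dots> \<le> (1 - M * ?n0) / (2 * (M * n + 1)) * (M * n + 1)"
      using den by (intro mult_right_mono) (auto simp: e_def)
    also have "\<dots> = (1 - M * ?n0) / 2" using den by (simp add: field_simps)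
    also have "\<dots> < 1 - M * ?n0" using small by simp
    finally show ?thesis .
  qed
  define W where "W k = (1 + e * mag k) ^ s" for k
  have W1: "1 \<le> W k" for k using e mag_nonneg[of k] by (simp add: W_def)
  have W: "W (k + l) \<le> W k * W l" for k l
  proof -
    have "1 + e * mag (k + l) \<le> 1 + e * (mag k + mag l)"
      using e mag_add[of k l] by simp
    also have "\<dots> \<le> (1 + e * mag k) * (1 + e * mag l)"
      using e mag_nonneg[of k] mag_nonneg[of l] by (simp add: algebra_simps)
    finally show ?thesis
      unfolding W_def power_mult_distrib[symmetric] using e mag_nonneg[of "k + l"] by (intro power_mono) auto
  qed
  have Wle: "W k * norm (\<rho> k) \<le> norm (\<rho> k) + e * ((1 + mag k) ^ s * norm (\<rho> k))" for k
  proof -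
    have "W k \<le> 1 + e * ((1 + mag k) ^ s - 1)"
      unfolding W_def by (rule power_one_plus_convex) (use e mag_nonneg in auto)
    also have "\<dots> \<le> 1 + e * (1 + mag k) ^ s" using e by (simp add: algebra_simps)
    finally show ?thesis using mult_right_mono[of "W k" "1 + e * (1 + mag k) ^ s" "norm (\<rho> k)"]
      by (simp add: algebra_simps)
  qed
  have su: "(\<lambda>k. norm (\<rho> k) + e * ((1 + mag k) ^ s * norm (\<rho> k))) summable_on UNIV"
    by (intro summable_on_add r0 summable_on_cmult_right rs)
  have \<rho>W: "wsummable W \<rho>"
    unfolding wsummable_def
    by (rule summable_on_comparison_test[OF su]) (use Wle W1 order_trans[OF zero_le_one W1] in auto)
  have "wnorm W \<rho> \<le> (\<Sum>\<^sub>\<infinity>k. norm (\<rho> k) + e * ((1 + mag k) ^ s * norm (\<rho> k)))"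
    unfolding wnorm_def by (rule infsum_mono[OF _ su Wle]) (use \<rho>W in \<open>simp add: wsummable_def\<close>)
  also have "\<dots> = ?n0 + e * n"
    by (simp only: infsum_add[OF r0 summable_on_cmult_right[OF rs]] infsum_cmult_right' n_def wnorm_def)
  finally have "M * wnorm W \<rho> \<le> M * (?n0 + e * n)"
    using M0 by (rule mult_left_mono)
  also have "\<dots> < 1" using eMn by (simp add: algebra_simps)
  finally have \<nu>: "wsummable W (neumann_sum \<rho> \<sigma>)"
    by (rule neumann_sum_wsummable(2)[OF \<rho>W \<sigma> W1 W])
  have "(1 + mag k) ^ s \<le> (1 / e) ^ s * W k" for k
  proof -
    have "e * (1 + mag k) \<le> 1 + e * mag k" using e by (simp add: algebra_simps)
    then have "1 + mag k \<le> 1 / e * (1 + e * mag k)" using e by (simp add: field_simps)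
    then have "(1 + mag k) ^ s \<le> (1 / e * (1 + e * mag k)) ^ s"
      using mag_nonneg[of k] by (intro power_mono) auto
    then show ?thesis unfolding W_def by (simp only: power_mult_distrib)
  qed
  then have le: "(1 + mag k) ^ s * norm (neumann_sum \<rho> \<sigma> k) \<le> (1 / e) ^ s * (W k * norm (neumann_sum \<rho> \<sigma> k))" for k
    using mult_right_mono[of "(1 + mag k) ^ s" "(1 / e) ^ s * W k" "norm (neumann_sum \<rho> \<sigma> k)"]
    by (simp only: mult.assoc norm_ge_zero)
  show "wsummable (\<lambda>k. (1 + mag k) ^ s) (neumann_sum \<rho> \<sigma>)"
    unfolding wsummable_def
    by (rule summable_on_comparison_test[OF summable_on_cmult_right[OF \<nu>[unfolded wsummable_def]] le])
      (simp add: mag_nonneg)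
qed

text \<open>With t = M times the norm of rho the bound is t / (1 - t), which is below 1 exactly for
  t < 1/2. The stronger smallness is what later keeps the x-derivative of the solution away from
  zero.\<close>

lemma neumann_sum_norm:
  assumes \<rho>: "\<rho> norm_summable_on UNIV" and \<sigma>: "\<And>k. norm (\<sigma> k) \<le> M"
    and small: "M * (\<Sum>\<^sub>\<infinity>k. norm (\<rho> k)) < 1 / 2"
  shows "M * (\<Sum>\<^sub>\<infinity>k. norm (neumann_sum \<rho> \<sigma> k)) < 1"
proof -
  have M0: "0 \<le> M" using \<sigma> norm_ge_zero order_trans by blast
  define t where "t = M * (\<Sum>\<^sub>\<infinity>k. norm (\<rho> k))"
  have W: "wsummable (\<lambda>k. 1) \<rho>" "M * wnorm (\<lambda>k. 1) \<rho> < 1"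
    using \<rho> small by (simp_all add: wsummable_def wnorm_def)
  have "M * (\<Sum>\<^sub>\<infinity>k. norm (neumann_sum \<rho> \<sigma> k)) \<le> M * ((\<Sum>\<^sub>\<infinity>k. norm (\<rho> k)) / (1 - t))"
    using neumann_sum_wsummable(3)[OF W(1) \<sigma> _ _ W(2)] M0
    by (intro mult_left_mono) (simp_all add: wnorm_def t_def)
  also have "\<dots> = t / (1 - t)" by (simp add: t_def)
  also have "\<dots> < 1" using small by (simp add: t_def divide_less_eq)
  finally show ?thesis .
qed

subsection \<open>Smoothness of rapidly convergent Fourier series\<close>

lemma rapid_mult:
  assumes a: "rapid a" and c: "\<And>k. norm (c k) \<le> K * (1 + mag k) ^ m"
  shows "rapid (\<lambda>k. c k * a k)"
  unfolding rapid_def wsummable_def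
proof
  fix s
  have "(\<lambda>k. K * ((1 + mag k) ^ (s + m) * norm (a k))) summable_on UNIV"
    by (rule summable_on_cmult_right[OF a[unfolded rapid_def wsummable_def, rule_format]])
  then show "(\<lambda>k. (1 + mag k) ^ s * norm (c k * a k)) summable_on UNIV"
  proof (rule summable_on_comparison_test)
    fix k
    have "(1 + mag k) ^ s * (norm (c k) * norm (a k)) \<le> (1 + mag k) ^ s * (K * (1 + mag k) ^ m * norm (a k))"
      using c[of k] mag_nonneg[of k] by (intro mult_left_mono mult_right_mono) auto
    then show "(1 + mag k) ^ s * norm (c k * a k) \<le> K * ((1 + mag k) ^ (s + m) * norm (a k))"
      by (simp add: norm_mult power_add algebra_simps)
  qed (simp add: mag_nonneg)
qed

lemma rapid_norm_summable: "rapid a \<Longrightarrow> a norm_summable_on UNIV"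
  unfolding rapid_def wsummable_def by (elim allE[of _ 0]) simp

text \<open>The eigenvalue i (k . v) of differentiation along \<open>v\<close> on the character
  \<open>fchar k\<close>.\<close>

definition fchar_symbol :: "int \<times> int \<Rightarrow> real \<times> real \<Rightarrow> complex" where
  "fchar_symbol k v = \<i> * of_real (of_int (fst k) * fst v + of_int (snd k) * snd v)"

lemma norm_fchar_symbol: "norm (fchar_symbol k v) \<le> mag k * norm v"
proof -
  have "norm (fchar_symbol k v) \<le> \<bar>of_int (fst k)\<bar> * \<bar>fst v\<bar> + \<bar>of_int (snd k)\<bar> * \<bar>snd v\<bar>"
    unfolding fchar_symbol_def norm_mult norm_ii norm_of_real
    by (simp add: abs_mult[symmetric] abs_triangle_ineq)
  also have "\<dots> \<le> \<bar>of_int (fst k)\<bar> * norm v + \<bar>of_int (snd k)\<bar> * norm v"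
    using norm_fst_le[of "fst v" "snd v"] norm_snd_le[of "snd v" "fst v"]
    by (intro add_mono mult_left_mono) auto
  also have "\<dots> = mag k * norm v" by (simp add: mag_def algebra_simps)
  finally show ?thesis .
qed

lemma fchar_has_derivative:
  "(fchar k has_derivative (\<lambda>v. fchar_symbol k v * fchar k p)) (at p within S)"
proof -
  have "linear (fchar_symbol k)"
    by (rule linearI) (simp_all add: fchar_symbol_def algebra_simps scaleR_conv_of_real)
  then have "(fchar_symbol k has_derivative fchar_symbol k) (at p within S)"
    by (simp add: linear_conv_bounded_linear bounded_linear_imp_has_derivative)
  moreover have "(exp has_derivative (*) (exp (fchar_symbol k p))) (at (fchar_symbol k p))"
    using DERIV_exp by (simp add: has_field_derivative_def)
  ultimately have "((\<lambda>p. exp (fchar_symbol k p)) has_derivative (\<lambda>v. exp (fchar_symbol k p) * fchar_symbol k v)) (at p within S)"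
    by (rule has_derivative_compose)
  then show ?thesis
    by (simp add: fchar_def[abs_def] fchar_symbol_def cis_conv_exp mult.commute)
qed

text \<open>An enumeration of the lattice, because termwise differentiation is available for
  sequential series while the Fourier sums are unordered.\<close>

definition zenum :: "nat \<Rightarrow> int \<times> int" where "zenum = from_nat_into UNIV"

lemma bij_zenum: "bij_betw zenum UNIV UNIV"
proof -
  have "infinite (UNIV :: (int \<times> int) set)" by (simp add: finite_prod)
  then show ?thesis unfolding zenum_def by (intro bij_betw_from_nat_into) auto
qed

lemma sums_zenum:
  fixes f :: "int \<times> int \<Rightarrow> 'a::banach"
  assumes "f norm_summable_on UNIV"
  shows "(\<lambda>n. f (zenum n)) sums (\<Sum>\<^sub>\<infinity>k. f k)"
proof -
  have "((\<lambda>n. f (zenum n)) has_sum (\<Sum>\<^sub>\<infinity>k. f k)) UNIV"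
    using has_sum_reindex_bij_betw[OF bij_zenum, of f] abs_summable_summable[OF assms] by (simp add: has_sum_infsum)
  then show ?thesis by (rule has_sum_imp_sums)
qed

text \<open>Termwise differentiation: the tails of the derived series are bounded, uniformly in the
  point, by \<open>norm h\<close> times tails of the sum of
  \<open>mag k * norm (a k)\<close>.\<close>

lemma fseries_has_derivative:
  assumes a: "a norm_summable_on UNIV" and ma: "(\<lambda>k. mag k * norm (a k)) summable_on UNIV"
  shows "(fseries a has_derivative (\<lambda>v. fseries (\<lambda>k. fchar_symbol k v * a k) p)) (at p)"
proof -
  define f where "f n x = a (zenum n) * fchar (zenum n) x" for n x
  define f' where "f' n x h = fchar_symbol (zenum n) h * a (zenum n) * fchar (zenum n) x" for n x h
  define g where "g n = mag (zenum n) * norm (a (zenum n))" for n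
  have sg: "summable g"
    using sums_zenum[of "\<lambda>k. mag k * norm (a k)"] ma mag_nonneg by (auto simp: g_def[abs_def] summable_def)
  have sf: "(\<lambda>n. f n x) sums fseries a x" for x
    unfolding f_def fseries_def by (rule sums_zenum[OF abs_summable_fchar[OF a]])
  have dle: "norm (fchar_symbol k h * a k) \<le> norm h * (mag k * norm (a k))" for k h
    using mult_right_mono[OF norm_fchar_symbol[of k h], of "norm (a k)"] by (simp add: norm_mult algebra_simps)
  have da: "(\<lambda>k. fchar_symbol k h * a k) norm_summable_on UNIV" for h
    by (rule summable_on_comparison_test[OF summable_on_cmult_right[OF ma] dle]) auto
  have sf': "(\<lambda>n. f' n x h) sums fseries (\<lambda>k. fchar_symbol k h * a k) x" for x h
    unfolding f'_def fseries_def by (rule sums_zenum[OF abs_summable_fchar[OF da]])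
  have f'g: "norm (f' n x h) \<le> norm h * g n" for n x h
    using dle[of "zenum n" h] by (simp add: f'_def g_def norm_mult norm_fchar)
  have "\<exists>G. \<forall>x\<in>UNIV. (\<lambda>n. f n x) sums (G x) \<and>
      (G has_derivative (\<lambda>v. fseries (\<lambda>k. fchar_symbol k v * a k) x)) (at x within UNIV)"
  proof (rule has_derivative_series)
    show "(f n has_derivative f' n x) (at x within UNIV)" for n x
      unfolding f_def f'_def
      using has_derivative_mult_right[OF fchar_has_derivative, of "a (zenum n)" "zenum n" x UNIV]
      by (simp add: algebra_simps)
    fix e :: real assume "e > 0"
    from suminf_exist_split[OF this sg] obtain N where N: "\<And>n. n \<ge> N \<Longrightarrow> norm (\<Sum>i. g (i + n)) < e"
      by blast
    have "norm ((\<Sum>i<n. f' i x h) - fseries (\<lambda>k. fchar_symbol k h * a k) x) \<le> e * norm h" if n: "n \<ge> N" for n x h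
    proof -
      have sg': "summable (\<lambda>i. g (i + n))" using sg summable_ignore_initial_segment by blast
      have "(\<Sum>i. f' (i + n) x h) = fseries (\<lambda>k. fchar_symbol k h * a k) x - (\<Sum>i<n. f' i x h)"
        using sums_unique[OF sums_split_initial_segment[OF sf']] by (rule sym)
      then have "norm (fseries (\<lambda>k. fchar_symbol k h * a k) x - (\<Sum>i<n. f' i x h)) = norm (\<Sum>i. f' (i + n) x h)"
        by (simp only:)
      also have "\<dots> \<le> (\<Sum>i. norm h * g (i + n))"
        by (rule norm_suminf_le[OF f'g summable_mult[OF sg']])
      also have "\<dots> = norm h * (\<Sum>i. g (i + n))" by (rule suminf_mult[OF sg'])
      also have "\<dots> \<le> norm h * e" using N[OF n] by (intro mult_left_mono) auto
      finally show ?thesis by (simp add: norm_minus_commute mult.commute)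
    qed
    then show "\<forall>\<^sub>F n in sequentially. \<forall>x\<in>UNIV. \<forall>h. norm ((\<Sum>i<n. f' i x h) - fseries (\<lambda>k. fchar_symbol k h * a k) x) \<le> e * norm h"
      unfolding eventually_sequentially by blast
  qed (use sf in auto)
  then obtain G where G: "\<And>x. (\<lambda>n. f n x) sums (G x)"
      "\<And>x. (G has_derivative (\<lambda>v. fseries (\<lambda>k. fchar_symbol k v * a k) x)) (at x)" by auto
  have "G = fseries a" using sums_unique2[OF G(1) sf] by auto
  then show ?thesis using G(2) by simp
qed

lemma rapid_fchar_symbol: "rapid a \<Longrightarrow> rapid (\<lambda>k. fchar_symbol k v * a k)"
proof (rule rapid_mult)
  show "norm (fchar_symbol k v) \<le> norm v * (1 + mag k) ^ 1" for k
    by (rule order_trans[OF norm_fchar_symbol]) (simp add: algebra_simps)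
qed

lemma rapid_fseries_has_derivative:
  assumes "rapid a"
  shows "(fseries a has_derivative (\<lambda>v. fseries (\<lambda>k. fchar_symbol k v * a k) p)) (at p)"
proof (rule fseries_has_derivative[OF rapid_norm_summable[OF assms]])
  have "rapid (\<lambda>k. complex_of_real (mag k) * a k)"
    by (rule rapid_mult[OF assms, of _ 1 1]) (simp add: mag_nonneg)
  from rapid_norm_summable[OF this] show "(\<lambda>k. mag k * norm (a k)) summable_on UNIV"
    by (simp add: norm_mult mag_nonneg)
qed

lemma smooth_on_fseries: "rapid a \<Longrightarrow> smooth_on UNIV (fseries a)"
proof -
  assume "rapid a"
  then have "higher_differentiable_on UNIV (fseries a) n" for n
  proof (induction n arbitrary: a)
    case 0
    have "continuous_on UNIV (fseries a)"
      using has_derivative_continuous[OF rapid_fseries_has_derivative[OF 0]]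
      by (simp add: continuous_on_eq_continuous_at)
    then show ?case by simp
  next
    case (Suc n)
    show ?case
      by (rule hdiff_SucI[OF open_UNIV rapid_fseries_has_derivative[OF Suc.prems]])
        (use Suc rapid_fchar_symbol in blast)
  qed
  then show ?thesis by (simp add: smooth_on_def)
qed

subsection \<open>Fourier inversion on the torus\<close>

definition torus :: "(real \<times> real) set" where
  "torus = cbox (- pi, - pi) (pi, pi)"

text \<open>The functions of interest are only controlled near the closed box, so periodicity means
  equal values at opposite boundary points. That is enough for boundary terms to cancel.\<close>

definition torus_periodic :: "(real \<times> real \<Rightarrow> complex) \<Rightarrow> bool" where
  "torus_periodic F \<longleftrightarrow> (\<forall>t\<in>{-pi..pi}. F (pi, t) = F (- pi, t) \<and> F (t, pi) = F (t, - pi))"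

lemma torus_iff: "p \<in> torus \<longleftrightarrow> fst p \<in> {-pi..pi} \<and> snd p \<in> {-pi..pi}"
  by (cases p) (auto simp: torus_def cbox_Pair_eq)

lemma content_torus: "measure lborel torus = 4 * pi\<^sup>2"
  by (simp add: torus_def content_Pair power2_eq_square)

lemma continuous_on_fchar: "continuous_on S (fchar k)"
  unfolding fchar_def[abs_def] by (intro continuous_intros)

lemma torus_periodic_fchar: "torus_periodic (fchar k)"
  unfolding torus_periodic_def fchar_def
proof safe
  have e: "cis (of_int m * pi) = cis (- (of_int m * pi))" for m :: int
    by (rule complex_eqI) (auto simp: sin_int_times_real mult.commute)
  have "cis (of_int (fst k) * pi + b) = cis (of_int (fst k) * - pi + b)"
    "cis (b + of_int (snd k) * pi) = cis (b + of_int (snd k) * - pi)" for b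
    unfolding cis_mult[symmetric] using e by simp_all
  then show "cis (of_int (fst k) * fst (pi, t) + of_int (snd k) * snd (pi, t)) =
      cis (of_int (fst k) * fst (- pi, t) + of_int (snd k) * snd (- pi, t))"
    "cis (of_int (fst k) * fst (t, pi) + of_int (snd k) * snd (t, pi)) =
      cis (of_int (fst k) * fst (t, - pi) + of_int (snd k) * snd (t, - pi))" for t
    by simp_all
qed

text \<open>Fubini with the inner integral along \<open>e\<close>: on each such segment the
  fundamental theorem gives a difference of endpoint values, which periodicity cancels.\<close>

lemma integral_torus_derivative:
  fixes \<Phi> :: "real \<times> real \<Rightarrow> complex"
  assumes d: "\<And>p. p \<in> torus \<Longrightarrow> (\<Phi> has_derivative D p) (at p)"
    and per: "torus_periodic \<Phi>" and e: "e = (1, 0) \<or> e = (0, 1)"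
    and c: "continuous_on torus (\<lambda>p. D p e)"
  shows "integral torus (\<lambda>p. D p e) = 0"
proof -
  have c': "continuous_on (cbox (- pi, - pi) (pi, pi)) (\<lambda>(x, y). D (x, y) e)"
    using c by (simp add: torus_def case_prod_unfold)
  have iter: "integral torus (\<lambda>p. D p e) = integral (cbox (-pi) pi) (\<lambda>x. integral (cbox (-pi) pi) (\<lambda>y. D (x, y) e))"
    unfolding torus_def by (rule integral_prod_continuous) (use c in \<open>simp add: torus_def\<close>)
  have pp: "- pi \<le> pi" using pi_ge_zero by linarith
  have line: "integral (cbox (-pi) pi) (\<lambda>s. D (c + s *\<^sub>R e) e) = 0"
    if c: "\<And>s. s \<in> {-pi..pi} \<Longrightarrow> c + s *\<^sub>R e \<in> torus" and ends: "\<Phi> (c + pi *\<^sub>R e) = \<Phi> (c + (- pi) *\<^sub>R e)" for c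
  proof -
    have "((\<lambda>s. D (c + s *\<^sub>R e) e) has_integral \<Phi> (c + pi *\<^sub>R e) - \<Phi> (c + (- pi) *\<^sub>R e)) {-pi..pi}"
    proof (rule fundamental_theorem_of_calculus[OF pp])
      fix s assume s: "s \<in> {-pi..pi}"
      have "((\<lambda>s. c + s *\<^sub>R e) has_derivative (\<lambda>r. r *\<^sub>R e)) (at s within {-pi..pi})"
        by (auto intro!: derivative_eq_intros)
      from has_derivative_compose[OF this d[OF c[OF s]]]
      show "((\<lambda>s. \<Phi> (c + s *\<^sub>R e)) has_vector_derivative D (c + s *\<^sub>R e) e) (at s within {-pi..pi})"
        by (simp add: has_vector_derivative_def linear_scale[OF has_derivative_linear[OF d[OF c[OF s]]]])
    qed
    then show ?thesis using ends by (simp add: integral_unique)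
  qed
  from e show ?thesis
  proof
    assume e: "e = (0, 1)"
    have "integral (cbox (-pi) pi) (\<lambda>y. D (x, y) e) = 0" if "x \<in> cbox (-pi) pi" for x
      using line[of "(x, 0)"] that per by (simp add: e torus_iff torus_periodic_def)
    then have "integral (cbox (-pi) pi) (\<lambda>x. integral (cbox (-pi) pi) (\<lambda>y. D (x, y) e)) = integral (cbox (-pi) pi) (\<lambda>x. 0)"
      by (rule integral_cong)
    then show ?thesis unfolding iter by simp
  next
    assume e: "e = (1, 0)"
    have "integral (cbox (-pi) pi) (\<lambda>x. D (x, y) e) = 0" if "y \<in> cbox (-pi) pi" for y
      using line[of "(0, y)"] that per by (simp add: e torus_iff torus_periodic_def)
    then have "integral (cbox (-pi) pi) (\<lambda>y. integral (cbox (-pi) pi) (\<lambda>x. D (x, y) e)) = integral (cbox (-pi) pi) (\<lambda>x. 0)"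
      by (rule integral_cong)
    then show ?thesis unfolding iter integral_swap_continuous[OF c'] by simp
  qed
qed

text \<open>For nonzero \<open>k\<close> some coordinate derivative multiplies the character by a
  nonzero constant, and that derivative integrates to zero.\<close>

lemma integral_fchar: "integral torus (fchar k) = (if k = 0 then 4 * pi\<^sup>2 else 0)"
proof (cases "k = 0")
  case True
  then have "fchar k = (\<lambda>p. 1)" by (simp add: fchar_def fun_eq_iff)
  then show ?thesis using True content_torus by (simp add: torus_def scaleR_conv_of_real)
next
  case False
  then obtain e where e: "e = (1, 0) \<or> e = (0, 1)" "fchar_symbol k e \<noteq> 0"
    by (cases k) (force simp: fchar_symbol_def zero_prod_def)
  have "integral torus (\<lambda>p. fchar_symbol k e * fchar k p) = 0"
    by (rule integral_torus_derivative[OF fchar_has_derivative torus_periodic_fchar e(1)])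
      (intro continuous_intros continuous_on_fchar)
  then show ?thesis using e(2) False by simp
qed

lemma continuous_on_fseries_torus:
  assumes "a norm_summable_on UNIV"
  shows "uniform_limit S (\<lambda>X p. \<Sum>k\<in>X. a k * fchar k p) (fseries a) (finite_subsets_at_top UNIV)"
    and "continuous_on S (fseries a)"
proof -
  show 1: "uniform_limit S (\<lambda>X p. \<Sum>k\<in>X. a k * fchar k p) (fseries a) (finite_subsets_at_top UNIV)"
    unfolding fseries_def[abs_def]
    by (rule Weierstrass_m_test_general[where M = "\<lambda>k. norm (a k)"])
      (use assms in \<open>auto simp: norm_mult norm_fchar\<close>)
  show "continuous_on S (fseries a)"
    by (rule uniform_limit_theorem[OF _ 1])
      (auto intro!: always_eventually continuous_intros continuous_on_fchar)
qed

lemma integrable_torus: "continuous_on torus F \<Longrightarrow> F integrable_on torus"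
  for F :: "real \<times> real \<Rightarrow> 'b::banach"
  unfolding torus_def by (rule integrable_continuous)

definition fcoef :: "(real \<times> real \<Rightarrow> complex) \<Rightarrow> coeffs" where
  "fcoef F k = integral torus (\<lambda>p. F p * fchar (- k) p) / (4 * pi\<^sup>2)"

lemma fchar_minus: "fchar k p * fchar (- k) p = 1"
  using fchar_add[of k "- k" p] by (simp add: fchar_def)

text \<open>Multiplying by \<open>fchar (- k)\<close> shifts the frequencies by \<open>k\<close>,
  reducing to the mean value; uniform convergence allows termwise integration.\<close>

lemma fcoef_fseries:
  assumes "a norm_summable_on UNIV"
  shows "fcoef (fseries a) k = a k"
proof -
  define b where "b l = a (l + k)" for l
  have bij: "bij_betw (\<lambda>l. l + k) UNIV UNIV"
    by (rule bij_betw_byWitness[where f' = "\<lambda>l. l - k"]) auto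
  have b: "b norm_summable_on UNIV"
    using summable_on_reindex_bij_betw[OF bij, of "\<lambda>l. norm (a l)"] assms by (simp add: b_def)
  have "fseries a p * fchar (- k) p = fseries b p" for p
  proof -
    have "fseries a p = (\<Sum>\<^sub>\<infinity>l. b l * fchar (l + k) p)"
      unfolding fseries_def b_def using infsum_reindex_bij_betw[OF bij, of "\<lambda>l. a l * fchar l p"] by simp
    also have "\<dots> = fseries b p * fchar k p"
      unfolding fseries_def fchar_add mult.assoc[symmetric] by (rule infsum_cmult_left')
    finally show ?thesis using fchar_minus[of k p] by simp
  qed
  moreover have "integral torus (fseries b) = 4 * pi\<^sup>2 * b 0"
  proof -
    have cont: "continuous_on (cbox (- pi, - pi) (pi, pi)) (\<lambda>p. \<Sum>k\<in>X. b k * fchar k p)" for X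
      by (intro continuous_intros continuous_on_fchar)
    obtain I J where IJ: "\<And>X. ((\<lambda>p. \<Sum>k\<in>X. b k * fchar k p) has_integral I X) torus"
      "(fseries b has_integral J) torus" "(I \<longlongrightarrow> J) (finite_subsets_at_top UNIV)"
      using uniform_limit_integral_cbox[OF continuous_on_fseries_torus(1)[OF b] cont finite_subsets_at_top_neq_bot]
      unfolding torus_def by blast
    have "I X = 4 * pi\<^sup>2 * b 0" if X: "finite X" "0 \<in> X" for X
    proof -
      have "((\<lambda>p. \<Sum>k\<in>X. b k * fchar k p) has_integral (\<Sum>k\<in>X. b k * (if k = 0 then 4 * pi\<^sup>2 else 0))) torus"
        by (intro has_integral_sum X has_integral_mult_right)
          (metis integrable_torus integral_fchar integrable_integral continuous_on_fchar)
      from has_integral_unique[OF IJ(1) this] show ?thesis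
        using X by (simp add: if_distrib sum.delta cong: if_cong)
    qed
    then have "\<forall>\<^sub>F X in finite_subsets_at_top UNIV. I X = 4 * pi\<^sup>2 * b 0"
      unfolding eventually_finite_subsets_at_top by (intro exI[of _ "{0}"]) auto
    then have "J = 4 * pi\<^sup>2 * b 0"
      using IJ(3) tendsto_eventually tendsto_unique[OF finite_subsets_at_top_neq_bot] by blast
    then show ?thesis using IJ(2) by (simp add: integral_unique)
  qed
  ultimately show ?thesis by (simp add: fcoef_def b_def)
qed

lemma cis_eq_cases:
  assumes "cis s = cis t" "s \<in> {-pi..pi}" "t \<in> {-pi..pi}"
  shows "s = t \<or> s = pi \<and> t = - pi \<or> s = - pi \<and> t = pi"
proof -
  have "sin s = sin t \<and> cos s = cos t" using assms(1) by (auto simp: complex_eq_iff)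
  then obtain n :: int where n: "s = t + 2 * pi * n" using sin_cos_eq_iff by blast
  define m where "m = 2 * pi * real_of_int n"
  have "s = t + m" using n by (simp add: m_def)
  then have "\<bar>m\<bar> \<le> 2 * pi" using assms(2,3) by (auto simp: abs_le_iff)
  then have "\<bar>real_of_int n\<bar> \<le> 1" by (simp add: abs_mult m_def)
  then have "n = 0 \<or> n = 1 \<or> n = -1" by linarith
  then show ?thesis using n assms(2,3) by auto
qed

text \<open>The image of the box in \<open>\<complex>\<^sup>2\<close> is a product of two circles, on which trigonometric polynomials are
  the restrictions of real polynomials, so Stone--Weierstrass applies there.\<close>

lemma fourier_unique:
  assumes c: "continuous_on torus H" and per: "torus_periodic H"
    and zero: "\<And>k. integral torus (\<lambda>p. H p * fchar k p) = 0" and p: "p \<in> torus"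
  shows "H p = 0"
proof -
  define q :: "real \<times> real \<Rightarrow> complex \<times> complex" where "q p = (cis (fst p), cis (snd p))" for p
  have qc: "continuous_on S q" for S
    unfolding q_def by (intro continuous_intros)
  define T where "T = q ` torus"
  have compQ: "compact torus" by (simp add: torus_def)
  have compT: "compact T" unfolding T_def by (rule compact_continuous_image[OF qc compQ])
  define h where "h z = H (SOME p. p \<in> torus \<and> q p = z)" for z
  have Hq: "H p = H p'" if "p \<in> torus" "p' \<in> torus" "q p = q p'" for p p'
  proof -
    obtain a b a' b' where pp: "p = (a, b)" "p' = (a', b')" by (cases p, cases p') auto
    have I: "a \<in> {-pi..pi}" "b \<in> {-pi..pi}" "a' \<in> {-pi..pi}" "b' \<in> {-pi..pi}" "- pi \<in> {-pi..pi}" "pi \<in> {-pi..pi}"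
      using that pp pi_ge_zero by (auto simp: torus_iff simp del: pi_ge_zero)
    have "cis a = cis a'" "cis b = cis b'" using that(3) pp by (auto simp: q_def)
    then have ab: "a = a' \<or> a = pi \<and> a' = - pi \<or> a = - pi \<and> a' = pi"
      "b = b' \<or> b = pi \<and> b' = - pi \<or> b = - pi \<and> b' = pi"
      using cis_eq_cases I by blast+
    have "H (a, b) = H (a', b)"
      using ab(1) per I(2) unfolding torus_periodic_def by metis
    also have "\<dots> = H (a', b')"
      using ab(2) per I(3) unfolding torus_periodic_def by metis
    finally show ?thesis using pp by simp
  qed
  have hq: "h (q p) = H p" if "p \<in> torus" for p
    unfolding h_def using Hq someI[of "\<lambda>p'. p' \<in> torus \<and> q p' = q p" p] that by metis
  \<comment> \<open>\<open>q\<close> maps closed, hence compact, subsets of the box to closed sets,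
    so continuity of \<open>H\<close> descends to \<open>h\<close>.\<close>
  have hc: "continuous_on T h"
    unfolding continuous_on_closed_vimage[OF compact_imp_closed[OF compT]]
  proof (intro allI impI)
    fix B :: "complex set" assume "closed B"
    then have "closed (H -` B \<inter> torus)"
      using c continuous_on_closed_vimage[OF compact_imp_closed[OF compQ]] by blast
    moreover have "torus \<inter> (H -` B \<inter> torus) = H -` B \<inter> torus" by blast
    ultimately have "compact (H -` B \<inter> torus)"
      using compact_Int_closed[OF compQ, of "H -` B \<inter> torus"] by simp
    then have "closed (q ` (H -` B \<inter> torus))"
      by (rule compact_imp_closed[OF compact_continuous_image[OF qc]])
    moreover have "h -` B \<inter> T = q ` (H -` B \<inter> torus)" using hq by (auto simp: T_def)
    ultimately show "closed (h -` B \<inter> T)" by simp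
  qed
  \<comment> \<open>Stable under multiplication by characters. Cosine and sine of the coordinates
    are combinations of characters, so the class is stable under every real polynomial in
    \<open>q p\<close>.\<close>
  define Ann where "Ann G \<longleftrightarrow> continuous_on torus G \<and> (\<forall>k. integral torus (\<lambda>p. G p * fchar k p) = 0)" for G
  have Ann_cmult: "Ann (\<lambda>p. c * G p)" if "Ann G" for G c
    using that unfolding Ann_def by (auto intro!: continuous_intros simp: mult.assoc)
  have Ann_add: "Ann (\<lambda>p. G p + G' p)" if "Ann G" "Ann G'" for G G'
    unfolding Ann_def
  proof (intro conjI allI)
    show "continuous_on torus (\<lambda>p. G p + G' p)" using that by (auto simp: Ann_def intro!: continuous_intros)
    fix k
    have "(\<lambda>p. G p * fchar k p) integrable_on torus" "(\<lambda>p. G' p * fchar k p) integrable_on torus"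
      using that by (auto simp: Ann_def intro!: integrable_torus continuous_intros continuous_on_fchar)
    from integral_add[OF this] show "integral torus (\<lambda>p. (G p + G' p) * fchar k p) = 0"
      using that unfolding distrib_right Ann_def by (simp only: add_0_left)
  qed
  have Ann_fchar: "Ann (\<lambda>p. G p * fchar l p)" if "Ann G" for G l
    using that unfolding Ann_def mult.assoc fchar_add[symmetric]
    by (intro conjI allI continuous_intros continuous_on_fchar) (simp_all only:)
  have poly: "Ann (\<lambda>p. G p * of_real (r (q p)))" if "real_polynomial_function r" "Ann G" for r G
    using that
  proof (induction r arbitrary: G rule: real_polynomial_function.induct)
    case (linear f)
    have lf: "linear f" using linear bounded_linear.linear by blast
    define a b c d where "a = complex_of_real (f (1, 0))" and "b = complex_of_real (f (\<i>, 0))"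
      and "c = complex_of_real (f (0, 1))" and "d = complex_of_real (f (0, \<i>))"
    have qf: "f (q p) = cos (fst p) * f (1, 0) + sin (fst p) * f (\<i>, 0) + cos (snd p) * f (0, 1) + sin (snd p) * f (0, \<i>)" for p
    proof -
      have "q p = cos (fst p) *\<^sub>R (1, 0) + sin (fst p) *\<^sub>R (\<i>, 0) + cos (snd p) *\<^sub>R (0, 1) + sin (snd p) *\<^sub>R (0, \<i>)"
        by (simp add: q_def complex_eq_iff)
      then show ?thesis by (simp only: linear_add[OF lf] linear_scale[OF lf] real_scaleR_def)
    qed
    have cs: "complex_of_real (cos t) = (cis t + cis (- t)) / 2" "complex_of_real (sin t) = - \<i> * (cis t - cis (- t)) / 2" for t
      by (simp_all add: complex_eq_iff)
    have "complex_of_real (f (q p)) = (a - \<i> * b) / 2 * fchar (1, 0) p + (a + \<i> * b) / 2 * fchar (-1, 0) p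
        + (c - \<i> * d) / 2 * fchar (0, 1) p + (c + \<i> * d) / 2 * fchar (0, -1) p" for p
    proof -
      have "complex_of_real (f (q p)) = complex_of_real (cos (fst p)) * a + complex_of_real (sin (fst p)) * b
          + complex_of_real (cos (snd p)) * c + complex_of_real (sin (snd p)) * d"
        by (simp add: qf a_def b_def c_def d_def)
      moreover have "fchar (1, 0) p = cis (fst p)" "fchar (-1, 0) p = cis (- fst p)"
        "fchar (0, 1) p = cis (snd p)" "fchar (0, -1) p = cis (- snd p)"
        by (simp_all add: fchar_def)
      ultimately show ?thesis unfolding cs by (simp add: field_simps)
    qed
    then have "(\<lambda>p. G p * of_real (f (q p))) = (\<lambda>p. (a - \<i> * b) / 2 * (G p * fchar (1, 0) p) + (a + \<i> * b) / 2 * (G p * fchar (-1, 0) p)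
        + (c - \<i> * d) / 2 * (G p * fchar (0, 1) p) + (c + \<i> * d) / 2 * (G p * fchar (0, -1) p))"
      by (simp add: fun_eq_iff algebra_simps)
    then show ?case using linear.prems by (simp only: Ann_add Ann_cmult Ann_fchar)
  next
    case (const c)
    then show ?case using Ann_cmult[of G "of_real c"] by (simp add: mult.commute)
  next
    case (add f g)
    then show ?case using Ann_add by (simp add: distrib_left)
  next
    case (mult f g)
    then show ?case using mult.IH(2)[OF mult.IH(1)] by (simp add: mult.assoc)
  qed
  have AnnH: "Ann H" using c zero by (simp add: Ann_def)
  have poly2: "integral torus (\<lambda>p. H p * g (q p)) = 0" and gc: "continuous_on torus (\<lambda>p. g (q p))"
    if g: "polynomial_function g" for g :: "complex \<times> complex \<Rightarrow> complex"
  proof -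
    have r: "real_polynomial_function (\<lambda>z. Re (g z))" "real_polynomial_function (\<lambda>z. Im (g z))"
      using g bounded_linear_Re bounded_linear_Im unfolding polynomial_function_def o_def by blast+
    have "Ann (\<lambda>p. H p * of_real (Re (g (q p))) + \<i> * (H p * of_real (Im (g (q p)))))"
      by (intro Ann_add Ann_cmult poly r AnnH)
    moreover have "(\<lambda>p. H p * of_real (Re (g (q p))) + \<i> * (H p * of_real (Im (g (q p))))) = (\<lambda>p. H p * g (q p))"
    proof
      fix p show "H p * of_real (Re (g (q p))) + \<i> * (H p * of_real (Im (g (q p)))) = H p * g (q p)"
        by (subst complex_eq[of "g (q p)"]) (simp add: algebra_simps)
    qed
    ultimately have "Ann (\<lambda>p. H p * g (q p))" by (simp only:)
    then have "integral torus (\<lambda>p. H p * g (q p) * fchar 0 p) = 0" unfolding Ann_def by blast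
    then show "integral torus (\<lambda>p. H p * g (q p)) = 0" by (simp add: fchar_def)
    show "continuous_on torus (\<lambda>p. g (q p))"
      using continuous_on_compose2[OF continuous_on_polymonial_function[OF g] qc] by blast
  qed
  obtain M where M: "M > 0" "\<And>p. p \<in> torus \<Longrightarrow> norm (H p) \<le> M"
    using compact_imp_bounded[OF compact_continuous_image[OF c compQ]] unfolding bounded_pos by auto
  have cHH: "continuous_on torus (\<lambda>p. H p * cnj (H p))" by (intro continuous_intros c)
  \<comment> \<open>The conjugate of \<open>H\<close> is replaced by a polynomial within
    \<open>e\<close>, against which \<open>H\<close> integrates to zero. Letting \<open>e\<close>
    shrink kills the integral of |H|^2.\<close>
  have small: "norm (integral torus (\<lambda>p. H p * cnj (H p))) \<le> M * e * (4 * pi\<^sup>2)" if e: "e > 0" for e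
  proof -
    have "continuous_on T (\<lambda>z. cnj (h z))" by (intro continuous_intros hc)
    from Stone_Weierstrass_polynomial_function[OF compT this e]
    obtain g where g: "polynomial_function g" "\<And>z. z \<in> T \<Longrightarrow> norm (cnj (h z) - g z) < e" by blast
    have "integral torus (\<lambda>p. H p * cnj (H p)) = integral torus (\<lambda>p. H p * cnj (H p)) - integral torus (\<lambda>p. H p * g (q p))"
      using poly2[OF g(1)] by simp
    also have "\<dots> = integral torus (\<lambda>p. H p * cnj (H p) - H p * g (q p))"
      by (rule integral_diff[symmetric]) (intro integrable_torus continuous_intros c gc g(1))+
    finally have eq: "integral torus (\<lambda>p. H p * cnj (H p)) = integral torus (\<lambda>p. H p * cnj (H p) - H p * g (q p))" .
    have "norm (integral torus (\<lambda>p. H p * cnj (H p) - H p * g (q p))) \<le> M * e * measure lborel torus"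
      unfolding torus_def
    proof (rule has_integral_bound)
      show "0 \<le> M * e" using M e by simp
      show "((\<lambda>p. H p * cnj (H p) - H p * g (q p)) has_integral
          integral (cbox (- pi, - pi) (pi, pi)) (\<lambda>p. H p * cnj (H p) - H p * g (q p))) (cbox (- pi, - pi) (pi, pi))"
        unfolding torus_def[symmetric]
        by (rule integrable_integral, rule integrable_torus) (intro continuous_intros c gc g(1))
      fix x assume "x \<in> cbox (- pi, - pi) (pi, pi)"
      then have x: "x \<in> torus" by (simp add: torus_def)
      have "norm (H x * cnj (H x) - H x * g (q x)) = norm (H x) * norm (cnj (h (q x)) - g (q x))"
        by (simp add: hq[OF x] right_diff_distrib[symmetric] norm_mult)
      also have "\<dots> \<le> M * e"
        using M(2)[OF x] g(2)[of "q x"] x M(1) by (intro mult_mono) (auto simp: T_def less_imp_le)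
      finally show "norm (H x * cnj (H x) - H x * g (q x)) \<le> M * e" .
    qed
    then show ?thesis unfolding eq content_torus .
  qed
  have "integral torus (\<lambda>p. H p * cnj (H p)) = 0"
  proof (rule ccontr)
    define N where "N = norm (integral torus (\<lambda>p. H p * cnj (H p)))"
    assume "integral torus (\<lambda>p. H p * cnj (H p)) \<noteq> 0"
    then have N: "N > 0" by (simp add: N_def)
    have den: "M * (4 * pi\<^sup>2) > 0" using M(1) by simp
    have "N / (2 * (M * (4 * pi\<^sup>2))) > 0" using N den by simp
    from small[OF this] have "N \<le> N / 2" using M(1) by (simp add: N_def[symmetric] field_simps)
    then show False using N by simp
  qed
  moreover have "((\<lambda>p. H p * cnj (H p)) has_integral integral torus (\<lambda>p. H p * cnj (H p))) torus"
    by (rule integrable_integral[OF integrable_torus[OF cHH]])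
  ultimately have "((\<lambda>p. Re (H p * cnj (H p))) has_integral Re 0) torus"
    using has_integral_linear[OF _ bounded_linear_Re] unfolding o_def by metis
  then have hi: "((\<lambda>p. (norm (H p))\<^sup>2) has_integral 0) (cbox (- pi, - pi) (pi, pi))"
    by (simp add: torus_def flip: complex_norm_square of_real_power)
  have "(norm (H p))\<^sup>2 = 0"
  proof (rule has_integral_0_cbox_imp_0[OF _ _ hi])
    show "continuous_on (cbox (- pi, - pi) (pi, pi)) (\<lambda>p. (norm (H p))\<^sup>2)"
      using c unfolding torus_def by (intro continuous_intros)
    show "box (- pi, - pi) (pi, pi) \<noteq> ({} :: (real \<times> real) set)"
      by (simp add: box_ne_empty Basis_prod_def)
  qed (use p in \<open>auto simp: torus_def\<close>)
  then show ?thesis by simp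
qed

text \<open>The difference of the two sides is continuous and periodic with vanishing coefficients,
  so uniqueness applies.\<close>

lemma fourier_inversion:
  assumes F: "continuous_on torus F" "torus_periodic F" and s: "fcoef F norm_summable_on UNIV"
    and p: "p \<in> torus"
  shows "F p = fseries (fcoef F) p"
proof -
  have cs: "continuous_on torus (fseries (fcoef F))"
    by (rule continuous_on_fseries_torus(2)[OF s])
  have "F p - fseries (fcoef F) p = 0"
  proof (rule fourier_unique[OF _ _ _ p])
    show "continuous_on torus (\<lambda>p. F p - fseries (fcoef F) p)" by (intro continuous_intros F cs)
    show "torus_periodic (\<lambda>p. F p - fseries (fcoef F) p)"
      using F(2) torus_periodic_fchar unfolding torus_periodic_def fseries_def by simp
    fix k
    have "integral torus (\<lambda>p. F p * fchar k p) = integral torus (\<lambda>p. fseries (fcoef F) p * fchar k p)"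
      using fcoef_fseries[OF s, of "- k"]
      by (simp add: fcoef_def[of F "- k"] fcoef_def[of "fseries (fcoef F)" "- k"])
    then show "integral torus (\<lambda>p. (F p - fseries (fcoef F) p) * fchar k p) = 0"
      unfolding left_diff_distrib
      by (subst integral_diff) (auto intro!: integrable_torus continuous_intros F cs continuous_on_fchar)
  qed
  then show ?thesis by simp
qed

subsection \<open>Decay of Fourier coefficients\<close>

lemma norm_fcoef_le:
  assumes "continuous_on torus F" "\<And>p. p \<in> torus \<Longrightarrow> norm (F p) \<le> C" "0 \<le> C"
  shows "norm (fcoef F k) \<le> C"
proof -
  have "norm (integral torus (\<lambda>p. F p * fchar (- k) p)) \<le> C * measure lborel torus"
    unfolding torus_def
  proof (rule has_integral_bound[OF assms(3)])
    show "((\<lambda>p. F p * fchar (- k) p) has_integral integral (cbox (- pi, - pi) (pi, pi)) (\<lambda>p. F p * fchar (- k) p))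
        (cbox (- pi, - pi) (pi, pi))"
      unfolding torus_def[symmetric]
      by (rule integrable_integral, rule integrable_torus) (intro continuous_intros assms(1) continuous_on_fchar)
  qed (use assms(2) in \<open>auto simp: norm_mult norm_fchar torus_def\<close>)
  then have "norm (integral torus (\<lambda>p. F p * fchar (- k) p)) / (4 * pi\<^sup>2) \<le> C"
    by (simp add: content_torus divide_le_eq)
  moreover have "norm (4 * (complex_of_real pi)\<^sup>2) = 4 * pi\<^sup>2"
    by (simp add: norm_mult norm_power)
  ultimately show ?thesis by (simp add: fcoef_def norm_divide)
qed

text \<open>Since 1 < pi, such functions vanish near the boundary of the box, so they and their
  derivatives are periodic. Only points of \<open>S\<close> count, as \<open>F\<close> is meaningful
  only there.\<close>

definition supported :: "(real \<times> real) set \<Rightarrow> (real \<times> real \<Rightarrow> complex) \<Rightarrow> bool" where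
  "supported S F \<longleftrightarrow> (\<forall>p\<in>S. 1 < \<bar>fst p\<bar> \<or> 1 < \<bar>snd p\<bar> \<longrightarrow> F p = 0)"

lemma supported_torus_periodic: "supported S F \<Longrightarrow> torus \<subseteq> S \<Longrightarrow> torus_periodic F"
proof -
  assume F: "supported S F" "torus \<subseteq> S"
  have "F p = 0" if "p \<in> torus" "1 < \<bar>fst p\<bar> \<or> 1 < \<bar>snd p\<bar>" for p
    using F that unfolding supported_def by blast
  moreover have "1 < \<bar>pi\<bar>" using pi_gt3 by simp
  ultimately show "torus_periodic F"
    by (simp add: torus_periodic_def torus_iff)
qed

lemma supported_dirder:
  assumes "open S" "supported S F"
  shows "supported S (dirder v F)"
  unfolding supported_def
proof (intro ballI impI)
  fix p assume p: "p \<in> S" "1 < \<bar>fst p\<bar> \<or> 1 < \<bar>snd p\<bar>"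
  let ?T = "S \<inter> ({p. 1 < \<bar>fst p\<bar>} \<union> {p. 1 < \<bar>snd p\<bar>})"
  have "open {p :: real \<times> real. 1 < \<bar>fst p\<bar>}" "open {p :: real \<times> real. 1 < \<bar>snd p\<bar>}"
    by (intro open_Collect_less continuous_intros)+
  then have "open ?T" using assms(1) by blast
  then have "dirder v F p = dirder v (\<lambda>p. 0) p"
    by (rule dirder_cong) (use p assms(2) in \<open>auto simp: supported_def\<close>)
  then show "dirder v F p = 0" by (simp add: dirder_const)
qed

text \<open>Integration by parts against the character.\<close>

lemma fcoef_dirder:
  assumes S: "open S" "torus \<subseteq> S" and F: "smooth_on S F" "torus_periodic F"
    and e: "e = (1, 0) \<or> e = (0, 1)"
  shows "fcoef (dirder e F) k = fchar_symbol k e * fcoef F k"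
proof -
  have cF: "continuous_on torus F" "continuous_on torus (dirder e F)"
    using F(1) S(2) smooth_on_dirder smooth_on_imp_continuous_on continuous_on_subset by metis+
  have "integral torus (\<lambda>p. F p * (fchar_symbol (- k) e * fchar (- k) p) + dirder e F p * fchar (- k) p) = 0"
  proof (rule integral_torus_derivative[OF _ _ e])
    show "((\<lambda>p. F p * fchar (- k) p) has_derivative
        (\<lambda>v. F p * (fchar_symbol (- k) v * fchar (- k) p) + dirder v F p * fchar (- k) p)) (at p)" if "p \<in> torus" for p
      by (rule has_derivative_mult[OF smooth_on_has_dirder[OF F(1)] fchar_has_derivative]) (use that S in auto)
    show "torus_periodic (\<lambda>p. F p * fchar (- k) p)"
      using F(2) torus_periodic_fchar by (simp add: torus_periodic_def)
  qed (intro continuous_intros continuous_on_fchar cF)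
  moreover have "integral torus (\<lambda>p. F p * (fchar_symbol (- k) e * fchar (- k) p) + dirder e F p * fchar (- k) p) =
      integral torus (\<lambda>p. F p * (fchar_symbol (- k) e * fchar (- k) p)) + integral torus (\<lambda>p. dirder e F p * fchar (- k) p)"
    by (rule integral_add) (intro integrable_torus continuous_intros continuous_on_fchar cF)+
  moreover have "integral torus (\<lambda>p. F p * (fchar_symbol (- k) e * fchar (- k) p)) = - fchar_symbol k e * integral torus (\<lambda>p. F p * fchar (- k) p)"
  proof -
    have "(\<lambda>p. F p * (fchar_symbol (- k) e * fchar (- k) p)) = (\<lambda>p. - fchar_symbol k e * (F p * fchar (- k) p))"
      by (simp add: fun_eq_iff fchar_symbol_def algebra_simps)
    then show ?thesis by (simp only: integral_mult_right)
  qed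
  ultimately have "integral torus (\<lambda>p. dirder e F p * fchar (- k) p) = fchar_symbol k e * integral torus (\<lambda>p. F p * fchar (- k) p)"
    by algebra
  then show ?thesis by (simp add: fcoef_def)
qed

text \<open>The operator 1 - d_v^2. Its symbol 1 + (k . v)^2 is at least 1 for every frequency, zero
  included; the product over both axes has a reciprocal summable over the lattice.\<close>

definition bessel_op :: "'a::real_normed_vector \<Rightarrow> ('a \<Rightarrow> complex) \<Rightarrow> 'a \<Rightarrow> complex" where
  "bessel_op v F p = F p - dirder v (dirder v F) p"

lemma smooth_on_bessel_op: "open S \<Longrightarrow> smooth_on S F \<Longrightarrow> smooth_on S (bessel_op v F)"
  using smooth_on_diff[OF _ _ smooth_on_dirder[OF smooth_on_dirder], of S F F v v]
  by (simp add: bessel_op_def[abs_def])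

lemma supported_bessel_op: "open S \<Longrightarrow> supported S F \<Longrightarrow> supported S (bessel_op v F)"
  using supported_dirder[of S "dirder v F" v] supported_dirder[of S F v]
  by (auto simp: bessel_op_def supported_def)

lemma fcoef_bessel_op:
  assumes S: "open S" "torus \<subseteq> S" and F: "smooth_on S F" "supported S F"
    and e: "e = (1, 0) \<or> e = (0, 1)"
  shows "fcoef (bessel_op e F) k = (1 - (fchar_symbol k e)\<^sup>2) * fcoef F k"
proof -
  have d: "smooth_on S (dirder e F)" "supported S (dirder e F)"
    using F S smooth_on_dirder supported_dirder by blast+
  have c: "continuous_on torus F" "continuous_on torus (dirder e (dirder e F))"
    using F(1) S(2) smooth_on_dirder smooth_on_imp_continuous_on continuous_on_subset by metis+
  have "fcoef (bessel_op e F) k = fcoef F k - fcoef (dirder e (dirder e F)) k"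
    unfolding fcoef_def bessel_op_def left_diff_distrib
    by (subst integral_diff) (intro integrable_torus continuous_intros continuous_on_fchar c, intro integrable_torus continuous_intros continuous_on_fchar c, simp add: diff_divide_distrib)
  also have "fcoef (dirder e (dirder e F)) k = fchar_symbol k e * (fchar_symbol k e * fcoef F k)"
    using fcoef_dirder[OF S d(1) supported_torus_periodic[OF d(2) S(2)] e]
      fcoef_dirder[OF S F(1) supported_torus_periodic[OF F(2) S(2)] e] by simp
  finally show ?thesis by (simp add: power2_eq_square algebra_simps)
qed

definition bessel_weight :: "int \<times> int \<Rightarrow> real" where
  "bessel_weight k = (1 + (of_int (fst k))\<^sup>2) * (1 + (of_int (snd k))\<^sup>2)"

lemma bessel_weight_ge_1: "1 \<le> bessel_weight k"
proof -
  have "1 * 1 \<le> bessel_weight k" unfolding bessel_weight_def by (intro mult_mono) auto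
  then show ?thesis by simp
qed

lemma fcoef_bessel_op_bessel_op:
  assumes S: "open S" "torus \<subseteq> S" and F: "smooth_on S F" "supported S F"
  shows "fcoef (bessel_op (1, 0) (bessel_op (0, 1) F)) k = of_real (bessel_weight k) * fcoef F k"
proof -
  have "(fchar_symbol k (1, 0))\<^sup>2 = - of_real ((of_int (fst k))\<^sup>2)" "(fchar_symbol k (0, 1))\<^sup>2 = - of_real ((of_int (snd k))\<^sup>2)"
    by (simp_all add: fchar_symbol_def power_mult_distrib)
  then show ?thesis
    using fcoef_bessel_op[OF S smooth_on_bessel_op[OF S(1) F(1)] supported_bessel_op[OF S(1) F(2)], of "(1, 0)" "(0, 1)" k]
      fcoef_bessel_op[OF S F, of "(0, 1)" k]
    by (simp add: bessel_weight_def)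
qed

lemma summable_bessel_weight: "(\<lambda>k. 1 / bessel_weight k) summable_on UNIV"
proof -
  have n: "(\<lambda>n::nat. 1 / (1 + (real n)\<^sup>2)) summable_on UNIV"
  proof (rule norm_summable_imp_summable_on)
    have "summable (\<lambda>n. inverse (real n ^ 2))" by (rule inverse_power_summable) simp
    moreover have "norm (norm (1 / (1 + (real n)\<^sup>2))) \<le> inverse (real n ^ 2)" if "n \<ge> 1" for n
    proof -
      have "norm (norm (1 / (1 + (real n)\<^sup>2))) = 1 / (1 + (real n)\<^sup>2)" by simp
      also have "\<dots> \<le> 1 / (real n)\<^sup>2" using that by (intro frac_le) auto
      finally show ?thesis by (simp add: inverse_eq_divide)
    qed
    ultimately show "summable (\<lambda>n::nat. norm (1 / (1 + (real n)\<^sup>2)))"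
      by (rule summable_comparison_test'[where N = 1])
  qed
  define g where "g k = 1 / (1 + (real_of_int k)\<^sup>2)" for k
  have "g summable_on range int" "g summable_on range (\<lambda>n. - int n)"
    using n by (subst summable_on_reindex; simp add: inj_on_def g_def o_def)+
  then have "g summable_on (range int \<union> range (\<lambda>n. - int n))"
    by (rule summable_on_union)
  moreover have "range int \<union> range (\<lambda>n. - int n) = UNIV"
  proof (rule set_eqI)
    fix k :: int show "k \<in> range int \<union> range (\<lambda>n. - int n) \<longleftrightarrow> k \<in> UNIV"
      by (cases k rule: int_cases2) auto
  qed
  ultimately have "g summable_on UNIV" by simp
  moreover have "(\<lambda>k. norm (g k)) = g" by (simp add: g_def fun_eq_iff)
  ultimately have "g norm_summable_on UNIV" by simp
  from abs_summable_summable[OF abs_summable_tensor(1)[OF this this]]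
  show ?thesis by (simp add: g_def bessel_weight_def case_prod_beta)
qed

text \<open>Converts a sup bound on four derivatives into a bound in the Wiener algebra. This is
  where the smallness for the Neumann series comes from.\<close>

lemma fcoef_summable:
  assumes S: "open S" "torus \<subseteq> S" and F: "smooth_on S F" "supported S F"
    and C: "\<And>p. p \<in> torus \<Longrightarrow> norm (bessel_op (1, 0) (bessel_op (0, 1) F) p) \<le> C" "0 \<le> C"
  shows "norm (fcoef F k) \<le> C * (1 / bessel_weight k)"
    and "(\<Sum>\<^sub>\<infinity>k. norm (fcoef F k)) \<le> C * (\<Sum>\<^sub>\<infinity>k. 1 / bessel_weight k)"
proof -
  have c: "continuous_on torus (bessel_op (1, 0) (bessel_op (0, 1) F))"
    using smooth_on_imp_continuous_on[OF smooth_on_bessel_op[OF S(1) smooth_on_bessel_op[OF S(1) F(1)]]] S(2) continuous_on_subset by blast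
  show le: "norm (fcoef F k) \<le> C * (1 / bessel_weight k)" for k
    using norm_fcoef_le[OF c C, of k] bessel_weight_ge_1[of k] fcoef_bessel_op_bessel_op[OF S F, of k]
    by (simp add: norm_mult field_simps)
  have su: "(\<lambda>k. C * (1 / bessel_weight k)) summable_on UNIV" by (rule summable_on_cmult_right[OF summable_bessel_weight])
  have "(\<Sum>\<^sub>\<infinity>k. norm (fcoef F k)) \<le> (\<Sum>\<^sub>\<infinity>k. C * (1 / bessel_weight k))"
    by (rule infsum_mono[OF summable_on_comparison_test[OF su le] su le]) auto
  then show "(\<Sum>\<^sub>\<infinity>k. norm (fcoef F k)) \<le> C * (\<Sum>\<^sub>\<infinity>k. 1 / bessel_weight k)"
    by (simp only: infsum_cmult_right')
qed

text \<open>Applying both operators keeps smoothness and support and gains one factor of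
  \<open>bessel_weight\<close>, so decay of any order follows by iteration.\<close>

lemma rapid_fcoef:
  assumes S: "open S" "torus \<subseteq> S" and F: "smooth_on S F" "supported S F"
  shows "rapid (fcoef F)"
proof -
  have "\<exists>C\<ge>0. \<forall>k. norm (fcoef F k) \<le> C * (1 / bessel_weight k) ^ s" for s
    using F
  proof (induction s arbitrary: F)
    case 0
    have c: "continuous_on torus F"
      using smooth_on_imp_continuous_on[OF 0(1)] S(2) continuous_on_subset by blast
    have "compact torus" by (simp add: torus_def)
    then obtain C where C: "C > 0" "\<And>p. p \<in> torus \<Longrightarrow> norm (F p) \<le> C"
      using compact_imp_bounded[OF compact_continuous_image[OF c]] unfolding bounded_pos by auto
    then show ?case using norm_fcoef_le[OF c C(2)] by (intro exI[of _ C]) simp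
  next
    case (Suc s)
    let ?F = "bessel_op (1, 0) (bessel_op (0, 1) F)"
    have "smooth_on S ?F" "supported S ?F"
      using Suc.prems S by (blast intro: smooth_on_bessel_op supported_bessel_op)+
    from Suc.IH[OF this] obtain C where C: "C \<ge> 0" "\<And>k. norm (fcoef ?F k) \<le> C * (1 / bessel_weight k) ^ s"
      by blast
    have "norm (fcoef F k) \<le> C * (1 / bessel_weight k) ^ Suc s" for k
    proof -
      have "bessel_weight k * norm (fcoef F k) \<le> C * (1 / bessel_weight k) ^ s"
        using C(2)[of k] bessel_weight_ge_1[of k] fcoef_bessel_op_bessel_op[OF S Suc.prems, of k] by (simp add: norm_mult)
      then have "norm (fcoef F k) \<le> C * (1 / bessel_weight k) ^ s / bessel_weight k"
        using bessel_weight_ge_1[of k] by (simp add: field_simps)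
      then show ?thesis by simp
    qed
    then show ?case using C(1) by blast
  qed
  note decay = this
  show ?thesis
    unfolding rapid_def wsummable_def
  proof
    fix s
    \<comment> \<open>One power more than \<open>s\<close>: the first \<open>s\<close> absorb the
      polynomial weight through \<open>1 + mag k \<le> 4 * bessel_weight k\<close>, the last one
      makes the series converge.\<close>
    obtain C where C: "C \<ge> 0" "\<And>k. norm (fcoef F k) \<le> C * (1 / bessel_weight k) ^ Suc s"
      using decay by blast
    have le: "(1 + mag k) ^ s * norm (fcoef F k) \<le> 4 ^ s * C * (1 / bessel_weight k)" for k
    proof -
      have sq: "1 + \<bar>x\<bar> \<le> 2 * (1 + x\<^sup>2)" for x :: real
      proof -
        have e: "2 * (1 + x\<^sup>2) - (1 + \<bar>x\<bar>) = 2 * (\<bar>x\<bar> - 1 / 4)\<^sup>2 + 7 / 8"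
          by (simp add: power2_eq_square algebra_simps)
        have "0 \<le> 2 * (\<bar>x\<bar> - 1 / 4)\<^sup>2 + 7 / 8" by simp
        then show ?thesis unfolding e[symmetric] by (simp only: diff_ge_0_iff_ge)
      qed
      let ?x = "real_of_int (fst k)" and ?y = "real_of_int (snd k)"
      have "1 + mag k \<le> (1 + \<bar>?x\<bar>) * (1 + \<bar>?y\<bar>)"
        by (simp add: mag_def algebra_simps)
      also have "\<dots> \<le> (2 * (1 + ?x\<^sup>2)) * (2 * (1 + ?y\<^sup>2))"
        by (intro mult_mono sq) auto
      also have "\<dots> = 4 * bessel_weight k" by (simp add: bessel_weight_def algebra_simps)
      finally have "1 + mag k \<le> 4 * bessel_weight k" .
      then have "(1 + mag k) ^ s \<le> (4 * bessel_weight k) ^ s"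
        using mag_nonneg[of k] by (intro power_mono) auto
      then have "(1 + mag k) ^ s * norm (fcoef F k) \<le> (4 * bessel_weight k) ^ s * (C * (1 / bessel_weight k) ^ Suc s)"
        using C bessel_weight_ge_1[of k] by (intro mult_mono) auto
      also have "\<dots> = 4 ^ s * C * (1 / bessel_weight k)"
        using bessel_weight_ge_1[of k] by (simp add: power_mult_distrib power_divide field_simps)
      finally show ?thesis .
    qed
    show "(\<lambda>k. (1 + mag k) ^ s * norm (fcoef F k)) summable_on UNIV"
      by (rule summable_on_comparison_test[OF summable_on_cmult_right[OF summable_bessel_weight] le])
        (simp add: mag_nonneg)
  qed
qed

subsection \<open>A smooth bump function\<close>

text \<open>The family t^(-n) exp(- 1 / t), extended by zero, is closed under differentiation up to
  linear combinations, so smoothness follows by induction over all \<open>n\<close> at once.\<close>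

definition flat :: "nat \<Rightarrow> real \<Rightarrow> real" where
  "flat n t = (if t > 0 then inverse t ^ n * exp (- inverse t) else 0)"

lemma flat_tendsto_0: "(flat n \<longlongrightarrow> 0) (at 0)"
proof (rule filterlim_split_at)
  have "\<forall>\<^sub>F t in at_left 0. flat n t = 0"
    unfolding eventually_at_left_field by (intro exI[of _ "-1"]) (auto simp: flat_def)
  then show "(flat n \<longlongrightarrow> 0) (at_left 0)" by (rule tendsto_eventually)
  have "((\<lambda>t. inverse t ^ n / exp (inverse t)) \<longlongrightarrow> 0) (at_right (0::real))"
    by (rule filterlim_compose[OF tendsto_power_div_exp_0 filterlim_inverse_at_top_right])
  moreover have "\<forall>\<^sub>F t in at_right (0::real). inverse t ^ n / exp (inverse t) = flat n t"
    unfolding eventually_at_right_field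
    by (intro exI[of _ 1]) (auto simp: flat_def exp_minus divide_inverse)
  ultimately show "(flat n \<longlongrightarrow> 0) (at_right 0)" by (rule Lim_transform_eventually)
qed

lemma flat_has_derivative:
  "(flat n has_real_derivative flat (n + 2) t - of_nat n * flat (n + 1) t) (at t)"
proof -
  consider "t > 0" | "t < 0" | "t = 0" by linarith
  then show ?thesis
  proof cases
    case 1
    have "((\<lambda>t. inverse t ^ n * exp (- inverse t)) has_real_derivative
        flat (n + 2) t - of_nat n * flat (n + 1) t) (at t)"
      using 1 by (auto intro!: derivative_eq_intros simp: flat_def power2_eq_square)
        (cases n; simp add: field_simps)
    then show ?thesis
      by (rule has_field_derivative_transform_within_open[where S = "{0<..}"]) (use 1 in \<open>auto simp: flat_def\<close>)
  next
    case 2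
    have "((\<lambda>t. 0) has_real_derivative flat (n + 2) t - of_nat n * flat (n + 1) t) (at t)"
      using 2 by (simp add: flat_def)
    then show ?thesis
      by (rule has_field_derivative_transform_within_open[where S = "{..<0}"]) (use 2 in \<open>auto simp: flat_def\<close>)
  next
    case 3
    \<comment> \<open>The difference quotient at 0 is again a member of the family, which tends to
      0.\<close>
    have "(\<lambda>h. (flat n (0 + h) - flat n 0) / h) = flat (Suc n)"
      by (auto simp: fun_eq_iff flat_def divide_inverse)
    then have "(flat n has_real_derivative 0) (at 0)"
      using flat_tendsto_0[of "Suc n"] by (simp add: DERIV_def)
    then show ?thesis using 3 by (simp add: flat_def)
  qed
qed

lemma smooth_on_flat: "smooth_on UNIV (flat n)"
proof -
  have "higher_differentiable_on UNIV (flat n) m" for m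
  proof (induction m arbitrary: n)
    case 0
    then show ?case using DERIV_isCont[OF flat_has_derivative] by (simp add: continuous_on_eq_continuous_at)
  next
    case (Suc m)
    show ?case
    proof (rule hdiff_SucI[OF open_UNIV flat_has_derivative[unfolded has_field_derivative_def]])
      fix v :: real
      have "higher_differentiable_on UNIV (\<lambda>t. v * flat (n + 2) t + (- of_nat n * v) * flat (n + 1) t) m"
        by (intro hdiff_add open_UNIV hdiff_linear_compose[OF open_UNIV bounded_linear_mult_right Suc])
      then show "higher_differentiable_on UNIV (\<lambda>t. (flat (n + 2) t - of_nat n * flat (n + 1) t) * v) m"
        by (rule hdiff_cong[OF open_UNIV, rotated]) (simp add: algebra_simps)
    qed
  qed
  then show ?thesis by (simp add: smooth_on_def)
qed

definition bump :: "real \<Rightarrow> real" where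
  "bump x = flat 0 (1 - x\<^sup>2) / (flat 0 (1 - x\<^sup>2) + flat 0 (x\<^sup>2 - 1 / 4))"

text \<open>The intervals x^2 < 1 and x^2 > 1/4 cover the line, so one summand is always
  positive.\<close>

lemma bump_denom: "flat 0 (1 - x\<^sup>2) + flat 0 (x\<^sup>2 - 1 / 4) > 0"
  by (simp add: flat_def add_pos_pos)

lemma bump_eq_1: "\<bar>x\<bar> \<le> 1 / 2 \<Longrightarrow> bump x = 1"
proof -
  assume "\<bar>x\<bar> \<le> 1 / 2"
  then have "x\<^sup>2 \<le> (1 / 2)\<^sup>2" using abs_le_square_iff[of x "1/2"] by simp
  then have "x\<^sup>2 \<le> 1 / 4" by (simp add: power2_eq_square)
  then show ?thesis by (simp add: bump_def flat_def)
qed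

lemma bump_eq_0: "1 \<le> \<bar>x\<bar> \<Longrightarrow> bump x = 0"
  using abs_le_square_iff[of 1 x] by (simp add: bump_def flat_def)

lemma smooth_on_bump: "smooth_on UNIV bump"
proof -
  have id: "smooth_on UNIV (\<lambda>x::real. x)" by (intro smooth_on_bounded_linear open_UNIV bounded_linear_ident)
  have sq: "smooth_on UNIV (\<lambda>x::real. x\<^sup>2)"
    unfolding power2_eq_square by (intro smooth_on_mult id open_UNIV)
  have "smooth_on UNIV (\<lambda>x::real. flat 0 (1 - x\<^sup>2))" "smooth_on UNIV (\<lambda>x::real. flat 0 (x\<^sup>2 - 1 / 4))"
    by (rule smooth_on_compose[OF _ _ _ _ smooth_on_flat]; auto intro!: smooth_on_diff sq smooth_on_const)+
  then show ?thesis
    unfolding bump_def[abs_def]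
    by (intro smooth_on_divide smooth_on_add open_UNIV) (use bump_denom in \<open>auto simp: less_imp_neq[symmetric]\<close>)
qed

subsection \<open>Isothermal coordinates\<close>

lemma fseries_add:
  assumes "a norm_summable_on UNIV" "b norm_summable_on UNIV"
  shows "fseries (\<lambda>k. a k + b k) p = fseries a p + fseries b p"
  unfolding fseries_def distrib_right
  by (rule infsum_add[OF abs_summable_summable[OF abs_summable_fchar[OF assms(1)]]
        abs_summable_summable[OF abs_summable_fchar[OF assms(2)]]])

lemma fseries_cmult: "fseries (\<lambda>k. c * a k) p = c * fseries a p"
  unfolding fseries_def mult.assoc by (rule infsum_cmult_right')

lemma fseries_single: "fseries (\<lambda>k. if k = 0 then c else 0) p = c"
proof -
  have "fseries (\<lambda>k. if k = 0 then c else 0) p = (\<Sum>\<^sub>\<infinity>k\<in>{0}. c * fchar k p)"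
    unfolding fseries_def by (rule infsum_cong_neutral) auto
  then show ?thesis by (simp add: fchar_def)
qed

text \<open>Ellipticity: the imaginary part of the denominator controls the first frequency, and if
  that is zero the second is a nonzero integer.\<close>

lemma beltrami_symbol_lower_bound:
  fixes t0 :: complex
  assumes "Im t0 > 0" "k \<noteq> 0"
  shows "of_int (snd k) - t0 * of_int (fst k) \<noteq> 0"
    and "norm (1 / (of_int (snd k) - t0 * of_int (fst k))) \<le> 1 + 1 / Im t0"
    and "norm (of_int (fst k) / (of_int (snd k) - t0 * of_int (fst k))) \<le> 1 / Im t0"
proof -
  let ?d = "of_int (snd k) - t0 * of_int (fst k)"
  have im: "Im t0 * \<bar>of_int (fst k)\<bar> \<le> norm ?d"
    using abs_Im_le_cmod[of ?d] assms(1) by (simp add: abs_mult)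
  have one: "fst k = 0 \<Longrightarrow> 1 \<le> norm ?d"
    using assms(2) by (cases k) (auto simp: zero_prod_def simp flip: of_int_abs)
  have fst1: "fst k \<noteq> 0 \<Longrightarrow> Im t0 \<le> norm ?d"
  proof -
    assume "fst k \<noteq> 0"
    then have "1 \<le> \<bar>fst k\<bar>" by linarith
    then have "(1::real) \<le> \<bar>of_int (fst k)\<bar>" by (metis of_int_1_le_iff of_int_abs)
    then have "Im t0 * 1 \<le> Im t0 * \<bar>of_int (fst k)\<bar>" using assms(1) by (intro mult_left_mono) auto
    then show ?thesis using im by simp
  qed
  show "?d \<noteq> 0"
    using one fst1 assms(1) by (cases "fst k = 0") auto
  then have np: "norm ?d > 0" by simp
  show "norm (1 / ?d) \<le> 1 + 1 / Im t0"
  proof (cases "fst k = 0")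
    case True
    then have "norm (1 / ?d) \<le> 1" using one np by (simp add: norm_divide divide_le_eq)
    also have "\<dots> \<le> 1 + 1 / Im t0" using assms(1) by simp
    finally show ?thesis .
  next
    case False
    then have "norm (1 / ?d) \<le> 1 / Im t0"
      using fst1 np assms(1) by (simp add: norm_divide frac_le)
    then show ?thesis by simp
  qed
  show "norm (of_int (fst k) / ?d) \<le> 1 / Im t0"
    using im np assms(1) by (simp add: norm_divide field_simps)
qed

text \<open>Freezing the scale \<open>d\<close>: derivatives of the slice are derivatives of the
  joint function along (0, v), so they depend continuously on \<open>d\<close> as well.\<close>

lemma dirder_slice:
  fixes G :: "real \<times> (real \<times> real) \<Rightarrow> complex"
  assumes "open S" "smooth_on S G"
  shows "smooth_on {p. (d, p) \<in> S} (\<lambda>p. G (d, p))" "open {p. (d, p) \<in> S}"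
    and "\<And>p. (d, p) \<in> S \<Longrightarrow> dirder v (\<lambda>p. G (d, p)) p = dirder (0, v) G (d, p)"
proof -
  have dp: "((\<lambda>p. (d, p)) has_derivative (\<lambda>v. (0, v))) (at p)" for p :: "real \<times> real"
    by (auto intro!: derivative_eq_intros)
  have "open ((\<lambda>p. (d, p)) -` S)"
    by (rule open_vimage[OF assms(1)]) (intro continuous_intros)
  then show o: "open {p. (d, p) \<in> S}" by (simp add: vimage_def)
  have lin: "bounded_linear (\<lambda>p. (0::real, p :: real \<times> real))"
    by (intro bounded_linear_Pair bounded_linear_zero bounded_linear_ident)
  have "smooth_on {p. (d, p) \<in> S} (\<lambda>p. (d, 0) + (0, p :: real \<times> real))"
    by (intro smooth_on_add smooth_on_const o smooth_on_bounded_linear lin)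
  then have "smooth_on {p. (d, p) \<in> S} (\<lambda>p. (d, p :: real \<times> real))" by simp
  from smooth_on_compose[OF o assms(1) _ this assms(2)]
  show "smooth_on {p. (d, p) \<in> S} (\<lambda>p. G (d, p))" by simp
  show "dirder v (\<lambda>p. G (d, p)) p = dirder (0, v) G (d, p)" if "(d, p) \<in> S" for p
    by (rule dirder_eqI[OF has_derivative_compose[OF dp smooth_on_has_dirder[OF assms(2) that]]])
qed

lemma bessel_op_slice:
  fixes G :: "real \<times> (real \<times> real) \<Rightarrow> complex"
  assumes S: "open S" "smooth_on S G" and p: "(d, p) \<in> S"
  shows "bessel_op v (\<lambda>p. G (d, p)) p = bessel_op (0, v) G (d, p)"
proof -
  note sl = dirder_slice[OF S]
  have "dirder v (dirder v (\<lambda>p. G (d, p))) p = dirder v (\<lambda>p. dirder (0, v) G (d, p)) p"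
  proof (rule dirder_cong[OF sl(2)])
    show "dirder v (\<lambda>p. G (d, p)) y = dirder (0, v) G (d, y)" if "y \<in> {p. (d, p) \<in> S}" for y
      by (rule sl(3)) (use that in simp)
  qed (use p in simp)
  also have "\<dots> = dirder (0, v) (dirder (0, v) G) (d, p)"
    by (rule dirder_slice(3)[OF S(1) smooth_on_dirder[OF S(2)] p])
  finally show ?thesis by (simp add: bessel_op_def)
qed

lemma bessel_op_cong:
  assumes "open S" "x \<in> S" "\<And>y. y \<in> S \<Longrightarrow> f y = g y"
  shows "bessel_op v f x = bessel_op v g x"
proof -
  have "dirder v (dirder v f) x = dirder v (dirder v g) x"
    by (rule dirder_cong[OF assms(1,2)]) (rule dirder_cong[OF assms(1) _ assms(3)])
  then show ?thesis using assms by (simp add: bessel_op_def)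
qed

lemma bessel_op_bessel_op_slice:
  fixes G :: "real \<times> (real \<times> real) \<Rightarrow> complex"
  assumes S: "open S" "smooth_on S G" and p: "(d, p) \<in> S"
  shows "bessel_op u (bessel_op v (\<lambda>p. G (d, p))) p = bessel_op (0, u) (bessel_op (0, v) G) (d, p)"
proof -
  have "bessel_op u (bessel_op v (\<lambda>p. G (d, p))) p = bessel_op u (\<lambda>p. bessel_op (0, v) G (d, p)) p"
  proof (rule bessel_op_cong[OF dirder_slice(2)[OF S]])
    show "bessel_op v (\<lambda>p. G (d, p)) y = bessel_op (0, v) G (d, y)" if "y \<in> {p. (d, p) \<in> S}" for y
      by (rule bessel_op_slice[OF S]) (use that in simp)
  qed (use p in simp)
  also have "\<dots> = bessel_op (0, u) (bessel_op (0, v) G) (d, p)"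
    by (rule bessel_op_slice[OF S(1) smooth_on_bessel_op[OF S] p])
  finally show ?thesis .
qed

text \<open>Rescaling by a small factor \<open>d\<close> makes the cut-off oscillation of \<open>t\<close> small in the Wiener
  algebra: jointly smooth in \<open>(d, p)\<close>, it vanishes with all its \<open>p\<close>-derivatives at \<open>d = 0\<close>.\<close>

definition plane_vec :: "real \<times> real \<Rightarrow> real^2" where
  "plane_vec p = vector [fst p, snd p]"

lemma bounded_linear_plane_vec: "bounded_linear plane_vec"
proof -
  have "linear plane_vec"
    by (rule linearI) (simp_all add: plane_vec_def vec_eq_iff forall_2)
  then show ?thesis by (simp add: linear_conv_bounded_linear)
qed

lemma rescaled_oscillation_small:
  fixes t :: "real^2 \<Rightarrow> complex"
  assumes S: "open S" "q \<in> S" and t: "smooth_on S t" and e: "e > 0"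
  obtains d F T where "d > 0" "open T" "torus \<subseteq> T" "smooth_on T F" "supported T F"
    "\<And>p. p \<in> T \<Longrightarrow> q + d *\<^sub>R plane_vec p \<in> S"
    "\<And>p. p \<in> torus \<Longrightarrow> norm (bessel_op (1, 0) (bessel_op (0, 1) F) p) \<le> e"
    "\<And>p. \<bar>fst p\<bar> \<le> 1 / 2 \<Longrightarrow> \<bar>snd p\<bar> \<le> 1 / 2 \<Longrightarrow> F p = t (q + d *\<^sub>R plane_vec p) - t q"
proof -
  define pos where "pos = (\<lambda>z :: real \<times> (real \<times> real). q + fst z *\<^sub>R plane_vec (snd z))"
  define \<Omega> where "\<Omega> = pos -` S"
  define G where "G z = complex_of_real (bump (fst (snd z)) * bump (snd (snd z))) * (t (pos z) - t q)" for z
  have pv: "continuous_on A plane_vec" for A by (rule linear_continuous_on[OF bounded_linear_plane_vec])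
  have posc: "continuous_on UNIV pos"
    unfolding pos_def by (intro continuous_intros continuous_on_compose2[OF pv]) auto
  have \<Omega>: "open \<Omega>"
    unfolding \<Omega>_def by (rule open_vimage[OF S(1)]) (use posc in \<open>simp add: continuous_on_eq_continuous_at\<close>)
  have comps: "smooth_on \<Omega> (\<lambda>z. fst z)" "smooth_on \<Omega> (\<lambda>z. fst (snd z))" "smooth_on \<Omega> (\<lambda>z. snd (snd z))"
    "smooth_on \<Omega> (\<lambda>z. plane_vec (snd z))"
    by (intro smooth_on_bounded_linear \<Omega> bounded_linear_fst bounded_linear_snd
        bounded_linear_compose[OF bounded_linear_fst] bounded_linear_compose[OF bounded_linear_snd]
        bounded_linear_compose[OF bounded_linear_plane_vec])+
  have "smooth_on \<Omega> pos"
    unfolding pos_def by (intro smooth_on_add smooth_on_const \<Omega> smooth_on_scaleR comps)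
  then have tp: "smooth_on \<Omega> (\<lambda>z. t (pos z))"
    by (rule smooth_on_compose[OF \<Omega> S(1) _ _ t, rotated]) (simp add: \<Omega>_def)
  have bumps: "smooth_on \<Omega> (\<lambda>z. bump (fst (snd z)))" "smooth_on \<Omega> (\<lambda>z. bump (snd (snd z)))"
    by (rule smooth_on_compose[OF \<Omega> open_UNIV _ _ smooth_on_bump]; simp add: comps)+
  have G: "smooth_on \<Omega> G"
    unfolding G_def
    by (rule smooth_on_mult[OF \<Omega> smooth_on_linear_compose[OF \<Omega> bounded_linear_of_real smooth_on_mult[OF \<Omega> bumps]]
          smooth_on_diff[OF \<Omega> tp smooth_on_const[OF \<Omega>]]])
  define L where "L = bessel_op (0, (1, 0)) (bessel_op (0, (0, 1)) G)"
  have Lc: "continuous_on \<Omega> L"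
    unfolding L_def by (intro smooth_on_imp_continuous_on smooth_on_bessel_op \<Omega> G)
  have zero_in: "(0, p) \<in> \<Omega>" for p using S(2) by (simp add: \<Omega>_def pos_def)
  have L0: "L (0, p) = 0" for p
  proof -
    have "(\<lambda>p. G (0, p)) = (\<lambda>p. 0)" by (simp add: fun_eq_iff G_def pos_def)
    moreover have "bessel_op u (\<lambda>p. 0) = (\<lambda>p. 0)" for u :: "real \<times> real"
      by (simp add: fun_eq_iff bessel_op_def dirder_const[abs_def])
    ultimately show ?thesis
      using bessel_op_bessel_op_slice[OF \<Omega> G zero_in, of "(1, 0)" "(0, 1)" p] by (simp add: L_def)
  qed
  define V where "V = \<Omega> \<inter> L -` ball 0 e"
  have V: "open V" unfolding V_def by (rule continuous_open_preimage[OF Lc \<Omega> open_ball])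
  have comp: "compact torus" by (simp add: torus_def)
  \<comment> \<open>The bound holds on the whole slice \<open>d = 0\<close>. Compactness of the box
    carries it, through the tube lemma, to all scales near 0, uniformly in \<open>p\<close>.\<close>
  have "{0} \<times> torus \<subseteq> V" using zero_in L0 e by (auto simp: V_def)
  from Elementary_Topology.tube_lemma[OF comp V this]
  obtain A where A: "open A" "0 \<in> A" "A \<times> torus \<subseteq> V" by auto
  obtain d' where d': "d' > 0" "ball 0 d' \<subseteq> A" using A open_contains_ball by blast
  define d where "d = d' / 2"
  have d: "d > 0" "d \<in> A" using d' by (auto simp: d_def)
  define T where "T = {p. (d, p) \<in> \<Omega>}"
  define F where "F p = G (d, p)" for p
  show thesis
  proof (rule that[of d T F])
    show "d > 0" by (rule d)
    show "open T" unfolding T_def by (rule dirder_slice(2)[OF \<Omega> G])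
    show "torus \<subseteq> T" using A(3) d by (auto simp: T_def V_def)
    show "smooth_on T F" unfolding T_def F_def by (rule dirder_slice(1)[OF \<Omega> G])
    show "supported T F"
      by (auto simp: supported_def F_def G_def bump_eq_0)
    show "q + d *\<^sub>R plane_vec p \<in> S" if "p \<in> T" for p
      using that by (simp add: T_def \<Omega>_def pos_def)
    show "norm (bessel_op (1, 0) (bessel_op (0, 1) F) p) \<le> e" if "p \<in> torus" for p
    proof -
      have "(d, p) \<in> V" using A(3) d that by auto
      then have "(d, p) \<in> \<Omega>" "norm (L (d, p)) < e" by (auto simp: V_def)
      then show ?thesis
        unfolding F_def bessel_op_bessel_op_slice[OF \<Omega> G \<open>(d, p) \<in> \<Omega>\<close>] L_def by simp
    qed
    show "F p = t (q + d *\<^sub>R plane_vec p) - t q" if "\<bar>fst p\<bar> \<le> 1 / 2" "\<bar>snd p\<bar> \<le> 1 / 2" for p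
      using that by (simp add: F_def G_def pos_def bump_eq_1)
  qed
qed

text \<open>For the rescaled unknown W put nu = W_y - t0 W_x. Inverting this operator gives W_x = 1
  + sigma nu, and the Beltrami equation becomes nu = F (1 + sigma nu), which the Neumann series
  solves.\<close>

lemma beltrami_solution:
  fixes t :: "real^2 \<Rightarrow> complex"
  assumes S: "open S" "q \<in> S" and t: "smooth_on S t" and im: "Im (t q) > 0"
  obtains V w where "open V" "q \<in> V" "V \<subseteq> S" "smooth_on V w"
    "\<And>y. y \<in> V \<Longrightarrow> dirder (axis 2 1) w y = t y * dirder (axis 1 1) w y"
    "\<And>y. y \<in> V \<Longrightarrow> dirder (axis 1 1) w y \<noteq> 0"
proof -
  define t0 where "t0 = t q"
  define M where "M = 1 / Im t0"
  have M: "M > 0" using im by (simp add: M_def t0_def)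
  define K where "K = (\<Sum>\<^sub>\<infinity>k. 1 / bessel_weight k)"
  have K: "K \<ge> 0" unfolding K_def by (rule infsum_nonneg) (use bessel_weight_ge_1 order_trans[OF zero_le_one] in auto)
  \<comment> \<open>Since the norm of \<open>\<rho>\<close> is at most \<open>e * K\<close>, this
    gives \<open>M * (e * K) = K / (4 * (K + 1))\<close>, below 1/2; the summand 1 keeps the
    denominator positive.\<close>
  define e where "e = 1 / (4 * M * (K + 1))"
  have e: "e > 0" using M K by (simp add: e_def)
  obtain d F T where d: "d > 0" and T: "open T" "torus \<subseteq> T" and F: "smooth_on T F" "supported T F"
    and TS: "\<And>p. p \<in> T \<Longrightarrow> q + d *\<^sub>R plane_vec p \<in> S"
    and Fe: "\<And>p. p \<in> torus \<Longrightarrow> norm (bessel_op (1, 0) (bessel_op (0, 1) F) p) \<le> e"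
    and Ft: "\<And>p. \<bar>fst p\<bar> \<le> 1 / 2 \<Longrightarrow> \<bar>snd p\<bar> \<le> 1 / 2 \<Longrightarrow> F p = t (q + d *\<^sub>R plane_vec p) - t q"
    by (rule rescaled_oscillation_small[OF S t e]) (rule that)
  define \<rho> where "\<rho> = fcoef F"
  have \<rho>: "rapid \<rho>" unfolding \<rho>_def by (rule rapid_fcoef[OF T F])
  have \<rho>1: "\<rho> norm_summable_on UNIV" by (rule rapid_norm_summable[OF \<rho>])
  have "(\<Sum>\<^sub>\<infinity>k. norm (\<rho> k)) \<le> e * K"
    unfolding \<rho>_def K_def by (rule fcoef_summable(2)[OF T F Fe]) (use e in auto)
  then have "M * (\<Sum>\<^sub>\<infinity>k. norm (\<rho> k)) \<le> M * (e * K)" using M by (intro mult_left_mono) auto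
  also have "M * (e * K) = K / (4 * (K + 1))" using M by (simp add: e_def)
  also have "\<dots> < 1 / 2" using K by (simp add: divide_less_eq)
  finally have small: "M * (\<Sum>\<^sub>\<infinity>k. norm (\<rho> k)) < 1 / 2" .
  then have small1: "M * (\<Sum>\<^sub>\<infinity>k. norm (\<rho> k)) < 1" by simp
  define dn where "dn k = complex_of_int (snd k) - t0 * of_int (fst k)" for k :: "int \<times> int"
  have im0: "Im t0 > 0" using im by (simp add: t0_def)
  note sym = beltrami_symbol_lower_bound[OF im0, folded dn_def]
  \<comment> \<open>Symbol of d_x (d_y - t0 d_x)^(-1). At frequency 0 the quotient is undefined; the
    value 0 matches the fact that derivatives of periodic functions have mean zero.\<close>
  define \<sigma> where "\<sigma> k = (if k = 0 then 0 else of_int (fst k) / dn k)" for k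
  have \<sigma>: "norm (\<sigma> k) \<le> M" for k using sym(3)[of k] M by (simp add: \<sigma>_def M_def)
  define \<nu> where "\<nu> = neumann_sum \<rho> \<sigma>"
  have \<nu>: "rapid \<nu>" unfolding \<nu>_def by (rule neumann_sum_rapid[OF \<rho> \<sigma> small1])
  have eq: "fseries \<nu> p = fseries \<rho> p * (1 + fseries (\<lambda>k. \<sigma> k * \<nu> k) p)" for p
    unfolding \<nu>_def by (rule neumann_sum_fseries[OF \<rho>1 \<sigma> small1])
  \<comment> \<open>Symbol of (d_y - t0 d_x)^(-1) off frequency 0, so \<open>fseries a\<close>
    solves that equation with right side \<open>fseries \<nu>\<close> minus its mean
    \<open>\<nu> 0\<close>.\<close>
  define c where "c k = (if k = 0 then 0 else 1 / (\<i> * dn k))" for k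
  define a where "a k = c k * \<nu> k" for k
  have a: "rapid a"
    unfolding a_def
  proof (rule rapid_mult[OF \<nu>])
    show "norm (c k) \<le> (1 + 1 / Im t0) * (1 + mag k) ^ 0" for k
      using sym(2)[of k] im0 by (auto simp: c_def norm_mult norm_divide)
  qed
  have \<sigma>\<nu>: "rapid (\<lambda>k. \<sigma> k * \<nu> k)"
    by (rule rapid_mult[OF \<nu>, of _ M 0]) (simp add: \<sigma>)
  have a1: "fchar_symbol k (1, 0) * a k = \<sigma> k * \<nu> k" for k
    using sym(1)[of k] by (auto simp: a_def c_def \<sigma>_def fchar_symbol_def)
  have a2: "\<nu> k = (if k = 0 then \<nu> 0 else 0) + (fchar_symbol k (0, 1) * a k + (- t0) * (\<sigma> k * \<nu> k))" for k
  proof (cases "k = 0")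
    case True
    then show ?thesis by (simp add: a_def c_def \<sigma>_def)
  next
    case False
    have "fchar_symbol k (0, 1) * a k + (- t0) * (\<sigma> k * \<nu> k) = (of_int (snd k) - t0 * of_int (fst k)) / dn k * \<nu> k"
      using False sym(1)[of k] by (simp add: a_def c_def \<sigma>_def fchar_symbol_def field_simps)
    then show ?thesis using False sym(1)[of k] by (simp add: dn_def)
  qed
  \<comment> \<open>The linear terms give W_x mean 1 and supply the missing mean
    \<open>\<nu> 0\<close> of W_y - t0 W_x.\<close>
  define W where "W p = complex_of_real (fst p) + (t0 + \<nu> 0) * complex_of_real (snd p) + fseries a p" for p
  have smW: "smooth_on UNIV W"
    unfolding W_def
    by (intro smooth_on_add open_UNIV smooth_on_fseries a smooth_on_bounded_linear
        bounded_linear_compose[OF bounded_linear_of_real bounded_linear_fst]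
        bounded_linear_compose[OF bounded_linear_mult_right bounded_linear_compose[OF bounded_linear_of_real bounded_linear_snd]])
  have DW: "(W has_derivative (\<lambda>v. complex_of_real (fst v) + (t0 + \<nu> 0) * complex_of_real (snd v) + fseries (\<lambda>k. fchar_symbol k v * a k) p)) (at p)" for p
    unfolding W_def
    by (intro has_derivative_add rapid_fseries_has_derivative a bounded_linear_imp_has_derivative
        bounded_linear_compose[OF bounded_linear_of_real bounded_linear_fst]
        bounded_linear_compose[OF bounded_linear_mult_right bounded_linear_compose[OF bounded_linear_of_real bounded_linear_snd]])
  have W1: "dirder (1, 0) W p = 1 + fseries (\<lambda>k. \<sigma> k * \<nu> k) p" for p
    using dirder_eqI[OF DW, of "(1, 0)" p] by (simp add: a1)
  have W2: "dirder (0, 1) W p = t0 * dirder (1, 0) W p + fseries \<nu> p" for p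
  proof -
    have fin: "(\<lambda>k :: int \<times> int. if k = 0 then \<nu> 0 else 0) norm_summable_on UNIV"
    proof -
      have "(\<lambda>k :: int \<times> int. norm (if k = 0 then \<nu> 0 else 0)) summable_on {0}" by simp
      then show ?thesis by (rule summable_on_cong_neutral[THEN iffD1, rotated -1]) auto
    qed
    have s1: "(\<lambda>k. fchar_symbol k (0, 1) * a k) norm_summable_on UNIV"
      by (rule rapid_norm_summable[OF rapid_fchar_symbol[OF a]])
    have s2: "(\<lambda>k. (- t0) * (\<sigma> k * \<nu> k)) norm_summable_on UNIV"
      by (rule rapid_norm_summable[OF rapid_mult[OF \<sigma>\<nu>, of _ "norm t0" 0]]) simp
    have s12: "(\<lambda>k. fchar_symbol k (0, 1) * a k + (- t0) * (\<sigma> k * \<nu> k)) norm_summable_on UNIV"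
      by (rule summable_on_comparison_test[OF summable_on_add[OF s1 s2] norm_triangle_ineq]) simp
    have "fseries \<nu> p = fseries (\<lambda>k. (if k = 0 then \<nu> 0 else 0) + (fchar_symbol k (0, 1) * a k + (- t0) * (\<sigma> k * \<nu> k))) p"
      using a2 by (intro arg_cong[of _ _ "\<lambda>f. fseries f p"] ext)
    also have "\<dots> = \<nu> 0 + (fseries (\<lambda>k. fchar_symbol k (0, 1) * a k) p + (- t0) * fseries (\<lambda>k. \<sigma> k * \<nu> k) p)"
      unfolding fseries_add[OF fin s12] fseries_add[OF s1 s2] fseries_single fseries_cmult ..
    finally have "fseries (\<lambda>k. fchar_symbol k (0, 1) * a k) p = fseries \<nu> p - \<nu> 0 + t0 * fseries (\<lambda>k. \<sigma> k * \<nu> k) p"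
      by (simp add: algebra_simps)
    then show ?thesis
      using dirder_eqI[OF DW, of "(0, 1)" p] unfolding W1 by (simp add: algebra_simps)
  qed
  have "M * (\<Sum>\<^sub>\<infinity>k. norm (\<nu> k)) < 1"
    unfolding \<nu>_def by (rule neumann_sum_norm[OF \<rho>1 \<sigma> small])
  have W1nz: "dirder (1, 0) W p \<noteq> 0" for p
  proof
    assume "dirder (1, 0) W p = 0"
    then have "fseries (\<lambda>k. \<sigma> k * \<nu> k) p = -1" unfolding W1 by (simp add: add_eq_0_iff)
    then have "1 \<le> (\<Sum>\<^sub>\<infinity>k. norm (\<sigma> k * \<nu> k))"
      using fseries_bound[OF rapid_norm_summable[OF \<sigma>\<nu>], of p] by simp
    also have "\<dots> \<le> (\<Sum>\<^sub>\<infinity>k. M * norm (\<nu> k))"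
    proof (rule infsum_mono[OF rapid_norm_summable[OF \<sigma>\<nu>] summable_on_cmult_right[OF rapid_norm_summable[OF \<nu>]]])
      show "norm (\<sigma> k * \<nu> k) \<le> M * norm (\<nu> k)" for k
        using \<sigma>[of k] by (simp add: norm_mult mult_right_mono)
    qed
    also have "\<dots> = M * (\<Sum>\<^sub>\<infinity>k. norm (\<nu> k))" by (rule infsum_cmult_right')
    finally show False using \<open>M * (\<Sum>\<^sub>\<infinity>k. norm (\<nu> k)) < 1\<close> by simp
  qed
  have inv: "F p = fseries \<rho> p" if "p \<in> torus" for p
    unfolding \<rho>_def
  proof (rule fourier_inversion[OF _ supported_torus_periodic[OF F(2) T(2)] _ that])
    show "continuous_on torus F" using smooth_on_imp_continuous_on[OF F(1)] T(2) continuous_on_subset by blast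
    show "fcoef F norm_summable_on UNIV" using \<rho>1 by (simp add: \<rho>_def)
  qed
  define \<kappa> where "\<kappa> y = ((y - q) $ 1 / d, (y - q) $ 2 / d)" for y :: "real^2"
  \<comment> \<open>In rescaled coordinates the square of half-side 1/2, where the cut-off equals 1
    and hence F is t - t0 exactly.\<close>
  define V where "V = {y :: real^2. \<bar>(y - q) $ 1 / d\<bar> < 1 / 2} \<inter> {y. \<bar>(y - q) $ 2 / d\<bar> < 1 / 2}"
  define w where "w y = W (\<kappa> y)" for y
  have \<kappa>q: "q + d *\<^sub>R plane_vec (\<kappa> y) = y" for y
    using d by (simp add: \<kappa>_def plane_vec_def vec_eq_iff forall_2)
  have \<kappa>T: "\<kappa> y \<in> torus" "\<bar>fst (\<kappa> y)\<bar> \<le> 1 / 2" "\<bar>snd (\<kappa> y)\<bar> \<le> 1 / 2" if "y \<in> V" for y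
  proof -
    show b: "\<bar>fst (\<kappa> y)\<bar> \<le> 1 / 2" "\<bar>snd (\<kappa> y)\<bar> \<le> 1 / 2" using that by (simp_all add: V_def \<kappa>_def)
    have "1 / 2 \<le> pi" using pi_gt3 by simp
    then have "\<bar>fst (\<kappa> y)\<bar> \<le> pi" "\<bar>snd (\<kappa> y)\<bar> \<le> pi"
      using order_trans[OF b(1)] order_trans[OF b(2)] by blast+
    then show "\<kappa> y \<in> torus" by (simp add: torus_iff abs_le_iff minus_le_iff)
  qed
  have D\<kappa>: "(\<kappa> has_derivative (\<lambda>v. (v $ 1 / d, v $ 2 / d))) (at y)" for y
    unfolding \<kappa>_def using d by (auto intro!: derivative_eq_intros has_derivative_vec_nth simp: fun_eq_iff)
  have sm\<kappa>: "smooth_on UNIV \<kappa>"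
  proof -
    have "linear (\<lambda>v :: real^2. (v $ 1 / d, v $ 2 / d))"
      by (rule linearI) (simp_all add: add_divide_distrib)
    then have "bounded_linear (\<lambda>v :: real^2. (v $ 1 / d, v $ 2 / d))" by (simp add: linear_conv_bounded_linear)
    then have "smooth_on UNIV (\<lambda>v :: real^2. (v $ 1 / d, v $ 2 / d) + (- q $ 1 / d, - q $ 2 / d))"
      by (intro smooth_on_add smooth_on_const smooth_on_bounded_linear open_UNIV)
    moreover have "(\<lambda>v :: real^2. (v $ 1 / d, v $ 2 / d) + (- q $ 1 / d, - q $ 2 / d)) = \<kappa>"
      by (simp add: fun_eq_iff \<kappa>_def diff_divide_distrib)
    ultimately show ?thesis by simp
  qed
  have Dw: "dirder v w y = dirder (v $ 1 / d, v $ 2 / d) W (\<kappa> y)" for v y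
    unfolding w_def
    by (rule dirder_eqI[OF has_derivative_compose[OF D\<kappa> smooth_on_has_dirder[OF smW UNIV_I]]])
  have scale: "dirder (r *\<^sub>R v) W p = r *\<^sub>R dirder v W p" for r v p
    using linear_scale[OF has_derivative_linear[OF smooth_on_has_dirder[OF smW UNIV_I]]] .
  have w1: "dirder (axis 1 1) w y = (1 / d) *\<^sub>R dirder (1, 0) W (\<kappa> y)"
    and w2: "dirder (axis 2 1) w y = (1 / d) *\<^sub>R dirder (0, 1) W (\<kappa> y)" for y
    unfolding Dw scale[symmetric] by (simp_all add: axis_def)
  show thesis
  proof (rule that[of V w])
    show "open V" unfolding V_def by (intro open_Int open_Collect_less continuous_intros) (use d in auto)
    show "q \<in> V" using d by (simp add: V_def)
    show "V \<subseteq> S"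
    proof
      fix y assume "y \<in> V"
      then show "y \<in> S" using TS[of "\<kappa> y"] \<kappa>T(1)[of y] T(2) \<kappa>q[of y] by auto
    qed
    have "smooth_on UNIV w" unfolding w_def by (rule smooth_on_compose[OF open_UNIV open_UNIV _ sm\<kappa> smW]) simp
    then show "smooth_on V w" by (rule smooth_on_subset) simp
    fix y assume y: "y \<in> V"
    show "dirder (axis 1 1) w y \<noteq> 0" using W1nz d by (simp add: w1)
    have "fseries \<nu> (\<kappa> y) = (t y - t0) * dirder (1, 0) W (\<kappa> y)"
      unfolding eq W1 inv[OF \<kappa>T(1)[OF y], symmetric] Ft[OF \<kappa>T(2,3)[OF y]] \<kappa>q t0_def ..
    then show "dirder (axis 2 1) w y = t y * dirder (axis 1 1) w y"
      unfolding w1 w2 W2 by (simp add: algebra_simps)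
  qed
qed

lemma smooth_on_complexI:
  assumes S: "open S" and "smooth_on S (\<lambda>x. Re (w x))" "smooth_on S (\<lambda>x. Im (w x))"
  shows "smooth_on S w"
proof -
  have "smooth_on S (\<lambda>x. complex_of_real (Re (w x)) + \<i> * complex_of_real (Im (w x)))"
    by (rule smooth_on_add[OF S smooth_on_linear_compose[OF S bounded_linear_of_real assms(2)]
          smooth_on_linear_compose[OF S bounded_linear_mult_right smooth_on_linear_compose[OF S bounded_linear_of_real assms(3)]]])
  then show ?thesis by (rule smooth_on_cong[OF _ S]) (simp add: complex_eq_iff)
qed

text \<open>Completing the square, the metric is \<open>b(e\<^sub>1, e\<^sub>1) |dx + t dy|\<^sup>2\<close> with \<open>Im t > 0\<close>, so a solution of
  \<open>w\<^sub>y = t w\<^sub>x\<close> has \<open>dw = w\<^sub>x (dx + t dy)\<close> and is conformal.\<close>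

lemma isothermal_coordinate:
  fixes b :: "real^2 \<Rightarrow> real^2 \<Rightarrow> real^2 \<Rightarrow> real"
  assumes S: "open S" "q \<in> S"
    and bil: "\<And>x. x \<in> S \<Longrightarrow> bilinear (b x)"
    and sym: "\<And>x u v. x \<in> S \<Longrightarrow> b x u v = b x v u"
    and pos: "\<And>x u. x \<in> S \<Longrightarrow> u \<noteq> 0 \<Longrightarrow> b x u u > 0"
    and sm: "\<And>u v. smooth_on S (\<lambda>x. b x u v)"
  obtains V w where "q \<in> V" "V \<subseteq> S" "conformal_coordinate b V w" "\<And>y. y \<in> V \<Longrightarrow> w y \<noteq> 0"
proof -
  let ?e1 = "axis 1 1 :: real^2" and ?e2 = "axis 2 1 :: real^2"
  define E F G where "E x = b x ?e1 ?e1" and "F x = b x ?e1 ?e2" and "G x = b x ?e2 ?e2" for x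
  have e12: "u = u $ 1 *\<^sub>R ?e1 + u $ 2 *\<^sub>R ?e2" for u :: "real^2"
    by (simp add: vec_eq_iff forall_2 axis_def)
  have b: "b x u v = E x * (u$1 * v$1) + F x * (u$1 * v$2 + u$2 * v$1) + G x * (u$2 * v$2)" if x: "x \<in> S" for x u v
  proof -
    note B = bil[OF x]
    have "b x u v = b x (u$1 *\<^sub>R ?e1 + u$2 *\<^sub>R ?e2) (v$1 *\<^sub>R ?e1 + v$2 *\<^sub>R ?e2)"
      by (simp only: e12[symmetric])
    also have "\<dots> = E x * (u$1 * v$1) + F x * (u$1 * v$2 + u$2 * v$1) + G x * (u$2 * v$2)"
      using sym[OF x, of ?e2 ?e1]
      by (simp add: bilinear_ladd[OF B] bilinear_radd[OF B] bilinear_lmul[OF B] bilinear_rmul[OF B]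
          E_def F_def G_def algebra_simps)
    finally show ?thesis .
  qed
  have E: "E x > 0" if "x \<in> S" for x
    using pos[OF that, of ?e1] by (simp add: E_def axis_eq_0_iff)
  have disc: "E x * G x - F x * F x > 0" if x: "x \<in> S" for x
  proof -
    \<comment> \<open>Orthogonal to the first basis vector for the metric; its squared length is E
      (E G - F^2).\<close>
    define u :: "real^2" where "u = vector [- F x, E x]"
    have "u \<noteq> 0" using E[OF x] by (auto simp: u_def vec_eq_iff forall_2)
    from pos[OF x this] have "0 < E x * (E x * G x - F x * F x)"
      unfolding b[OF x] u_def by (simp add: algebra_simps)
    then show ?thesis using E[OF x] by (simp add: zero_less_mult_iff)
  qed
  define t where "t x = Complex (F x / E x) (sqrt (E x * G x - F x * F x) / E x)" for x
  have smEFG: "smooth_on S E" "smooth_on S F" "smooth_on S G"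
    unfolding E_def F_def G_def by (rule sm)+
  have smt: "smooth_on S t"
  proof (rule smooth_on_complexI[OF S(1)])
    show "smooth_on S (\<lambda>x. Re (t x))"
      unfolding t_def complex.sel by (intro smooth_on_divide S smEFG) (use E in force)
    have "smooth_on S (\<lambda>x. sqrt (E x * G x - F x * F x))"
      by (intro smooth_on_sqrt smooth_on_diff smooth_on_mult S smEFG disc)
    then show "smooth_on S (\<lambda>x. Im (t x))"
      unfolding t_def complex.sel by (intro smooth_on_divide S smEFG) (use E in force)+
  qed
  have imt: "Im (t q) > 0" using E[OF S(2)] disc[OF S(2)] by (simp add: t_def)
  obtain V w where V: "open V" "q \<in> V" "V \<subseteq> S" and w: "smooth_on V w"
    and w2: "\<And>y. y \<in> V \<Longrightarrow> dirder ?e2 w y = t y * dirder ?e1 w y"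
    and w1: "\<And>y. y \<in> V \<Longrightarrow> dirder ?e1 w y \<noteq> 0"
    by (rule beltrami_solution[OF S smt imt]) (rule that)
  \<comment> \<open>Shifted to take the value 1 at \<open>q\<close>, so that it has no zero nearby
    and its square is again a conformal coordinate.\<close>
  define w' where "w' y = w y + (1 - w q)" for y
  have smw': "smooth_on V w'" unfolding w'_def by (intro smooth_on_add V w smooth_on_const)
  have dw': "dirder u w' y = dirder u w y" if "y \<in> V" for u y
    unfolding w'_def using dirder_add[OF w smooth_on_const[OF V(1)] that] by (simp add: dirder_const)
  define V' where "V' = V \<inter> w' -` (- {0})"
  have V': "open V'" unfolding V'_def
    by (rule continuous_open_preimage[OF smooth_on_imp_continuous_on[OF smw'] V(1)]) (rule open_Compl, simp)
  have sub: "V' \<subseteq> V" by (auto simp: V'_def)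
  have conf: "\<exists>l>0. \<forall>u u'. b y u u' = l * Re (dirder u w' y * cnj (dirder u' w' y))" if "y \<in> V'" for y
  proof -
    have y: "y \<in> V" "y \<in> S" using that sub V(3) by auto
    define W where "W = dirder ?e1 w y"
    have lin: "linear (\<lambda>u. dirder u w y)"
      using has_derivative_linear[OF smooth_on_has_dirder[OF w y(1)]] .
    have d: "dirder u w' y = W * (of_real (u$1) + t y * of_real (u$2))" for u
    proof -
      have "dirder u w y = dirder (u $ 1 *\<^sub>R ?e1 + u $ 2 *\<^sub>R ?e2) w y"
        by (simp only: e12[symmetric])
      also have "\<dots> = u $ 1 *\<^sub>R dirder ?e1 w y + u $ 2 *\<^sub>R dirder ?e2 w y"
        by (simp only: linear_add[OF lin] linear_scale[OF lin])
      finally show ?thesis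
        by (simp add: dw'[OF y(1)] w2[OF y(1)] W_def scaleR_conv_of_real algebra_simps)
    qed
    have nW: "(norm W)\<^sup>2 > 0" using w1[OF y(1)] by (simp add: W_def)
    have ReW: "Re (dirder u w' y * cnj (dirder u' w' y)) =
        (norm W)\<^sup>2 * Re ((of_real (u$1) + t y * of_real (u$2)) * cnj (of_real (u'$1) + t y * of_real (u'$2)))" for u u'
    proof -
      have "dirder u w' y * cnj (dirder u' w' y) =
          of_real ((norm W)\<^sup>2) * ((of_real (u$1) + t y * of_real (u$2)) * cnj (of_real (u'$1) + t y * of_real (u'$2)))"
        unfolding d complex_cnj_mult complex_norm_square by (simp only: mult_ac)
      then show ?thesis by simp
    qed
    have tt: "E y * Re (t y) = F y" "E y * (Re (t y) * Re (t y) + Im (t y) * Im (t y)) = G y"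
    proof -
      show "E y * Re (t y) = F y" using E[OF y(2)] by (simp add: t_def)
      have "sqrt (E y * G y - F y * F y) * sqrt (E y * G y - F y * F y) = E y * G y - F y * F y"
        using disc[OF y(2)] by simp
      then show "E y * (Re (t y) * Re (t y) + Im (t y) * Im (t y)) = G y"
        using E[OF y(2)] by (simp add: t_def add_divide_distrib[symmetric])
    qed
    have "b y u u' = E y / (norm W)\<^sup>2 * Re (dirder u w' y * cnj (dirder u' w' y))" for u u'
    proof -
      have "b y u u' = E y * Re ((of_real (u$1) + t y * of_real (u$2)) * cnj (of_real (u'$1) + t y * of_real (u'$2)))"
        unfolding b[OF y(2)] tt(1)[symmetric] tt(2)[symmetric] by (simp add: algebra_simps)
      then show ?thesis unfolding ReW using nW by simp
    qed
    then show ?thesis using E[OF y(2)] nW by (intro exI[of _ "E y / (norm W)\<^sup>2"]) simp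
  qed
  show thesis
  proof (rule that[of V' w'])
    show "q \<in> V'" using V(2) by (simp add: V'_def w'_def)
    show "V' \<subseteq> S" using sub V(3) by blast
    show "conformal_coordinate b V' w'"
      unfolding conformal_coordinate_def using V' smooth_on_subset[OF smw' sub] conf by blast
  qed (auto simp: V'_def)
qed

subsection \<open>Harmonic morphisms from Sol\<close>

text \<open>Real and imaginary parts of an isothermal coordinate and of its square pull back to
  harmonic functions, so the pulled-back coordinate has null gradient and hence zero differential.
  Conformality transfers this to the map itself.\<close>

lemma harmonic_morphism_locally_constant:
  fixes B :: "('b::{second_countable_topology, t2_space}, 2) chart set"
  assumes \<alpha>: "\<alpha> > 0" and U: "open U" and B: "riemannian_manifold B h"
    and hm: "harmonic_morphism sol_atlas (sol_metric \<alpha>) U B h \<phi>" and p: "p \<in> U"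
  shows "\<exists>e>0. \<forall>x\<in>ball p e. x \<in> U \<and> \<phi> x = \<phi> p"
proof -
  have sm\<phi>: "smooth_map_on sol_atlas U B \<phi>"
    and pull: "\<And>W f. open W \<Longrightarrow> W \<subseteq> manifold_carrier B \<Longrightarrow> U \<inter> \<phi> -` W \<noteq> {} \<Longrightarrow> harmonic_on B h W f
        \<Longrightarrow> harmonic_on sol_atlas (sol_metric \<alpha>) (U \<inter> \<phi> -` W) (f \<circ> \<phi>)"
    using hm unfolding harmonic_morphism_def by auto
  have cont: "continuous_on U \<phi>" using sm\<phi> by (simp add: smooth_map_on_def)
  have inv_id: "inv_into UNIV id = (id :: real^3 \<Rightarrow> real^3)"
    by (simp add: fun_eq_iff inv_f_eq)
  obtain E \<eta> where chart: "(E, \<eta>) \<in> B" "\<phi> p \<in> E"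
    using sm\<phi> p unfolding smooth_map_on_def manifold_carrier_def by blast
  have atlas: "smooth_atlas B" using B by (simp add: riemannian_manifold_def)
  have E: "open E" "open (\<eta> ` E)" "inj_on \<eta> E"
  proof -
    have H: "open E" "open (\<eta> ` E)" "homeomorphism E (\<eta> ` E) \<eta> (inv_into E \<eta>)"
      using atlas chart by (auto simp: smooth_atlas_def)
    then show "open E" "open (\<eta> ` E)" by auto
    show "inj_on \<eta> E" using H(3) unfolding homeomorphism_def by (metis inj_onI)
  qed
  have b: "\<forall>x\<in>\<eta> ` E. bilinear (h (E, \<eta>) x) \<and> (\<forall>u v. h (E, \<eta>) x u v = h (E, \<eta>) x v u) \<and>
      (\<forall>u. u \<noteq> 0 \<longrightarrow> h (E, \<eta>) x u u > 0)" "\<forall>u v. smooth_on (\<eta> ` E) (\<lambda>x. h (E, \<eta>) x u v)"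
    using B chart unfolding riemannian_manifold_def by blast+
  obtain V w where V: "\<eta> (\<phi> p) \<in> V" "V \<subseteq> \<eta> ` E" and w: "conformal_coordinate (h (E, \<eta>)) V w"
    and w0: "\<And>y. y \<in> V \<Longrightarrow> w y \<noteq> 0"
    by (rule isothermal_coordinate[OF E(2), of "\<eta> (\<phi> p)" "h (E, \<eta>)"]) (use b chart in auto)
  have smw: "smooth_on V w" using w by (auto simp: conformal_coordinate_def)
  define W where "W = E \<inter> \<eta> -` V"
  define \<Omega> where "\<Omega> = U \<inter> \<phi> -` W"
  have opW: "open W" "W \<subseteq> manifold_carrier B"
    using harmonic_on_conformal_coordinate(1,2)[OF B chart(1) w, of Re] by (auto simp: W_def)
  have \<Omega>: "open \<Omega>" unfolding \<Omega>_def by (rule continuous_open_preimage[OF cont U opW(1)])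
  have p\<Omega>: "p \<in> \<Omega>" using p chart V by (auto simp: \<Omega>_def W_def)
  define G where "G = (\<lambda>x. \<eta> (\<phi> x))"
  have GV: "G x \<in> V" if "x \<in> \<Omega>" for x using that by (simp add: \<Omega>_def W_def G_def)
  have smG: "smooth_on \<Omega> G"
  proof -
    have "smooth_on (id ` (UNIV \<inter> U \<inter> \<phi> -` E)) (\<eta> \<circ> \<phi> \<circ> inv_into UNIV id)"
      using sm\<phi> chart(1) unfolding smooth_map_on_def sol_atlas_def by blast
    then have "smooth_on (U \<inter> \<phi> -` E) G" by (simp add: inv_id G_def o_def)
    then show ?thesis by (rule smooth_on_subset) (auto simp: \<Omega>_def W_def)
  qed
  have harm: "smooth_on \<Omega> (\<lambda>x. c (G x)) \<and> sol_lap \<alpha> (\<lambda>x. c (G x)) y = 0"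
    if c: "conformal_coordinate (h (E, \<eta>)) V c" and y: "y \<in> \<Omega>" for c y
  proof -
    have L: "smooth_on \<Omega> (\<lambda>x. L (c (G x))) \<and> laplace_beltrami (sol_metric \<alpha> (UNIV, id)) (\<lambda>x. L (c (G x))) y = 0"
      if "L = Re \<or> L = Im" for L
    proof -
      have "harmonic_on sol_atlas (sol_metric \<alpha>) \<Omega> ((\<lambda>p. L (c (\<eta> p))) \<circ> \<phi>)"
        unfolding \<Omega>_def using pull[OF opW] harmonic_on_conformal_coordinate(3)[OF B chart(1) c that] p\<Omega>
        by (auto simp: \<Omega>_def W_def)
      then show ?thesis
        using y by (simp add: harmonic_on_def sol_atlas_def inv_id o_def G_def)
    qed
    have sc: "smooth_on \<Omega> (\<lambda>x. c (G x))"
      using L by (intro smooth_on_complexI[OF \<Omega>]) auto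
    have "L (sol_lap \<alpha> (\<lambda>x. c (G x)) y) = 0" if "L = Re \<or> L = Im" for L
      using laplace_beltrami_sol[OF \<Omega> y sc that] L[OF that] by metis
    then show ?thesis using sc by (auto simp: complex_eq_iff)
  qed
  define F where "F = (\<lambda>x. w (G x))"
  have smF: "smooth_on \<Omega> F" using harm[OF w p\<Omega>] by (simp add: F_def)
  have lapF: "sol_lap \<alpha> F y = 0" and lapF2: "sol_lap \<alpha> (\<lambda>x. F x * F x) y = 0" if "y \<in> \<Omega>" for y
    using harm[OF w that] harm[OF conformal_coordinate_square[OF w w0] that] by (simp_all add: F_def)
  have null: "(sol_frame \<alpha> 1 F y)\<^sup>2 + (sol_frame (-1) 2 F y)\<^sup>2 + (sol_frame 0 3 F y)\<^sup>2 = 0" if "y \<in> \<Omega>" for y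
    using sol_lap_square[OF \<Omega> that smF, of \<alpha>] lapF[OF that] lapF2[OF that] by algebra
  have dF: "dirder v F x = 0" if "x \<in> \<Omega>" for v x
    by (rule sol_null_gradient_eq_0[OF \<Omega> that smF lapF null \<alpha>])
  \<comment> \<open>The differential of a conformal coordinate is injective: a vector killed by dw
    would have zero length in the metric of the surface.\<close>
  have dG: "dirder v G x = 0" if x: "x \<in> \<Omega>" for v x
  proof (rule ccontr)
    assume ne: "dirder v G x \<noteq> 0"
    have "dirder v F x = dirder (dirder v G x) w (G x)"
      unfolding F_def
      by (rule dirder_eqI[OF has_derivative_compose[OF smooth_on_has_dirder[OF smG x] smooth_on_has_dirder[OF smw GV[OF x]]]])
    then have "dirder (dirder v G x) w (G x) = 0" using dF[OF x] by simp
    moreover obtain l where "\<And>u u'. h (E, \<eta>) (G x) u u' = l * Re (dirder u w (G x) * cnj (dirder u' w (G x)))"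
      using w GV[OF x] unfolding conformal_coordinate_def by blast
    ultimately have "h (E, \<eta>) (G x) (dirder v G x) (dirder v G x) = 0" by simp
    moreover have "h (E, \<eta>) (G x) (dirder v G x) (dirder v G x) > 0"
      using b(1) V(2) GV[OF x] ne by blast
    ultimately show False by simp
  qed
  obtain e where e: "e > 0" "ball p e \<subseteq> \<Omega>" using \<Omega> p\<Omega> open_contains_ball by blast
  have "\<phi> x = \<phi> p" if x: "x \<in> ball p e" for x
  proof -
    have "(G has_derivative (\<lambda>v. 0)) (at y within ball p e)" if "y \<in> ball p e" for y
    proof -
      have y: "y \<in> \<Omega>" using that e by auto
      show ?thesis
        using has_derivative_at_withinI[OF smooth_on_has_dirder[OF smG y]] dG[OF y] by simp
    qed
    from has_derivative_zero_constant[OF convex_ball this]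
    obtain c where c: "\<And>y. y \<in> ball p e \<Longrightarrow> G y = c" by blast
    then have "\<eta> (\<phi> x) = \<eta> (\<phi> p)" using x e c[of p] by (simp add: G_def)
    moreover have "\<phi> x \<in> E" using x e by (auto simp: \<Omega>_def W_def)
    ultimately show ?thesis using E(3) chart(2) by (meson inj_onD)
  qed
  moreover have "\<Omega> \<subseteq> U" by (auto simp: \<Omega>_def)
  ultimately show ?thesis using e by blast
qed

theorem mainTheorem2:
  fixes \<alpha> :: real
    and U :: "(real^3) set"
    and B :: "('b::{second_countable_topology, t2_space}, 2) chart set"
    and h :: "('b, 2) metric"
    and \<phi> :: "real^3 \<Rightarrow> 'b"
  assumes "\<alpha> > 0"
    and "open U" and "connected U" and "U \<noteq> {}"
    and "riemannian_manifold B h"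
    and "harmonic_morphism sol_atlas (sol_metric \<alpha>) U B h \<phi>"
  shows "\<phi> constant_on U"
proof -
  have "\<forall>\<^sub>F x in at p within U. \<phi> p = \<phi> x" if p: "p \<in> U" for p
  proof -
    obtain e where e: "e > 0" "\<forall>x\<in>ball p e. x \<in> U \<and> \<phi> x = \<phi> p"
      using harmonic_morphism_locally_constant[OF assms(1,2,5,6) p] by blast
    have "\<phi> p = \<phi> x" if "dist x p < e" for x
      using e(2) that by (metis dist_commute mem_ball)
    then show ?thesis unfolding eventually_at using e(1) by blast
  qed
  then have "\<phi> x = \<phi> y" if "x \<in> U" "y \<in> U" for x y
    using connected_local_const[OF assms(3) that] by blast
  moreover obtain p where "p \<in> U" using assms(4) by blast
  ultimately show ?thesis unfolding constant_on_def by blast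
qed

end
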